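(* Let $G$ be a finite group with cyclic center, let $(i,\alpha)$ and $(j,\beta)$ be cocentral actions of $\mathbb{Z}_p$ on $G$, where $p$ is a prime number, and put $H=G/i(\widehat{\mathbb{Z}_p})=G/j(\widehat{\mathbb{Z}_p})$ (the two subgroups coincide because $Z(G)$ is cyclic). Assume that $\mathrm{Hom}(H,\mathbb{Z}_p)=\{1\}$ and that $H^2(H,k^\times)$ is trivial or cyclic of order $p$. Then the following assertions are equivalent. (1) The Hopf algebras $\mathcal{O}(G)^{i,\alpha}$ and $\mathcal{O}(G)^{j,\beta}$ are isomorphic. (2) The cocentral actions $(i,\alpha)$ and $(j,\beta)$ are equivalent.
   Context: The base field $k$ is algebraically closed of characteristic zero. For a finite group $G$, $\mathcal{O}(G)$ is the Hopf algebra of functions $G\to k$. For a group $\Gamma$, $\widehat{\Gamma}=\mathrm{Hom}(\Gamma,k^\times)$. $H^2(H,k^\times)$ is group cohomology with trivial action. A cocentral action of a finite abelian group $\Gamma$ on a finite group $G$ is a pair $(i,\alpha)$ where $i:\widehat{\Gamma}\to Z(G)$ is an injective group morphism and $\alpha:\Gamma\to\mathrm{Aut}(G)$, $g\mapsto\alpha_g$, is a group morphism such that each $\alpha_g$ fixes every element of $i(\widehat{\Gamma})$. It gives a grading $\mathcal{O}(G)=\bigoplus_{g\in\Gamma}\mathcal{O}(G)_g$ with $\mathcal{O}(G)_g=\{\phi : \phi(x\,i(\chi))=\chi(g)\phi(x)\ \forall x\in G,\chi\in\widehat\Gamma\}$, and an action of $\Gamma$ on $\mathcal{O}(G)$ by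 Hopf algebra automorphisms $\alpha_g(\phi)=\phi\circ\alpha_g^{-1}$. The graded twisting $\mathcal{O}(G)^{i,\alpha}$ is the Hopf algebra having $\mathcal{O}(G)$ as underlying coalgebra, with product $\phi\cdot\psi=\phi\,\alpha_g(\psi)$ for $\phi\in\mathcal{O}(G)_g$, $\psi\in\mathcal{O}(G)$, and antipode $\phi\mapsto\alpha_{g^{-1}}(S(\phi))$ for $\phi\in\mathcal{O}(G)_g$. Two cocentral actions $(i,\alpha)$, $(j,\beta)$ of $\Gamma$ on $G$ are equivalent if there exist $u\in\mathrm{Aut}(\Gamma)$ and $f\in\mathrm{Aut}(G)$ such that $i\circ\widehat{u}=f\circ j$ (where $\widehat{u}(\chi)=\chi\circ u$) and $f^{-1}\circ\alpha_g\circ f=\beta_{u(g)}$ for all $g\in\Gamma$. *)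

theory Defs
  imports
    "HOL-Algebra.Algebra"
    "HOL-Algebra.Algebraic_Closure_Type"
    "HOL-Library.Poly_Mapping"
begin

section \<open>Groups of homomorphisms, centre, second cohomology\<close>

text \<open>
  Homomorphisms are taken extensional on the carrier of the source, so that each of them is
  counted once; the group structure of \<open>Hom(\<Gamma>, A)\<close> is pointwise.
\<close>

definition hom_group ::
  "('c, 'm) monoid_scheme \<Rightarrow> ('a, 'n) monoid_scheme \<Rightarrow> ('c \<Rightarrow> 'a) monoid" where
  "hom_group \<Gamma> A =
    \<lparr>carrier = hom \<Gamma> A \<inter> extensional (carrier \<Gamma>),
     monoid.mult = (\<lambda>\<phi> \<psi>. \<lambda>g\<in>carrier \<Gamma>. \<phi> g \<otimes>\<^bsub>A\<^esub> \<psi> g),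
     one = (\<lambda>g\<in>carrier \<Gamma>. \<one>\<^bsub>A\<^esub>)\<rparr>"

abbreviation field_units :: "'k::field monoid" where
  "field_units \<equiv> units_of (ring_of_type_algebra :: 'k ring)"

definition dual_group :: "('c, 'm) monoid_scheme \<Rightarrow> ('c \<Rightarrow> 'k::field) monoid" where
  "dual_group \<Gamma> = hom_group \<Gamma> field_units"

lemma field_units_simps [simp]:
  "carrier (field_units :: 'k::field monoid) = {c. c \<noteq> 0}"
  "a \<otimes>\<^bsub>(field_units :: 'k::field monoid)\<^esub> b = a * b"
  "\<one>\<^bsub>(field_units :: 'k::field monoid)\<^esub> = 1"
proof -
  have "\<exists>y. y * x = 1" "\<exists>y. x * y = 1" if "x \<noteq> 0" for x :: 'k
    using that by (auto intro: exI[of _ "inverse x"])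
  then show "carrier (field_units :: 'k::field monoid) = {c. c \<noteq> 0}"
    by (auto simp: units_of_def Units_def ring_of_type_algebra_def)
      (metis mult.commute right_inverse)
qed (auto simp: units_of_def ring_of_type_algebra_def)

lemma comm_group_field_units: "comm_group (field_units :: 'k::field monoid)"
proof (rule comm_groupI)
  show "\<exists>y\<in>carrier field_units. y \<otimes>\<^bsub>field_units\<^esub> x = \<one>\<^bsub>field_units\<^esub>"
    if "x \<in> carrier field_units" for x :: 'k
    using that by (auto intro!: exI[of _ "inverse x"])
qed auto

lemma comm_group_hom_group:
  assumes "group \<Gamma>" "comm_group A"
  shows "comm_group (hom_group \<Gamma> A)"
proof -
  interpret \<Gamma>: group \<Gamma> by fact
  interpret A: comm_group A by fact
  show ?thesis
  proof (rule comm_groupI)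
    fix x assume x: "x \<in> carrier (hom_group \<Gamma> A)"
    show "\<exists>y\<in>carrier (hom_group \<Gamma> A). y \<otimes>\<^bsub>hom_group \<Gamma> A\<^esub> x = \<one>\<^bsub>hom_group \<Gamma> A\<^esub>"
      using x by (intro bexI[of _ "\<lambda>g\<in>carrier \<Gamma>. inv\<^bsub>A\<^esub> (x g)"])
        (auto simp: hom_group_def hom_def Pi_iff A.inv_mult A.m_comm intro!: restrict_ext)
  qed (auto simp: hom_group_def hom_def Pi_iff extensional_def fun_eq_iff A.m_ac)
qed

lemma comm_group_dual_group: "group \<Gamma> \<Longrightarrow> comm_group (dual_group \<Gamma> :: ('c \<Rightarrow> 'k::field) monoid)"
  unfolding dual_group_def by (rule comm_group_hom_group[OF _ comm_group_field_units])

definition group_center :: "('g, 'm) monoid_scheme \<Rightarrow> 'g set" where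
  "group_center G = {z \<in> carrier G. \<forall>x\<in>carrier G. z \<otimes>\<^bsub>G\<^esub> x = x \<otimes>\<^bsub>G\<^esub> z}"

text \<open>
  Inhomogeneous 2-cocycles and 2-coboundaries of \<^term>\<open>H\<close> with coefficients in the abelian
  group \<^term>\<open>A\<close>, on which \<^term>\<open>H\<close> acts trivially.
\<close>

definition cochain2_group ::
  "('h, 'm) monoid_scheme \<Rightarrow> ('a, 'n) monoid_scheme \<Rightarrow> ('h \<times> 'h \<Rightarrow> 'a) monoid" where
  "cochain2_group H A =
    \<lparr>carrier = carrier H \<times> carrier H \<rightarrow>\<^sub>E carrier A,
     monoid.mult = (\<lambda>c d. \<lambda>p\<in>carrier H \<times> carrier H. c p \<otimes>\<^bsub>A\<^esub> d p),
     one = (\<lambda>p\<in>carrier H \<times> carrier H. \<one>\<^bsub>A\<^esub>)\<rparr>"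

definition cocycles2 ::
  "('h, 'm) monoid_scheme \<Rightarrow> ('a, 'n) monoid_scheme \<Rightarrow> ('h \<times> 'h \<Rightarrow> 'a) set" where
  "cocycles2 H A =
    {c \<in> carrier H \<times> carrier H \<rightarrow>\<^sub>E carrier A.
      \<forall>x\<in>carrier H. \<forall>y\<in>carrier H. \<forall>z\<in>carrier H.
        c (y, z) \<otimes>\<^bsub>A\<^esub> c (x, y \<otimes>\<^bsub>H\<^esub> z) = c (x \<otimes>\<^bsub>H\<^esub> y, z) \<otimes>\<^bsub>A\<^esub> c (x, y)}"

definition coboundaries2 ::
  "('h, 'm) monoid_scheme \<Rightarrow> ('a, 'n) monoid_scheme \<Rightarrow> ('h \<times> 'h \<Rightarrow> 'a) set" where
  "coboundaries2 H A =
    (\<lambda>m. \<lambda>(x, y)\<in>carrier H \<times> carrier H.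
      m y \<otimes>\<^bsub>A\<^esub> inv\<^bsub>A\<^esub> (m (x \<otimes>\<^bsub>H\<^esub> y)) \<otimes>\<^bsub>A\<^esub> m x) ` (carrier H \<rightarrow> carrier A)"

definition cohomology2 ::
  "('h, 'm) monoid_scheme \<Rightarrow> ('a, 'n) monoid_scheme \<Rightarrow> ('h \<times> 'h \<Rightarrow> 'a) set monoid" where
  "cohomology2 H A = (cochain2_group H A)\<lparr>carrier := cocycles2 H A\<rparr> Mod coboundaries2 H A"

lemma comm_group_cohomology2:
  assumes "group H" "comm_group A"
  shows "comm_group (cohomology2 H A)"
proof -
  interpret H: group H by fact
  interpret A: comm_group A by fact
  let ?C = "cochain2_group H A" and ?Z = "(cochain2_group H A)\<lparr>carrier := cocycles2 H A\<rparr>"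
  have comm: "comm_group ?Z"
  proof (rule comm_groupI)
    fix c d assume c: "c \<in> carrier ?Z" and d: "d \<in> carrier ?Z"
    have "(c (y, z) \<otimes>\<^bsub>A\<^esub> d (y, z)) \<otimes>\<^bsub>A\<^esub> (c (x, y \<otimes>\<^bsub>H\<^esub> z) \<otimes>\<^bsub>A\<^esub> d (x, y \<otimes>\<^bsub>H\<^esub> z)) =
        (c (x \<otimes>\<^bsub>H\<^esub> y, z) \<otimes>\<^bsub>A\<^esub> d (x \<otimes>\<^bsub>H\<^esub> y, z)) \<otimes>\<^bsub>A\<^esub> (c (x, y) \<otimes>\<^bsub>A\<^esub> d (x, y))"
      if "x \<in> carrier H" "y \<in> carrier H" "z \<in> carrier H" for x y z
    proof -
      have cl: "c (u, v) \<in> carrier A" "d (u, v) \<in> carrier A"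
        if "u \<in> carrier H" "v \<in> carrier H" for u v
        using c d that by (auto simp: cocycles2_def PiE_iff)
      have "c (y, z) \<otimes>\<^bsub>A\<^esub> c (x, y \<otimes>\<^bsub>H\<^esub> z) = c (x \<otimes>\<^bsub>H\<^esub> y, z) \<otimes>\<^bsub>A\<^esub> c (x, y)"
        "d (y, z) \<otimes>\<^bsub>A\<^esub> d (x, y \<otimes>\<^bsub>H\<^esub> z) = d (x \<otimes>\<^bsub>H\<^esub> y, z) \<otimes>\<^bsub>A\<^esub> d (x, y)"
        using c d that by (auto simp: cocycles2_def)
      moreover have swap: "(a \<otimes>\<^bsub>A\<^esub> b) \<otimes>\<^bsub>A\<^esub> (a' \<otimes>\<^bsub>A\<^esub> b') = (a \<otimes>\<^bsub>A\<^esub> a') \<otimes>\<^bsub>A\<^esub> (b \<otimes>\<^bsub>A\<^esub> b')"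
        if "a \<in> carrier A" "b \<in> carrier A" "a' \<in> carrier A" "b' \<in> carrier A" for a b a' b'
        using that by (simp add: A.m_ac)
      ultimately show ?thesis
        using that cl swap[of "c (y, z)" "d (y, z)"] swap[of "c (x \<otimes>\<^bsub>H\<^esub> y, z)" "d (x \<otimes>\<^bsub>H\<^esub> y, z)"]
        by (metis H.m_closed)
    qed
    then show "c \<otimes>\<^bsub>?Z\<^esub> d \<in> carrier ?Z"
      using c d by (auto simp: cocycles2_def cochain2_group_def PiE_iff)
  next
    fix c assume c: "c \<in> carrier ?Z"
    have "inv\<^bsub>A\<^esub> c (y, z) \<otimes>\<^bsub>A\<^esub> inv\<^bsub>A\<^esub> c (x, y \<otimes>\<^bsub>H\<^esub> z) = inv\<^bsub>A\<^esub> c (x \<otimes>\<^bsub>H\<^esub> y, z) \<otimes>\<^bsub>A\<^esub> inv\<^bsub>A\<^esub> c (x, y)"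
      if "x \<in> carrier H" "y \<in> carrier H" "z \<in> carrier H" for x y z
    proof -
      have cl: "c (u, v) \<in> carrier A" if "u \<in> carrier H" "v \<in> carrier H" for u v
        using c that by (auto simp: cocycles2_def PiE_iff)
      have "c (y, z) \<otimes>\<^bsub>A\<^esub> c (x, y \<otimes>\<^bsub>H\<^esub> z) = c (x \<otimes>\<^bsub>H\<^esub> y, z) \<otimes>\<^bsub>A\<^esub> c (x, y)"
        using c that by (auto simp: cocycles2_def)
      then show ?thesis using that cl by (simp flip: A.inv_mult)
    qed
    then show "\<exists>d\<in>carrier ?Z. d \<otimes>\<^bsub>?Z\<^esub> c = \<one>\<^bsub>?Z\<^esub>"
      using c by (intro bexI[of _ "\<lambda>p\<in>carrier H \<times> carrier H. inv\<^bsub>A\<^esub> (c p)"])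
        (auto simp: cocycles2_def cochain2_group_def PiE_iff intro!: restrict_ext)
  qed (auto simp: cocycles2_def cochain2_group_def PiE_iff fun_eq_iff extensional_def A.m_ac)
  interpret Z: comm_group ?Z by (fact comm)
  define bd where "bd m = (\<lambda>(x, y)\<in>carrier H \<times> carrier H.
      m y \<otimes>\<^bsub>A\<^esub> inv\<^bsub>A\<^esub> (m (x \<otimes>\<^bsub>H\<^esub> y)) \<otimes>\<^bsub>A\<^esub> m x)" for m
  have bd_Z: "bd m \<in> cocycles2 H A" if m: "m \<in> carrier H \<rightarrow> carrier A" for m
  proof -
    have cl: "m u \<in> carrier A" if "u \<in> carrier H" for u using m that by auto
    have cancel: "(c \<otimes>\<^bsub>A\<^esub> inv\<^bsub>A\<^esub> e \<otimes>\<^bsub>A\<^esub> b) \<otimes>\<^bsub>A\<^esub> (e \<otimes>\<^bsub>A\<^esub> inv\<^bsub>A\<^esub> t \<otimes>\<^bsub>A\<^esub> a) =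
        (c \<otimes>\<^bsub>A\<^esub> inv\<^bsub>A\<^esub> t \<otimes>\<^bsub>A\<^esub> d) \<otimes>\<^bsub>A\<^esub> (b \<otimes>\<^bsub>A\<^esub> inv\<^bsub>A\<^esub> d \<otimes>\<^bsub>A\<^esub> a)"
      if X: "a \<in> carrier A" "b \<in> carrier A" "c \<in> carrier A" "d \<in> carrier A" "e \<in> carrier A"
        "t \<in> carrier A" for a b c d e t
    proof -
      have cancel: "u \<otimes>\<^bsub>A\<^esub> (inv\<^bsub>A\<^esub> u \<otimes>\<^bsub>A\<^esub> v) = v" if "u \<in> carrier A" "v \<in> carrier A" for u v
        using that by (simp flip: A.m_assoc)
      from X show ?thesis by (simp add: A.m_ac cancel)
    qed
    show ?thesis
      using cl cancel by (auto simp: cocycles2_def bd_def PiE_iff H.m_assoc)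
  qed
  have B: "coboundaries2 H A = bd ` (carrier H \<rightarrow> carrier A)"
    by (auto simp: coboundaries2_def bd_def[abs_def])
  have mult: "bd m \<otimes>\<^bsub>?Z\<^esub> bd n = bd (\<lambda>x. m x \<otimes>\<^bsub>A\<^esub> n x)"
    if m: "m \<in> carrier H \<rightarrow> carrier A" and n: "n \<in> carrier H \<rightarrow> carrier A" for m n
  proof -
    have cl: "m u \<in> carrier A" "n u \<in> carrier A" if "u \<in> carrier H" for u using m n that by auto
    show ?thesis
      using cl by (auto simp: cochain2_group_def bd_def fun_eq_iff A.inv_mult A.m_ac)
  qed
  have one: "bd (\<lambda>_. \<one>\<^bsub>A\<^esub>) = \<one>\<^bsub>?Z\<^esub>"
    by (auto simp: cochain2_group_def bd_def fun_eq_iff)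
  have sub: "subgroup (coboundaries2 H A) ?Z"
  proof
    show "coboundaries2 H A \<subseteq> carrier ?Z" using bd_Z by (auto simp: B)
    show "\<one>\<^bsub>?Z\<^esub> \<in> coboundaries2 H A" unfolding B one[symmetric] by auto
  next
    fix c d assume "c \<in> coboundaries2 H A" "d \<in> coboundaries2 H A"
    then obtain m n where m: "m \<in> carrier H \<rightarrow> carrier A" "n \<in> carrier H \<rightarrow> carrier A"
      "c = bd m" "d = bd n" by (auto simp: B)
    then show "c \<otimes>\<^bsub>?Z\<^esub> d \<in> coboundaries2 H A"
      unfolding B using mult[of m n] by (auto intro!: image_eqI[of _ _ "\<lambda>x. m x \<otimes>\<^bsub>A\<^esub> n x"])
  next
    fix c assume "c \<in> coboundaries2 H A"
    then obtain m where m: "m \<in> carrier H \<rightarrow> carrier A" "c = bd m" by (auto simp: B)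
    let ?n = "\<lambda>x. inv\<^bsub>A\<^esub> (m x)"
    have n: "?n \<in> carrier H \<rightarrow> carrier A" using m by auto
    have eq: "bd ?n \<otimes>\<^bsub>?Z\<^esub> c = bd (\<lambda>x. ?n x \<otimes>\<^bsub>A\<^esub> m x)" using mult[OF n m(1)] m(2) by simp
    also have "\<dots> = bd (\<lambda>_. \<one>\<^bsub>A\<^esub>)"
      using m(1) by (auto simp: bd_def fun_eq_iff Pi_iff)
    finally have "bd ?n \<otimes>\<^bsub>?Z\<^esub> c = \<one>\<^bsub>?Z\<^esub>" using one by simp
    moreover have "c \<in> carrier ?Z" "bd ?n \<in> carrier ?Z" using bd_Z m n by auto
    ultimately have "inv\<^bsub>?Z\<^esub> c = bd ?n" by (intro Z.inv_equality)
    then show "inv\<^bsub>?Z\<^esub> c \<in> coboundaries2 H A" using n by (auto simp: B)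
  qed
  then show ?thesis unfolding cohomology2_def by (rule Z.abelian_FactGroup)
qed


section \<open>Hopf algebras and their isomorphisms\<close>

text \<open>
  The tensor square \<open>V \<otimes> V\<close> of a \<open>k\<close>-vector space is the quotient of the free vector space on
  \<open>V \<times> V\<close> by the subspace \<open>tensor_rel V\<close> spanned by the bilinearity relations. Its elements
  are the cosets \<open>tensor_class V t\<close>.
\<close>

inductive_set tensor_rel ::
  "('k::field, 'v, 'm) module_scheme \<Rightarrow> ('v \<times> 'v \<Rightarrow>\<^sub>0 'k) set"
  for V :: "('k, 'v, 'm) module_scheme" where
  zero: "0 \<in> tensor_rel V"
| add: "s \<in> tensor_rel V \<Longrightarrow> t \<in> tensor_rel V \<Longrightarrow> s + t \<in> tensor_rel V"
| add_left: "u \<in> carrier V \<Longrightarrow> v \<in> carrier V \<Longrightarrow> w \<in> carrier V \<Longrightarrow>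
    Poly_Mapping.single (u \<oplus>\<^bsub>V\<^esub> v, w) c - Poly_Mapping.single (u, w) c
      - Poly_Mapping.single (v, w) c \<in> tensor_rel V"
| add_right: "u \<in> carrier V \<Longrightarrow> v \<in> carrier V \<Longrightarrow> w \<in> carrier V \<Longrightarrow>
    Poly_Mapping.single (u, v \<oplus>\<^bsub>V\<^esub> w) c - Poly_Mapping.single (u, v) c
      - Poly_Mapping.single (u, w) c \<in> tensor_rel V"
| smult_left: "u \<in> carrier V \<Longrightarrow> v \<in> carrier V \<Longrightarrow>
    Poly_Mapping.single (a \<odot>\<^bsub>V\<^esub> u, v) c - Poly_Mapping.single (u, v) (c * a) \<in> tensor_rel V"
| smult_right: "u \<in> carrier V \<Longrightarrow> v \<in> carrier V \<Longrightarrow>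
    Poly_Mapping.single (u, a \<odot>\<^bsub>V\<^esub> v) c - Poly_Mapping.single (u, v) (c * a) \<in> tensor_rel V"

definition tensor_class ::
  "('k::field, 'v, 'm) module_scheme \<Rightarrow> ('v \<times> 'v \<Rightarrow>\<^sub>0 'k) \<Rightarrow> ('v \<times> 'v \<Rightarrow>\<^sub>0 'k) set" where
  "tensor_class V t =
    {s. Poly_Mapping.keys s \<subseteq> carrier V \<times> carrier V \<and> s - t \<in> tensor_rel V}"

definition free_map :: "('v \<Rightarrow> 'w) \<Rightarrow> ('v \<times> 'v \<Rightarrow>\<^sub>0 'k::field) \<Rightarrow> ('w \<times> 'w \<Rightarrow>\<^sub>0 'k)" where
  "free_map f t = (\<Sum>p\<in>Poly_Mapping.keys t.
    Poly_Mapping.single (map_prod f f p) (Poly_Mapping.lookup t p))"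

text \<open>
  The map \<open>f \<otimes> f : V \<otimes> V \<rightarrow> W \<otimes> W\<close> induced by a linear map \<open>f : V \<rightarrow> W\<close>; the union merely
  expresses independence of the representative, see \<open>tensor_map_class\<close> below.
\<close>

definition tensor_map ::
  "('k::field, 'w, 'm) module_scheme \<Rightarrow> ('v \<Rightarrow> 'w) \<Rightarrow>
    ('v \<times> 'v \<Rightarrow>\<^sub>0 'k) set \<Rightarrow> ('w \<times> 'w \<Rightarrow>\<^sub>0 'k) set" where
  "tensor_map W f T = (\<Union>t\<in>T. tensor_class W (free_map f t))"

lemma tensor_rel_uminus: "t \<in> tensor_rel V \<Longrightarrow> - t \<in> tensor_rel V"
proof (induction rule: tensor_rel.induct)
  case zero
  show ?case using tensor_rel.zero by simp
next
  case (add s t)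
  from tensor_rel.add[OF add.IH] show ?case by (simp add: add.commute)
next
  case (add_left u v w c)
  from tensor_rel.add_left[OF this, of "- c"] show ?case
    by (simp add: single_uminus algebra_simps)
next
  case (add_right u v w c)
  from tensor_rel.add_right[OF this, of "- c"] show ?case
    by (simp add: single_uminus algebra_simps)
next
  case (smult_left u v a c)
  from tensor_rel.smult_left[OF this, of a "- c"] show ?case
    by (simp add: single_uminus algebra_simps)
next
  case (smult_right u v a c)
  from tensor_rel.smult_right[OF this, of a "- c"] show ?case
    by (simp add: single_uminus algebra_simps)
qed

lemma free_map_superset:
  assumes "finite K" "Poly_Mapping.keys t \<subseteq> K"
  shows "free_map f t = (\<Sum>p\<in>K. Poly_Mapping.single (map_prod f f p) (Poly_Mapping.lookup t p))"
  unfolding free_map_def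
  by (rule sum.mono_neutral_left) (use assms in \<open>auto simp: in_keys_iff\<close>)

lemma free_map_add: "free_map f (s + t) = free_map f s + free_map f t"
proof -
  let ?K = "Poly_Mapping.keys s \<union> Poly_Mapping.keys t"
  have "Poly_Mapping.keys (s + t) \<subseteq> ?K" by (rule Poly_Mapping.keys_add)
  then show ?thesis
    by (subst (1 2 3) free_map_superset[of ?K])
      (auto simp: lookup_add single_add sum.distrib)
qed

lemma free_map_single: "free_map f (Poly_Mapping.single (u, v) c) = Poly_Mapping.single (f u, f v) c"
  by (subst free_map_superset[of "{(u, v)}"]) auto

lemma free_map_uminus: "free_map f (- t) = - free_map f t"
  using free_map_add[of f t "- t"] by (simp add: free_map_def eq_neg_iff_add_eq_0 add.commute)

lemma free_map_diff: "free_map f (s - t) = free_map f s - free_map f t"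
  using free_map_add[of f s "- t"] by (simp add: free_map_uminus)

lemma free_map_tensor_rel:
  assumes f: "f \<in> carrier V \<rightarrow> carrier W"
    and f_add: "\<And>u v. u \<in> carrier V \<Longrightarrow> v \<in> carrier V \<Longrightarrow> f (u \<oplus>\<^bsub>V\<^esub> v) = f u \<oplus>\<^bsub>W\<^esub> f v"
    and f_smult: "\<And>a u. u \<in> carrier V \<Longrightarrow> f (a \<odot>\<^bsub>V\<^esub> u) = a \<odot>\<^bsub>W\<^esub> f u"
    and t: "t \<in> tensor_rel V"
  shows "free_map f t \<in> tensor_rel W"
  using t
proof (induction rule: tensor_rel.induct)
  case zero
  show ?case by (simp add: free_map_def tensor_rel.zero)
next
  case (add s t)
  then show ?case by (simp add: free_map_add tensor_rel.add)
next
  case (add_left u v w c)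
  with f have "f u \<in> carrier W" "f v \<in> carrier W" "f w \<in> carrier W" by auto
  from tensor_rel.add_left[OF this, of c] add_left show ?case
    by (simp add: free_map_diff free_map_single f_add)
next
  case (add_right u v w c)
  with f have "f u \<in> carrier W" "f v \<in> carrier W" "f w \<in> carrier W" by auto
  from tensor_rel.add_right[OF this, of c] add_right show ?case
    by (simp add: free_map_diff free_map_single f_add)
next
  case (smult_left u v a c)
  with f have "f u \<in> carrier W" "f v \<in> carrier W" by auto
  from tensor_rel.smult_left[OF this, of a c] smult_left show ?case
    by (simp add: free_map_diff free_map_single f_smult)
next
  case (smult_right u v a c)
  with f have "f u \<in> carrier W" "f v \<in> carrier W" by auto
  from tensor_rel.smult_right[OF this, of a c] smult_right show ?case
    by (simp add: free_map_diff free_map_single f_smult)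
qed

lemma tensor_class_eqI:
  assumes "s - t \<in> tensor_rel V"
  shows "tensor_class V s = tensor_class V t"
proof -
  have "t - s \<in> tensor_rel V" using tensor_rel_uminus[OF assms] by simp
  then show ?thesis
    using assms unfolding tensor_class_def
    by (auto dest: tensor_rel.add[of "_ - s" V "s - t"] tensor_rel.add[of "_ - t" V "t - s"])
qed

lemma tensor_map_class:
  assumes f: "f \<in> carrier V \<rightarrow> carrier W"
    and f_add: "\<And>u v. u \<in> carrier V \<Longrightarrow> v \<in> carrier V \<Longrightarrow> f (u \<oplus>\<^bsub>V\<^esub> v) = f u \<oplus>\<^bsub>W\<^esub> f v"
    and f_smult: "\<And>a u. u \<in> carrier V \<Longrightarrow> f (a \<odot>\<^bsub>V\<^esub> u) = a \<odot>\<^bsub>W\<^esub> f u"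
    and t: "Poly_Mapping.keys t \<subseteq> carrier V \<times> carrier V"
  shows "tensor_map W f (tensor_class V t) = tensor_class W (free_map f t)"
proof -
  have "t \<in> tensor_class V t" using t by (simp add: tensor_class_def tensor_rel.zero)
  moreover have "tensor_class W (free_map f s) = tensor_class W (free_map f t)"
    if "s \<in> tensor_class V t" for s
    using free_map_tensor_rel[OF f f_add f_smult, of "s - t"] that
    by (intro tensor_class_eqI) (simp add: tensor_class_def free_map_diff)
  ultimately show ?thesis unfolding tensor_map_def by blast
qed

lemma tensor_class_cong:
  assumes "carrier V = carrier W" "ring.add V = ring.add W" "module.smult V = module.smult W"
  shows "tensor_class V = tensor_class W"
proof -
  have "free_map id t = t" for t :: "'a \<times> 'a \<Rightarrow>\<^sub>0 'b"
    unfolding free_map_def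
    by (rule poly_mapping_eqI)
      (simp add: prod.map_id0 lookup_sum lookup_single when_def in_keys_iff)
  then have "tensor_rel V \<subseteq> tensor_rel W" "tensor_rel W \<subseteq> tensor_rel V"
    using free_map_tensor_rel[of id V W] free_map_tensor_rel[of id W V] assms by auto
  then show ?thesis using assms(1) by (auto simp: tensor_class_def fun_eq_iff)
qed

record (overloaded) ('k, 'v) hopf_algebra = "('k, 'v) module" +
  comult :: "'v \<Rightarrow> ('v \<times> 'v \<Rightarrow>\<^sub>0 'k) set"
  counit :: "'v \<Rightarrow> 'k"
  antipode :: "'v \<Rightarrow> 'v"

definition hopf_iso ::
  "('k::field, 'v, 'm) hopf_algebra_scheme \<Rightarrow> ('k, 'w, 'n) hopf_algebra_scheme \<Rightarrow>
    ('v \<Rightarrow> 'w) set" where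
  "hopf_iso A B = {f \<in> ring_hom A B. bij_betw f (carrier A) (carrier B) \<and>
    (\<forall>a\<in>carrier A. (\<forall>c. f (c \<odot>\<^bsub>A\<^esub> a) = c \<odot>\<^bsub>B\<^esub> f a) \<and>
      comult B (f a) = tensor_map B f (comult A a) \<and>
      counit B (f a) = counit A a \<and>
      f (antipode A a) = antipode B (f a))}"

definition hopf_isomorphic ::
  "('k::field, 'v, 'm) hopf_algebra_scheme \<Rightarrow> ('k, 'w, 'n) hopf_algebra_scheme \<Rightarrow> bool" where
  "hopf_isomorphic A B \<longleftrightarrow> hopf_iso A B \<noteq> {}"


section \<open>The Hopf algebra of functions on a finite group\<close>

definition function_algebra :: "('g, 'm) monoid_scheme \<Rightarrow> ('k::field, 'g \<Rightarrow> 'k) module" where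
  "function_algebra G =
    \<lparr>carrier = extensional (carrier G),
     monoid.mult = (\<lambda>\<phi> \<psi>. \<lambda>x\<in>carrier G. \<phi> x * \<psi> x),
     one = (\<lambda>x\<in>carrier G. 1),
     ring.zero = (\<lambda>x\<in>carrier G. 0),
     ring.add = (\<lambda>\<phi> \<psi>. \<lambda>x\<in>carrier G. \<phi> x + \<psi> x),
     module.smult = (\<lambda>c \<phi>. \<lambda>x\<in>carrier G. c * \<phi> x)\<rparr>"

definition delta_fun :: "('g, 'm) monoid_scheme \<Rightarrow> 'g \<Rightarrow> ('g \<Rightarrow> 'k::field)" where
  "delta_fun G x = (\<lambda>y\<in>carrier G. if y = x then 1 else 0)"

text \<open>
  The comultiplication is dual to the product of \<open>G\<close>: under \<open>\<O>(G) \<otimes> \<O>(G) \<cong> \<O>(G \<times> G)\<close>,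
  \<open>\<Delta>(\<phi>)\<close> is the function \<open>(x, y) \<mapsto> \<phi>(xy)\<close>, that is, the tensor
  \<open>\<Sum>x y. \<phi>(xy) \<delta>\<^sub>x \<otimes> \<delta>\<^sub>y\<close>.
\<close>

definition function_hopf :: "('g, 'm) monoid_scheme \<Rightarrow> ('k::field, 'g \<Rightarrow> 'k) hopf_algebra" where
  "function_hopf G = module.extend (function_algebra G) (hopf_algebra.fields
    (\<lambda>\<phi>. tensor_class (function_algebra G)
      (\<Sum>x\<in>carrier G. \<Sum>y\<in>carrier G.
        Poly_Mapping.single (delta_fun G x, delta_fun G y) (\<phi> (x \<otimes>\<^bsub>G\<^esub> y))))
    (\<lambda>\<phi>. \<phi> \<one>\<^bsub>G\<^esub>)
    (\<lambda>\<phi>. \<lambda>x\<in>carrier G. \<phi> (inv\<^bsub>G\<^esub> x)))"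


section \<open>Cocentral actions and graded twisting\<close>

locale cocentral_action = \<Gamma>: comm_group \<Gamma> + G: group G
  for \<Gamma> :: "('c, 'n) monoid_scheme" and G :: "('g, 'm) monoid_scheme" +
  fixes i :: "('c \<Rightarrow> 'k::field) \<Rightarrow> 'g" and \<alpha> :: "'c \<Rightarrow> 'g \<Rightarrow> 'g"
  assumes finite_\<Gamma>: "finite (carrier \<Gamma>)"
    and finite_G: "finite (carrier G)"
    and i_hom: "i \<in> hom (dual_group \<Gamma>) (G\<lparr>carrier := group_center G\<rparr>)"
    and i_inj: "inj_on i (carrier (dual_group \<Gamma>))"
    and \<alpha>_hom: "\<alpha> \<in> hom \<Gamma> (AutoGroup G)"
    and \<alpha>_fixes: "g \<in> carrier \<Gamma> \<Longrightarrow> \<chi> \<in> carrier (dual_group \<Gamma>) \<Longrightarrow> \<alpha> g (i \<chi>) = i \<chi>"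

lemma (in group) finite_cyclic_subgroups_eq:
  assumes cyc: "cyclic_group G" and fin: "finite (carrier G)"
    and AB: "subgroup A G" "subgroup B G" "card A = card B"
  shows "A = B"
proof -
  obtain x where x: "x \<in> carrier G" and gen: "subgroup_generated G {x} = G"
    using cyc by (auto simp: cyclic_group_def)
  have range: "carrier G = range (\<lambda>n::int. x [^] n)"
    using carrier_subgroup_generated_by_singleton[OF x] gen by simp
  have ord: "ord x = Coset.order G" using cyclic_order_is_ord[OF x] gen by simp
  define d where "d = card A"
  have finA: "finite A" using AB(1) fin subgroup.subset finite_subset by blast
  then have d: "d > 0" using AB(1) subgroup.one_closed by (fastforce simp: d_def card_gt_0_iff)
  have "d * card (rcosets A) = Coset.order G" using lagrange[OF AB(1)] by (simp add: d_def mult.commute)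
  then obtain m where m: "Coset.order G = d * m" by metis
  define S where "S = (\<lambda>l::int. x [^] (int m * l)) ` {0..<int d}"
  have sub: "C \<subseteq> S" if C: "subgroup C G" "card C = d" for C
  proof
    fix a assume a: "a \<in> C"
    interpret C: group "G\<lparr>carrier := C\<rparr>" using C(1) by (rule subgroup_imp_group)
    have aG: "a \<in> carrier G" using a C(1) subgroup.mem_carrier by metis
    then obtain k :: int where k: "a = x [^] k" using range by auto
    have "a [^] d = \<one>"
      using C.pow_order_eq_1[of a] a C(2) by (simp add: Coset.order_def nat_pow_consistent[symmetric])
    then have "x [^] (k * int d) = \<one>" using x by (simp add: k int_pow_pow int_pow_int[symmetric])
    then have "int (d * m) dvd k * int d" using x ord m by (simp add: int_pow_eq_id)
    then have "int m dvd k" using d by (simp add: mult.commute)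
    then obtain q where q: "k = int m * q" by auto
    have "int (ord x) dvd k - int m * (q mod int d)"
    proof
      have "k - int m * (q mod int d) = int m * (q - q mod int d)"
        by (simp add: q right_diff_distrib)
      also have "\<dots> = int (ord x) * (q div int d)"
        by (simp add: minus_mod_eq_mult_div ord m)
      finally show "k - int m * (q mod int d) = int (ord x) * (q div int d)" .
    qed
    then have "a = x [^] (int m * (q mod int d))" using x by (simp add: k int_pow_eq dvd_diff_commute)
    then show "a \<in> S" using d by (simp add: S_def)
  qed
  have "finite S" "card S \<le> d" unfolding S_def using card_image_le[of "{0..<int d}"] by auto
  then have "C = S" if "subgroup C G" "card C = d" for C
    using sub[OF that] that(2) by (intro card_seteq) auto
  then show ?thesis using AB d_def by metis
qed

lemma cocentral_images_eq:
  fixes G :: "('g, 'm) monoid_scheme" and \<Gamma> :: "('c, 'n) monoid_scheme"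
    and i j :: "('c \<Rightarrow> 'k::field) \<Rightarrow> 'g"
  assumes "cocentral_action \<Gamma> G i \<alpha>" "cocentral_action \<Gamma> G j \<beta>"
    and "cyclic_group (G\<lparr>carrier := group_center G\<rparr>)"
  shows "i ` carrier (dual_group \<Gamma>) = j ` carrier (dual_group \<Gamma>)"
proof -
  interpret I: cocentral_action \<Gamma> G i \<alpha> by fact
  interpret J: cocentral_action \<Gamma> G j \<beta> by fact
  let ?D = "dual_group \<Gamma> :: ('c \<Rightarrow> 'k) monoid" and ?Z = "G\<lparr>carrier := group_center G\<rparr>"
  interpret D: comm_group ?D using comm_group_dual_group I.\<Gamma>.is_group by blast
  have "subgroup (group_center G) G"
  proof
    fix x y assume xy: "x \<in> group_center G" "y \<in> group_center G"
    have "(x \<otimes>\<^bsub>G\<^esub> y) \<otimes>\<^bsub>G\<^esub> z = z \<otimes>\<^bsub>G\<^esub> (x \<otimes>\<^bsub>G\<^esub> y)" if z: "z \<in> carrier G" for z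
    proof -
      have cl: "x \<in> carrier G" "y \<in> carrier G" using xy by (auto simp: group_center_def)
      have "(x \<otimes>\<^bsub>G\<^esub> y) \<otimes>\<^bsub>G\<^esub> z = x \<otimes>\<^bsub>G\<^esub> (z \<otimes>\<^bsub>G\<^esub> y)"
        using cl z xy(2) by (simp add: I.G.m_assoc group_center_def)
      also have "\<dots> = (z \<otimes>\<^bsub>G\<^esub> x) \<otimes>\<^bsub>G\<^esub> y"
        using cl z xy(1) by (simp add: group_center_def flip: I.G.m_assoc)
      finally show ?thesis using cl z by (simp add: I.G.m_assoc)
    qed
    moreover have "x \<otimes>\<^bsub>G\<^esub> y \<in> carrier G" using xy unfolding group_center_def by blast
    ultimately show "x \<otimes>\<^bsub>G\<^esub> y \<in> group_center G" unfolding group_center_def by blast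
  next
    fix x assume x: "x \<in> group_center G"
    have "inv\<^bsub>G\<^esub> x \<otimes>\<^bsub>G\<^esub> z = z \<otimes>\<^bsub>G\<^esub> inv\<^bsub>G\<^esub> x" if z: "z \<in> carrier G" for z
    proof -
      have cl: "x \<in> carrier G" and comm: "x \<otimes>\<^bsub>G\<^esub> z = z \<otimes>\<^bsub>G\<^esub> x"
        using x z unfolding group_center_def by blast+
      have "inv\<^bsub>G\<^esub> x \<otimes>\<^bsub>G\<^esub> z = inv\<^bsub>G\<^esub> x \<otimes>\<^bsub>G\<^esub> (z \<otimes>\<^bsub>G\<^esub> x) \<otimes>\<^bsub>G\<^esub> inv\<^bsub>G\<^esub> x"
        using cl z by (simp add: I.G.m_assoc)
      also have "\<dots> = inv\<^bsub>G\<^esub> x \<otimes>\<^bsub>G\<^esub> (x \<otimes>\<^bsub>G\<^esub> z) \<otimes>\<^bsub>G\<^esub> inv\<^bsub>G\<^esub> x"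
        by (simp only: comm)
      also have "\<dots> = z \<otimes>\<^bsub>G\<^esub> inv\<^bsub>G\<^esub> x"
        using cl z by (simp flip: I.G.m_assoc)
      finally show ?thesis .
    qed
    moreover have "inv\<^bsub>G\<^esub> x \<in> carrier G" using x unfolding group_center_def by blast
    ultimately show "inv\<^bsub>G\<^esub> x \<in> group_center G" unfolding group_center_def by blast
  qed (auto simp: group_center_def)
  then interpret Z: group ?Z by (rule I.G.subgroup_imp_group)
  have "group_hom ?D ?Z i" "group_hom ?D ?Z j"
    using I.i_hom J.i_hom by (auto simp: group_hom_def group_hom_axioms_def)
  then have "subgroup (i ` carrier ?D) ?Z" "subgroup (j ` carrier ?D) ?Z"
    using group_hom.img_is_subgroup by blast+
  moreover have "finite (carrier ?Z)"
    using I.finite_G by (auto simp: group_center_def)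
  moreover have "card (i ` carrier ?D) = card (j ` carrier ?D)"
    using I.i_inj J.i_inj by (simp add: card_image)
  ultimately show ?thesis by (intro Z.finite_cyclic_subgroups_eq assms(3))
qed

definition grade ::
  "('c, 'n) monoid_scheme \<Rightarrow> ('g, 'm) monoid_scheme \<Rightarrow> (('c \<Rightarrow> 'k::field) \<Rightarrow> 'g) \<Rightarrow> 'c \<Rightarrow>
    ('g \<Rightarrow> 'k) set" where
  "grade \<Gamma> G i g = {\<phi> \<in> extensional (carrier G).
    \<forall>x\<in>carrier G. \<forall>\<chi>\<in>carrier (dual_group \<Gamma>). \<phi> (x \<otimes>\<^bsub>G\<^esub> i \<chi>) = \<chi> g * \<phi> x}"

text \<open>
  The family of homogeneous components \<open>\<phi>\<^sub>g \<in> \<O>(G)\<^sub>g\<close> of \<open>\<phi> = \<Sum>g\<in>\<Gamma>. \<phi>\<^sub>g\<close>.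
\<close>

definition components ::
  "('c, 'n) monoid_scheme \<Rightarrow> ('g, 'm) monoid_scheme \<Rightarrow> (('c \<Rightarrow> 'k::field) \<Rightarrow> 'g) \<Rightarrow>
    ('g \<Rightarrow> 'k) \<Rightarrow> 'c \<Rightarrow> ('g \<Rightarrow> 'k)" where
  "components \<Gamma> G i \<phi> = (THE c. c \<in> (\<Pi>\<^sub>E g\<in>carrier \<Gamma>. grade \<Gamma> G i g) \<and>
    (\<forall>x\<in>carrier G. \<phi> x = (\<Sum>g\<in>carrier \<Gamma>. c g x)))"

text \<open>The decomposition is well defined as soon as the characters of \<open>\<Gamma>\<close> separate its points.\<close>

lemma ex1_components:
  fixes \<Gamma> :: "('c, 'n) monoid_scheme" and G :: "('g, 'm) monoid_scheme"
    and i :: "('c \<Rightarrow> 'k::field_char_0) \<Rightarrow> 'g"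
  assumes coc: "cocentral_action \<Gamma> G i \<alpha>"
    and sep: "\<And>g. g \<in> carrier \<Gamma> \<Longrightarrow> g \<noteq> \<one>\<^bsub>\<Gamma>\<^esub> \<Longrightarrow>
      \<exists>\<chi>\<in>carrier (dual_group \<Gamma> :: ('c \<Rightarrow> 'k) monoid). \<chi> g \<noteq> 1"
  shows "\<exists>!c. c \<in> (\<Pi>\<^sub>E g\<in>carrier \<Gamma>. grade \<Gamma> G i g) \<and>
    (\<forall>x\<in>carrier G. \<phi> x = (\<Sum>g\<in>carrier \<Gamma>. c g x))"
proof -
  interpret cocentral_action \<Gamma> G i \<alpha> by (fact coc)
  let ?D = "dual_group \<Gamma> :: ('c \<Rightarrow> 'k) monoid"
  interpret D: comm_group ?D using comm_group_dual_group \<Gamma>.is_group by blast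
  have Dv: "\<chi> g \<noteq> 0" "\<chi> (g \<otimes>\<^bsub>\<Gamma>\<^esub> h) = \<chi> g * \<chi> h"
    if "\<chi> \<in> carrier ?D" "g \<in> carrier \<Gamma>" "h \<in> carrier \<Gamma>" for \<chi> g h
    using that by (auto simp: dual_group_def hom_group_def hom_def)
  have Dm: "(\<chi> \<otimes>\<^bsub>?D\<^esub> \<chi>') g = \<chi> g * \<chi>' g" if "g \<in> carrier \<Gamma>" for \<chi> \<chi>' g
    using that by (simp add: dual_group_def hom_group_def)
  have D1: "\<one>\<^bsub>?D\<^esub> g = 1" if "g \<in> carrier \<Gamma>" for g
    using that by (simp add: dual_group_def hom_group_def)
  have iG: "i \<chi> \<in> carrier G" if "\<chi> \<in> carrier ?D" for \<chi>
    using i_hom that by (auto simp: hom_def group_center_def)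
  have im: "i (\<chi> \<otimes>\<^bsub>?D\<^esub> \<chi>') = i \<chi> \<otimes>\<^bsub>G\<^esub> i \<chi>'" if "\<chi> \<in> carrier ?D" "\<chi>' \<in> carrier ?D" for \<chi> \<chi>'
    using i_hom that by (auto simp: hom_def)
  have i1: "i \<one>\<^bsub>?D\<^esub> = \<one>\<^bsub>G\<^esub>"
    using im[of "\<one>\<^bsub>?D\<^esub>" "\<one>\<^bsub>?D\<^esub>"] iG[of "\<one>\<^bsub>?D\<^esub>"] by (simp add: G.l_cancel_one')
  have finD: "finite (carrier ?D)"
    using i_inj finite_G iG by (metis finite_imageD finite_subset image_subsetI)
  have D_sum: "(\<Sum>\<chi>\<in>carrier ?D. F (\<chi>' \<otimes>\<^bsub>?D\<^esub> \<chi>)) = (\<Sum>\<chi>\<in>carrier ?D. F \<chi>)"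
    if "\<chi>' \<in> carrier ?D" for F :: "_ \<Rightarrow> 'k" and \<chi>'
    by (rule sum.reindex_bij_witness[where j = "\<lambda>\<chi>. \<chi>' \<otimes>\<^bsub>?D\<^esub> \<chi>" and i = "\<lambda>\<chi>. inv\<^bsub>?D\<^esub> \<chi>' \<otimes>\<^bsub>?D\<^esub> \<chi>"])
      (use that in \<open>auto simp: D.inv_solve_left D.m_assoc[symmetric]\<close>)
  have \<Gamma>_sum: "(\<Sum>g\<in>carrier \<Gamma>. F (h \<otimes>\<^bsub>\<Gamma>\<^esub> g)) = (\<Sum>g\<in>carrier \<Gamma>. F g)"
    if "h \<in> carrier \<Gamma>" for F :: "_ \<Rightarrow> 'k" and h
    by (rule sum.reindex_bij_witness[where j = "\<lambda>g. h \<otimes>\<^bsub>\<Gamma>\<^esub> g" and i = "\<lambda>g. inv\<^bsub>\<Gamma>\<^esub> h \<otimes>\<^bsub>\<Gamma>\<^esub> g"])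
      (use that in \<open>auto simp: \<Gamma>.m_assoc[symmetric]\<close>)
  have orth: "(\<Sum>g\<in>carrier \<Gamma>. inverse (\<chi> g)) = (if \<chi> = \<one>\<^bsub>?D\<^esub> then of_nat (card (carrier \<Gamma>)) else 0)"
    if \<chi>: "\<chi> \<in> carrier ?D" for \<chi>
  proof (cases "\<chi> = \<one>\<^bsub>?D\<^esub>")
    case True
    then show ?thesis by (simp add: D1)
  next
    case False
    have "\<exists>h\<in>carrier \<Gamma>. \<chi> h \<noteq> 1"
    proof (rule ccontr)
      assume "\<not> ?thesis"
      moreover have "\<chi> \<in> extensional (carrier \<Gamma>)" "\<one>\<^bsub>?D\<^esub> \<in> extensional (carrier \<Gamma>)"
        using \<chi> by (auto simp: dual_group_def hom_group_def)
      ultimately have "\<chi> = \<one>\<^bsub>?D\<^esub>" by (intro extensionalityI[of _ "carrier \<Gamma>"]) (auto simp: D1)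
      with False show False ..
    qed
    then obtain h where h: "h \<in> carrier \<Gamma>" "\<chi> h \<noteq> 1" ..
    have "(\<Sum>g\<in>carrier \<Gamma>. inverse (\<chi> g)) = (\<Sum>g\<in>carrier \<Gamma>. inverse (\<chi> (h \<otimes>\<^bsub>\<Gamma>\<^esub> g)))"
      by (rule \<Gamma>_sum[OF h(1), symmetric])
    also have "\<dots> = inverse (\<chi> h) * (\<Sum>g\<in>carrier \<Gamma>. inverse (\<chi> g))"
      using h \<chi> by (simp add: Dv sum_distrib_left)
    finally have "(inverse (\<chi> h) - 1) * (\<Sum>g\<in>carrier \<Gamma>. inverse (\<chi> g)) = 0"
      by (simp add: algebra_simps)
    moreover have "inverse (\<chi> h) \<noteq> 1" using h by simp
    ultimately show ?thesis using False by simp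
  qed
  have orth': "(\<Sum>\<chi>\<in>carrier ?D. \<chi> g) = (if g = \<one>\<^bsub>\<Gamma>\<^esub> then of_nat (card (carrier ?D)) else 0)"
    if g: "g \<in> carrier \<Gamma>" for g
  proof (cases "g = \<one>\<^bsub>\<Gamma>\<^esub>")
    case True
    have "\<chi> \<one>\<^bsub>\<Gamma>\<^esub> = 1" if "\<chi> \<in> carrier ?D" for \<chi>
      using Dv[OF that, of "\<one>\<^bsub>\<Gamma>\<^esub>" "\<one>\<^bsub>\<Gamma>\<^esub>"] by simp
    then have "(\<Sum>\<chi>\<in>carrier ?D. \<chi> \<one>\<^bsub>\<Gamma>\<^esub>) = (\<Sum>\<chi>\<in>carrier ?D. 1)" by (rule sum.cong[OF refl])
    with True show ?thesis by simp
  next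
    case False
    with sep g obtain \<chi>' where \<chi>': "\<chi>' \<in> carrier ?D" "\<chi>' g \<noteq> 1" by blast
    have "(\<Sum>\<chi>\<in>carrier ?D. \<chi> g) = (\<Sum>\<chi>\<in>carrier ?D. (\<chi>' \<otimes>\<^bsub>?D\<^esub> \<chi>) g)"
      using D_sum[OF \<chi>'(1), of "\<lambda>\<chi>. \<chi> g"] by simp
    also have "\<dots> = \<chi>' g * (\<Sum>\<chi>\<in>carrier ?D. \<chi> g)" using g by (simp add: Dm sum_distrib_left)
    finally have "(\<chi>' g - 1) * (\<Sum>\<chi>\<in>carrier ?D. \<chi> g) = 0" by (simp add: algebra_simps)
    then show ?thesis using \<chi>' False by simp
  qed
  define n :: 'k where "n = of_nat (card (carrier \<Gamma>))"
  have n: "n \<noteq> 0" using finite_\<Gamma> \<Gamma>.one_closed by (auto simp: n_def)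
  define c where "c = (\<lambda>g\<in>carrier \<Gamma>. \<lambda>x\<in>carrier G.
    inverse n * (\<Sum>\<chi>\<in>carrier ?D. inverse (\<chi> g) * \<phi> (x \<otimes>\<^bsub>G\<^esub> i \<chi>)))"
  define P where "P d \<longleftrightarrow> d \<in> (\<Pi>\<^sub>E g\<in>carrier \<Gamma>. grade \<Gamma> G i g) \<and>
    (\<forall>x\<in>carrier G. \<phi> x = (\<Sum>g\<in>carrier \<Gamma>. d g x))" for d
  have "P c"
    unfolding P_def
  proof (intro conjI ballI PiE_I)
    fix g assume g: "g \<in> carrier \<Gamma>"
    have "c g (x \<otimes>\<^bsub>G\<^esub> i \<chi>') = \<chi>' g * c g x" if x: "x \<in> carrier G" and \<chi>': "\<chi>' \<in> carrier ?D" for x \<chi>'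
    proof -
      have "(\<Sum>\<chi>\<in>carrier ?D. inverse (\<chi> g) * \<phi> (x \<otimes>\<^bsub>G\<^esub> i \<chi>)) =
          (\<Sum>\<chi>\<in>carrier ?D. inverse ((\<chi>' \<otimes>\<^bsub>?D\<^esub> \<chi>) g) * \<phi> (x \<otimes>\<^bsub>G\<^esub> i (\<chi>' \<otimes>\<^bsub>?D\<^esub> \<chi>)))"
        using D_sum[OF \<chi>', of "\<lambda>\<chi>. inverse (\<chi> g) * \<phi> (x \<otimes>\<^bsub>G\<^esub> i \<chi>)"] by simp
      also have "\<dots> = inverse (\<chi>' g) * (\<Sum>\<chi>\<in>carrier ?D. inverse (\<chi> g) * \<phi> (x \<otimes>\<^bsub>G\<^esub> i \<chi>' \<otimes>\<^bsub>G\<^esub> i \<chi>))"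
        unfolding sum_distrib_left using g x \<chi>'
        by (intro sum.cong) (auto simp: Dm im iG G.m_assoc)
      finally show ?thesis
        using g x \<chi>' Dv[OF \<chi>' g g] by (simp add: c_def iG field_simps)
    qed
    then show "c g \<in> grade \<Gamma> G i g" using g by (simp add: grade_def c_def)
  next
    show "c g = undefined" if "g \<notin> carrier \<Gamma>" for g using that by (simp add: c_def)
  next
    fix x assume x: "x \<in> carrier G"
    have "(\<Sum>g\<in>carrier \<Gamma>. c g x) = inverse n * (\<Sum>g\<in>carrier \<Gamma>. \<Sum>\<chi>\<in>carrier ?D. inverse (\<chi> g) * \<phi> (x \<otimes>\<^bsub>G\<^esub> i \<chi>))"
      using x by (simp add: c_def sum_distrib_left)
    also have "\<dots> = inverse n * (\<Sum>\<chi>\<in>carrier ?D. (\<Sum>g\<in>carrier \<Gamma>. inverse (\<chi> g)) * \<phi> (x \<otimes>\<^bsub>G\<^esub> i \<chi>))"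
      by (subst sum.swap) (simp add: sum_distrib_right)
    also have "\<dots> = inverse n * (\<Sum>\<chi>\<in>carrier ?D. if \<chi> = \<one>\<^bsub>?D\<^esub> then n * \<phi> x else 0)"
      using x by (intro arg_cong[where f = "(*) (inverse n)"] sum.cong) (auto simp: orth i1 n_def)
    also have "\<dots> = \<phi> x" using finD n by simp
    finally show "\<phi> x = (\<Sum>g\<in>carrier \<Gamma>. c g x)" ..
  qed
  have eq: "of_nat (card (carrier ?D)) * d h x = (\<Sum>\<chi>\<in>carrier ?D. inverse (\<chi> h) * \<phi> (x \<otimes>\<^bsub>G\<^esub> i \<chi>))"
    if d: "P d" and h: "h \<in> carrier \<Gamma>" and x: "x \<in> carrier G" for d h x
  proof -
    have "inverse (\<chi> h) * d g (x \<otimes>\<^bsub>G\<^esub> i \<chi>) = \<chi> (g \<otimes>\<^bsub>\<Gamma>\<^esub> inv\<^bsub>\<Gamma>\<^esub> h) * d g x"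
      if \<chi>: "\<chi> \<in> carrier ?D" and g: "g \<in> carrier \<Gamma>" for \<chi> g
    proof -
      have "\<chi> g = \<chi> (g \<otimes>\<^bsub>\<Gamma>\<^esub> inv\<^bsub>\<Gamma>\<^esub> h) * \<chi> h"
        using Dv(2)[OF \<chi>, of "g \<otimes>\<^bsub>\<Gamma>\<^esub> inv\<^bsub>\<Gamma>\<^esub> h" h] g h by (simp add: \<Gamma>.m_assoc)
      moreover have "d g (x \<otimes>\<^bsub>G\<^esub> i \<chi>) = \<chi> g * d g x"
        using d g x \<chi> by (auto simp: P_def grade_def PiE_iff)
      ultimately show ?thesis using Dv(1)[OF \<chi> h h] by (simp add: field_simps)
    qed
    then have "(\<Sum>\<chi>\<in>carrier ?D. inverse (\<chi> h) * \<phi> (x \<otimes>\<^bsub>G\<^esub> i \<chi>)) =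
        (\<Sum>\<chi>\<in>carrier ?D. \<Sum>g\<in>carrier \<Gamma>. \<chi> (g \<otimes>\<^bsub>\<Gamma>\<^esub> inv\<^bsub>\<Gamma>\<^esub> h) * d g x)"
      using d x iG by (intro sum.cong) (auto simp: P_def sum_distrib_left)
    also have "\<dots> = (\<Sum>g\<in>carrier \<Gamma>. (\<Sum>\<chi>\<in>carrier ?D. \<chi> (g \<otimes>\<^bsub>\<Gamma>\<^esub> inv\<^bsub>\<Gamma>\<^esub> h)) * d g x)"
      by (subst sum.swap) (simp add: sum_distrib_right)
    also have "\<dots> = (\<Sum>g\<in>carrier \<Gamma>. if g = h then of_nat (card (carrier ?D)) * d h x else 0)"
    proof (rule sum.cong)
      fix g assume g: "g \<in> carrier \<Gamma>"
      have "g \<otimes>\<^bsub>\<Gamma>\<^esub> inv\<^bsub>\<Gamma>\<^esub> h = \<one>\<^bsub>\<Gamma>\<^esub> \<longleftrightarrow> g = h"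
        using g h by (metis \<Gamma>.inv_closed \<Gamma>.inv_equality \<Gamma>.inv_inv \<Gamma>.r_inv)
      then show "(\<Sum>\<chi>\<in>carrier ?D. \<chi> (g \<otimes>\<^bsub>\<Gamma>\<^esub> inv\<^bsub>\<Gamma>\<^esub> h)) * d g x =
          (if g = h then of_nat (card (carrier ?D)) * d h x else 0)"
        using g h by (simp add: orth')
    qed simp
    also have "\<dots> = of_nat (card (carrier ?D)) * d h x" using finite_\<Gamma> h by simp
    finally show ?thesis ..
  qed
  have "d = c" if d: "P d" for d
  proof (rule PiE_ext[of _ "carrier \<Gamma>" "\<lambda>g. grade \<Gamma> G i g"])
    fix h assume h: "h \<in> carrier \<Gamma>"
    have "card (carrier ?D) \<noteq> 0" using finD D.one_closed by (metis card_0_eq empty_iff)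
    then have "d h x = c h x" if "x \<in> carrier G" for x
      using eq[OF d h that] eq[OF \<open>P c\<close> h that]
      by (metis mult_left_cancel of_nat_eq_0_iff)
    moreover have "d h \<in> extensional (carrier G)" "c h \<in> extensional (carrier G)"
      using d \<open>P c\<close> h by (auto simp: P_def grade_def PiE_iff)
    ultimately show "d h = c h" by (rule extensionalityI[rotated 2])
  qed (use d \<open>P c\<close> in \<open>simp_all add: P_def\<close>)
  with \<open>P c\<close> show ?thesis unfolding P_def by (intro ex1I[of _ c])
qed

lemma dual_integer_mod_group_separates:
  assumes "Factorial_Ring.prime p" "k \<in> carrier (integer_mod_group p)" "k \<noteq> \<one>\<^bsub>integer_mod_group p\<^esub>"
  shows "\<exists>\<chi>\<in>carrier (dual_group (integer_mod_group p) ::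
    (int \<Rightarrow> 'k::{alg_closed_field, field_char_0}) monoid). \<chi> k \<noteq> 1"
proof -
  have p: "1 < p" using assms(1) prime_gt_1_nat by blast
  have "\<exists>x. (\<Sum>n\<le>p - 1. 1 * x ^ n) = (0 :: 'k)" using p by (intro alg_closed) auto
  then obtain \<omega> :: 'k where "(\<Sum>n\<le>p - 1. 1 * \<omega> ^ n) = 0" ..
  moreover have "{..p - 1} = {..<p}" using p by auto
  ultimately have sum: "(\<Sum>n<p. \<omega> ^ n) = 0" by simp
  then have ne: "\<omega> \<noteq> 1" using p by auto
  have pw: "\<omega> ^ p = 1" using sum power_diff_1_eq[of \<omega> p] by simp
  have pw': "\<omega> ^ (n mod p) = \<omega> ^ n" for n
  proof -
    have "\<omega> ^ n = \<omega> ^ (p * (n div p) + n mod p)" by simp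
    also have "\<dots> = \<omega> ^ (n mod p)" by (simp only: power_add power_mult pw power_one mult_1)
    finally show ?thesis ..
  qed
  define \<chi> where "\<chi> = (\<lambda>a\<in>carrier (integer_mod_group p). \<omega> ^ nat a)"
  have "\<omega> \<noteq> 0" using pw p by (auto simp: power_0_left)
  moreover have "\<omega> ^ nat ((a + b) mod int p) = \<omega> ^ nat a * \<omega> ^ nat b"
    if "0 \<le> a" "0 \<le> b" for a b
    using that pw'[of "nat (a + b)"] by (simp add: nat_mod_distrib nat_add_distrib power_add)
  ultimately have "\<chi> \<in> carrier (dual_group (integer_mod_group p))"
    using p by (auto simp: dual_group_def hom_group_def hom_def \<chi>_def carrier_integer_mod_group)
  moreover have "\<chi> k \<noteq> 1"
  proof
    assume "\<chi> k = 1"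
    with assms(2) have k1: "\<omega> ^ nat k = 1" by (simp add: \<chi>_def)
    have k: "0 < nat k" "nat k < p" using assms(2,3) p by (auto simp: carrier_integer_mod_group)
    then have "coprime (nat k) p"
      using assms(1) by (metis coprime_commute nat_dvd_not_less prime_imp_coprime)
    then obtain x y where "nat k * x = p * y + 1" using bezout_nat[of "nat k" p] k by auto
    then have "(\<omega> ^ nat k) ^ x = (\<omega> ^ p) ^ y * \<omega>" by (metis power_add power_mult power_one_right)
    with k1 pw ne show False by simp
  qed
  ultimately show ?thesis by blast
qed

lemma components_eqI:
  fixes G :: "('g, 'm) monoid_scheme"
    and i :: "(int \<Rightarrow> 'k::{alg_closed_field, field_char_0}) \<Rightarrow> 'g"
  assumes "cocentral_action (integer_mod_group p) G i \<alpha>" "Factorial_Ring.prime p"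
    and "c \<in> (\<Pi>\<^sub>E g\<in>carrier (integer_mod_group p). grade (integer_mod_group p) G i g)"
    and "\<And>x. x \<in> carrier G \<Longrightarrow> \<phi> x = (\<Sum>g\<in>carrier (integer_mod_group p). c g x)"
  shows "components (integer_mod_group p) G i \<phi> = c"
  unfolding components_def
  using ex1_components[OF assms(1) dual_integer_mod_group_separates[OF assms(2)], of \<phi>] assms(3,4)
  by (intro the1_equality) auto

lemma components_homogeneous:
  fixes G :: "('g, 'm) monoid_scheme"
    and i :: "(int \<Rightarrow> 'k::{alg_closed_field, field_char_0}) \<Rightarrow> 'g"
  assumes "cocentral_action (integer_mod_group p) G i \<alpha>" "Factorial_Ring.prime p"
    and g: "g \<in> carrier (integer_mod_group p)" and \<phi>: "\<phi> \<in> grade (integer_mod_group p) G i g"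
  shows "components (integer_mod_group p) G i \<phi> =
    (\<lambda>h\<in>carrier (integer_mod_group p). if h = g then \<phi> else (\<lambda>x\<in>carrier G. 0))"
proof (rule components_eqI[OF assms(1,2)])
  interpret cocentral_action "integer_mod_group p" G i \<alpha> by fact
  have "x \<otimes>\<^bsub>G\<^esub> i \<chi> \<in> carrier G" if "x \<in> carrier G" "\<chi> \<in> carrier (dual_group (integer_mod_group p))" for x \<chi>
    using i_hom that by (auto simp: hom_def group_center_def)
  then show "(\<lambda>h\<in>carrier (integer_mod_group p). if h = g then \<phi> else (\<lambda>x\<in>carrier G. 0))
      \<in> (\<Pi>\<^sub>E h\<in>carrier (integer_mod_group p). grade (integer_mod_group p) G i h)"
    using \<phi> by (auto simp: grade_def)
  show "\<phi> x = (\<Sum>h\<in>carrier (integer_mod_group p).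
      (\<lambda>h\<in>carrier (integer_mod_group p). if h = g then \<phi> else (\<lambda>x\<in>carrier G. 0)) h x)"
    if "x \<in> carrier G" for x
  proof -
    have "(\<Sum>h\<in>carrier (integer_mod_group p).
      (\<lambda>h\<in>carrier (integer_mod_group p). if h = g then \<phi> else (\<lambda>x\<in>carrier G. 0)) h x) =
      (\<Sum>h\<in>carrier (integer_mod_group p). if h = g then \<phi> x else 0)"
      using that by (intro sum.cong) auto
    then show ?thesis using g finite_\<Gamma> by simp
  qed
qed

definition aut_action :: "('g, 'm) monoid_scheme \<Rightarrow> ('g \<Rightarrow> 'g) \<Rightarrow> ('g \<Rightarrow> 'k) \<Rightarrow> ('g \<Rightarrow> 'k)" where
  "aut_action G a \<phi> = (\<lambda>x\<in>carrier G. \<phi> ((inv\<^bsub>AutoGroup G\<^esub> a) x))"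

text \<open>
  Product and antipode are the linear extensions of \<open>\<phi> \<cdot> \<psi> = \<phi> \<alpha>\<^sub>g(\<psi>)\<close> and
  \<open>\<phi> \<mapsto> \<alpha>\<^bsub>g\<^sup>-\<^sup>1\<^esub>(S(\<phi>))\<close> for \<open>\<phi>\<close> homogeneous of degree \<open>g\<close>; everything else is inherited from
  \<open>\<O>(G)\<close>.
\<close>

definition graded_twisting ::
  "('c, 'n) monoid_scheme \<Rightarrow> ('g, 'm) monoid_scheme \<Rightarrow> (('c \<Rightarrow> 'k::field) \<Rightarrow> 'g) \<Rightarrow>
    ('c \<Rightarrow> 'g \<Rightarrow> 'g) \<Rightarrow> ('k, 'g \<Rightarrow> 'k) hopf_algebra" where
  "graded_twisting \<Gamma> G i \<alpha> = (function_hopf G)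
    \<lparr>monoid.mult := (\<lambda>\<phi> \<psi>. \<lambda>x\<in>carrier G.
       \<Sum>g\<in>carrier \<Gamma>. components \<Gamma> G i \<phi> g x * aut_action G (\<alpha> g) \<psi> x),
     antipode := (\<lambda>\<phi>. \<lambda>x\<in>carrier G.
       \<Sum>g\<in>carrier \<Gamma>. aut_action G (\<alpha> (inv\<^bsub>\<Gamma>\<^esub> g))
         (antipode (function_hopf G) (components \<Gamma> G i \<phi> g)) x)\<rparr>"

text \<open>On homogeneous elements the operations are given by the usual formulas.\<close>

lemma graded_twisting_homogeneous:
  fixes G :: "('g, 'm) monoid_scheme"
    and i :: "(int \<Rightarrow> 'k::{alg_closed_field, field_char_0}) \<Rightarrow> 'g"
  assumes coc: "cocentral_action (integer_mod_group p) G i \<alpha>" and p: "Factorial_Ring.prime p"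
    and g: "g \<in> carrier (integer_mod_group p)" and \<phi>: "\<phi> \<in> grade (integer_mod_group p) G i g"
  shows "\<phi> \<otimes>\<^bsub>graded_twisting (integer_mod_group p) G i \<alpha>\<^esub> \<psi> =
      \<phi> \<otimes>\<^bsub>function_hopf G\<^esub> aut_action G (\<alpha> g) \<psi>"
    and "antipode (graded_twisting (integer_mod_group p) G i \<alpha>) \<phi> =
      aut_action G (\<alpha> (inv\<^bsub>integer_mod_group p\<^esub> g)) (antipode (function_hopf G) \<phi>)"
proof -
  interpret cocentral_action "integer_mod_group p" G i \<alpha> by (fact coc)
  let ?c = "\<lambda>h\<in>carrier (integer_mod_group p). if h = g then \<phi> else (\<lambda>x\<in>carrier G. 0)"
  have c: "components (integer_mod_group p) G i \<phi> = ?c"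
    by (rule components_homogeneous[OF coc p g \<phi>])
  have "(\<Sum>h\<in>carrier (integer_mod_group p). ?c h x * aut_action G (\<alpha> h) \<psi> x) =
      \<phi> x * aut_action G (\<alpha> g) \<psi> x" if "x \<in> carrier G" for x
  proof -
    have "(\<Sum>h\<in>carrier (integer_mod_group p). ?c h x * aut_action G (\<alpha> h) \<psi> x) =
        (\<Sum>h\<in>carrier (integer_mod_group p). if h = g then \<phi> x * aut_action G (\<alpha> g) \<psi> x else 0)"
      using that by (intro sum.cong) auto
    then show ?thesis using g finite_\<Gamma> by simp
  qed
  then show "\<phi> \<otimes>\<^bsub>graded_twisting (integer_mod_group p) G i \<alpha>\<^esub> \<psi> =
      \<phi> \<otimes>\<^bsub>function_hopf G\<^esub> aut_action G (\<alpha> g) \<psi>"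
    by (auto simp: graded_twisting_def c function_hopf_def function_algebra_def module.defs
      hopf_algebra.defs intro!: restrict_ext simp del: restrict_apply)
  let ?T = "\<lambda>h. aut_action G (\<alpha> (inv\<^bsub>integer_mod_group p\<^esub> h))"
  let ?S = "antipode (function_hopf G :: ('k, 'g \<Rightarrow> 'k) hopf_algebra)"
  have "(\<Sum>h\<in>carrier (integer_mod_group p). ?T h (?S (?c h)) x) = ?T g (?S \<phi>) x"
    if x: "x \<in> carrier G" for x
  proof -
    have "(inv\<^bsub>AutoGroup G\<^esub> (\<alpha> (inv\<^bsub>integer_mod_group p\<^esub> h))) x \<in> carrier G"
      if "h \<in> carrier (integer_mod_group p)" for h
    proof -
      interpret A: group "AutoGroup G" by (rule G.AutoGroup)
      have "\<alpha> (inv\<^bsub>integer_mod_group p\<^esub> h) \<in> carrier (AutoGroup G)"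
        using \<alpha>_hom that \<Gamma>.inv_closed unfolding hom_def by blast
      then have "inv\<^bsub>AutoGroup G\<^esub> (\<alpha> (inv\<^bsub>integer_mod_group p\<^esub> h)) \<in> carrier (AutoGroup G)"
        by (rule A.inv_closed)
      then show ?thesis using x by (auto simp: AutoGroup_def auto_def hom_def)
    qed
    then have "?T h (?S (?c h)) x = (if h = g then ?T g (?S \<phi>) x else 0)"
      if "h \<in> carrier (integer_mod_group p)" for h
      using that x by (auto simp: aut_action_def function_hopf_def hopf_algebra.defs module.defs)
    then have "(\<Sum>h\<in>carrier (integer_mod_group p). ?T h (?S (?c h)) x) =
        (\<Sum>h\<in>carrier (integer_mod_group p). if h = g then ?T g (?S \<phi>) x else 0)"
      by (intro sum.cong) auto
    then show ?thesis using g finite_\<Gamma> by simp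
  qed
  then have "(\<lambda>x\<in>carrier G. \<Sum>h\<in>carrier (integer_mod_group p). ?T h (?S (?c h)) x) =
      (\<lambda>x\<in>carrier G. ?T g (?S \<phi>) x)"
    by (intro restrict_ext)
  also have "\<dots> = ?T g (?S \<phi>)" by (auto simp: aut_action_def)
  finally show "antipode (graded_twisting (integer_mod_group p) G i \<alpha>) \<phi> = ?T g (?S \<phi>)"
    by (simp add: graded_twisting_def c del: restrict_apply inv_integer_mod_group)
qed

definition cocentral_equiv ::
  "('c, 'n) monoid_scheme \<Rightarrow> ('g, 'm) monoid_scheme \<Rightarrow>
    (('c \<Rightarrow> 'k::field) \<Rightarrow> 'g) \<Rightarrow> ('c \<Rightarrow> 'g \<Rightarrow> 'g) \<Rightarrow>
    (('c \<Rightarrow> 'k) \<Rightarrow> 'g) \<Rightarrow> ('c \<Rightarrow> 'g \<Rightarrow> 'g) \<Rightarrow> bool" where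
  "cocentral_equiv \<Gamma> G i \<alpha> j \<beta> \<longleftrightarrow> (\<exists>u\<in>auto \<Gamma>. \<exists>f\<in>auto G.
    (\<forall>\<chi>\<in>carrier (dual_group \<Gamma>). i (compose (carrier \<Gamma>) \<chi> u) = f (j \<chi>)) \<and>
    (\<forall>g\<in>carrier \<Gamma>. inv\<^bsub>AutoGroup G\<^esub> f \<otimes>\<^bsub>AutoGroup G\<^esub> \<alpha> g \<otimes>\<^bsub>AutoGroup G\<^esub> f = \<beta> (u g)))"

end

theory Submission
  imports Defs
begin

text \<open>
  An isomorphism \<open>F\<close> of the twistings sends \<open>x \<in> G\<close> to the functional \<open>\<phi> \<mapsto> F \<phi> x\<close>, an element of the
  group algebra, and is multiplicative in \<open>x\<close>. Let \<open>C\<close> be the common image of \<open>i\<close> and \<open>j\<close>.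

  For \<open>w = j \<chi>\<close> this functional is a character of the twisted algebra, hence is supported on one
  coset \<open>y C\<close>, and \<open>y\<close> is central with \<open>y\<^sup>p \<in> C\<close>. If \<open>y \<notin> C\<close>, the preimage of the commutative
  subalgebra of degree \<open>0\<close> contains elements of degree \<open>1\<close>; commutativity then forces \<open>\<alpha>\<^sub>1\<close> to be
  the identity modulo \<open>\<langle>C, y\<rangle>\<close>, hence the identity because \<open>Hom(H, \<int>\<^sub>p)\<close> is trivial, so that the
  functional is evaluation at a central element of order \<open>p\<close>, which lies in \<open>C\<close> by cyclicity of the
  centre. So \<open>y \<in> C\<close>, and \<open>F\<close> matches translation by \<open>w\<close> with translation by some
  \<open>z\<^sup>s\<close>, where \<open>z = i \<chi>\<close>.

  Consequently \<open>F\<close> preserves degree \<open>0\<close>, every functional \<open>\<phi> \<mapsto> F \<phi> x\<close> is supported on one coset,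
  and on degree \<open>1\<close> it is \<open>\<phi> \<mapsto> m \<phi>(y)\<close> with \<open>y\<close> determined up to \<open>C\<close> and \<open>m\<close> up to a
  \<open>p\<close>-th root of unity. The character \<open>m\<^sup>p\<close> has a \<open>p\<close>-th root, as \<open>H\<close> has no character of order
  \<open>p\<close>, and this root selects \<open>y = f x\<close> for an automorphism \<open>f\<close> of \<open>G\<close>. Multiplicativity of \<open>F\<close> gives
  \<open>\<alpha>\<^sub>1 f = f \<beta>\<^sub>s\<close> modulo \<open>C\<close>, and the discrepancy is a homomorphism from \<open>H\<close> to \<open>C\<close>, which is trivial.
\<close>

section \<open>Roots of unity and a central element of prime order\<close>

lemma bezout_mod_prime:
  fixes p k :: nat
  assumes "Factorial_Ring.prime p" "\<not> p dvd k"
  obtains q n where "k * q = p * n + 1"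
proof -
  have "coprime k p" using assms by (metis coprime_commute prime_imp_coprime)
  moreover have "k \<noteq> 0" using assms(2) by (metis dvd_0_right)
  ultimately show ?thesis using bezout_nat[of k p] that by auto
qed

locale prime_root =
  fixes p :: nat and \<omega> :: "'k::field"
  assumes prime_p: "Factorial_Ring.prime p"
    and omega_pow_p: "\<omega> ^ p = 1" and omega_ne_1: "\<omega> \<noteq> 1"
begin

lemma p_gt_1: "1 < p" using prime_p prime_gt_1_nat by blast

lemma omega_ne_0: "\<omega> \<noteq> 0" using omega_pow_p p_gt_1 by (auto simp: power_0_left)

lemma omega_pow_mod: "\<omega> ^ (k mod p) = \<omega> ^ k"
proof -
  have "\<omega> ^ k = \<omega> ^ (p * (k div p) + k mod p)" by simp
  also have "\<dots> = \<omega> ^ (k mod p)" by (simp only: power_add power_mult omega_pow_p power_one mult_1)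
  finally show ?thesis ..
qed

lemma omega_pow_eq_1: "\<omega> ^ k = 1 \<longleftrightarrow> p dvd k"
proof
  assume k: "\<omega> ^ k = 1"
  show "p dvd k"
  proof (rule ccontr)
    assume "\<not> p dvd k"
    then obtain q n where "k * q = p * n + 1" using bezout_mod_prime[OF prime_p] by metis
    then have "(\<omega> ^ k) ^ q = (\<omega> ^ p) ^ n * \<omega>" by (metis power_add power_mult power_one_right)
    then show False using k omega_pow_p omega_ne_1 by simp
  qed
qed (auto simp: power_mult omega_pow_p)

lemma omega_pow_eq: "\<omega> ^ k = \<omega> ^ l \<longleftrightarrow> k mod p = l mod p"
proof (induction k l rule: linorder_wlog)
  case (le a b)
  have "\<omega> ^ b = \<omega> ^ a * \<omega> ^ (b - a)" using le by (simp flip: power_add)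
  then have "\<omega> ^ a = \<omega> ^ b \<longleftrightarrow> \<omega> ^ (b - a) = 1" using omega_ne_0 by simp
  also have "\<dots> \<longleftrightarrow> a mod p = b mod p"
    using le by (simp add: omega_pow_eq_1 mod_eq_dvd_iff_nat eq_commute[of "a mod p"])
  finally show ?case .
qed (simp add: eq_commute)

text \<open>\<open>X\<^sup>p - 1\<close> has at most \<open>p\<close> roots.\<close>

lemma root_of_unity_eq_omega_pow:
  assumes "(c::'k) ^ p = 1"
  obtains k where "k < p" "c = \<omega> ^ k"
proof -
  let ?P = "Polynomial.monom (1::'k) p - 1"
  let ?R = "{x. poly ?P x = 0}"
  have ne: "?P \<noteq> 0"
  proof
    assume "?P = 0"
    then have "degree (Polynomial.monom (1::'k) p) = degree (1 :: 'k poly)" by simp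
    then show False using p_gt_1 by (simp add: Polynomial.degree_monom_eq)
  qed
  have "degree ?P \<le> p"
    using Polynomial.degree_diff_le[of "Polynomial.monom (1::'k) p" p 1] by (simp add: Polynomial.degree_monom_eq)
  then have "card ?R \<le> p" using card_poly_roots_bound[OF ne] by (rule order_trans[rotated])
  moreover have "inj_on (\<lambda>k. \<omega> ^ k) {..<p}" by (auto simp: inj_on_def omega_pow_eq)
  then have "card ((\<lambda>k. \<omega> ^ k) ` {..<p}) = p" by (simp add: card_image)
  moreover have "(\<lambda>k. \<omega> ^ k) ` {..<p} \<subseteq> ?R"
    by (auto simp: Polynomial.poly_monom power_mult[symmetric] mult.commute[of _ p])
      (simp add: power_mult omega_pow_p)
  moreover have "finite ?R" using poly_roots_finite[OF ne] .
  ultimately have "(\<lambda>k. \<omega> ^ k) ` {..<p} = ?R" by (intro card_seteq) auto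
  moreover have "c \<in> ?R" using assms by (simp add: Polynomial.poly_monom)
  ultimately show ?thesis using that by blast
qed

end

text \<open>Here z generates the common image C of the two embeddings of the dual group.
  \<open>no_index_p\<close> is the triviality of Hom(G / <z>, Z_p), where a homomorphism is given by
  a lift \<open>l\<close> to the naturals of which only residues count, and vanishing at z means
  that it factors through the quotient. \<open>central_p\<close> is what cyclicity of the centre
  provides: the subgroup of order p is unique.\<close>

locale central_root = group G + prime_root p \<omega>
  for G :: "('a, 'm) monoid_scheme" (structure) and p :: nat and \<omega> :: "'k::field" +
  fixes z :: 'a
  assumes finite_G: "finite (carrier G)"
    and z_closed [simp]: "z \<in> carrier G"
    and z_comm: "x \<in> carrier G \<Longrightarrow> z \<otimes> x = x \<otimes> z"
    and z_pow_p: "z [^] p = \<one>" and z_ne_1: "z \<noteq> \<one>"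
    and no_index_p: "\<And>l :: 'a \<Rightarrow> nat. (\<And>x y. x \<in> carrier G \<Longrightarrow> y \<in> carrier G \<Longrightarrow>
        l (x \<otimes> y) mod p = (l x + l y) mod p) \<Longrightarrow> l z mod p = 0 \<Longrightarrow> x \<in> carrier G \<Longrightarrow> l x mod p = 0"
    and central_p: "c \<in> carrier G \<Longrightarrow> (\<And>x. x \<in> carrier G \<Longrightarrow> c \<otimes> x = x \<otimes> c) \<Longrightarrow>
        c [^] p = \<one> \<Longrightarrow> \<exists>k::nat. c = z [^] k"
begin

lemma z_pow_mod: "z [^] (k mod p) = z [^] (k::nat)"
proof -
  have "z [^] k = z [^] (p * (k div p) + k mod p)" by simp
  also have "\<dots> = (z [^] p) [^] (k div p) \<otimes> z [^] (k mod p)"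
    by (simp only: nat_pow_mult[symmetric] nat_pow_pow[symmetric] z_closed)
  finally show ?thesis by (simp add: z_pow_p)
qed

lemma z_pow_eq_1: "z [^] k = \<one> \<longleftrightarrow> p dvd (k::nat)"
proof
  assume k: "z [^] k = \<one>"
  show "p dvd k"
  proof (rule ccontr)
    assume "\<not> p dvd k"
    then obtain q n where "k * q = p * n + 1" using bezout_mod_prime[OF prime_p] by metis
    then have "(z [^] k) [^] q = (z [^] p) [^] n \<otimes> z"
      by (metis nat_pow_mult nat_pow_pow nat_pow_eone z_closed)
    then show False using k z_pow_p z_ne_1 by simp
  qed
next
  assume "p dvd k"
  then show "z [^] k = \<one>" by (metis z_pow_mod dvd_imp_mod_0 nat_pow_0)
qed

lemma z_pow_eq: "z [^] k = z [^] l \<longleftrightarrow> k mod p = l mod (p::nat)"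
proof (induction k l rule: linorder_wlog)
  case (le a b)
  have "z [^] b = z [^] a \<otimes> z [^] (b - a)" using le by (simp add: nat_pow_mult)
  then have "z [^] a = z [^] b \<longleftrightarrow> z [^] (b - a) = \<one>" by simp
  also have "\<dots> \<longleftrightarrow> a mod p = b mod p"
    using le by (simp add: z_pow_eq_1 mod_eq_dvd_iff_nat eq_commute[of "a mod p"])
  finally show ?case .
qed (simp add: eq_commute)

lemma z_pow_comm: "x \<in> carrier G \<Longrightarrow> z [^] (k::nat) \<otimes> x = x \<otimes> z [^] k"
  by (rule group_commutes_pow[OF z_comm]) simp_all

text \<open>Keeps all exponents in \<open>nat\<close>: inverses of powers of z are again written as
  natural powers.\<close>

lemma z_pow_inverse: obtains l where "z [^] (k::nat) \<otimes> z [^] (l::nat) = \<one>"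
proof
  show "z [^] k \<otimes> z [^] (p * k - k) = \<one>"
    using p_gt_1 by (simp add: nat_pow_mult z_pow_eq_1)
qed

lemma in_coset_iff:
  assumes "x \<in> carrier G" "y \<in> carrier G"
  shows "(\<exists>k::nat. x = y \<otimes> z [^] k) \<longleftrightarrow> (\<exists>k::nat. inv y \<otimes> x = z [^] k)"
  using assms by (simp add: inv_solve_left')

text \<open>The exponents of z in the values of \<open>h\<close> add up modulo p and vanish at z, so
  \<open>no_index_p\<close> applies to them. Every discrepancy between two homomorphisms below is
  removed by this lemma.\<close>

lemma hom_to_center_trivial:
  assumes h: "\<And>x. x \<in> carrier G \<Longrightarrow> \<exists>k::nat. h x = z [^] k"
    and mult: "\<And>x y. x \<in> carrier G \<Longrightarrow> y \<in> carrier G \<Longrightarrow> h (x \<otimes> y) = h x \<otimes> h y"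
    and "h z = \<one>" and x: "x \<in> carrier G"
  shows "h x = \<one>"
proof -
  obtain l :: "_ \<Rightarrow> nat" where l: "h x = z [^] l x" if "x \<in> carrier G" for x using h by metis
  have "l x mod p = 0"
  proof (rule no_index_p[OF _ _ x])
    show "l (x \<otimes> y) mod p = (l x + l y) mod p" if "x \<in> carrier G" "y \<in> carrier G" for x y
      using mult[OF that] that by (simp add: l nat_pow_mult z_pow_eq)
    show "l z mod p = 0" using \<open>h z = \<one>\<close> by (simp add: l z_pow_eq_1 mod_eq_0_iff_dvd)
  qed
  then show ?thesis using x by (simp add: l z_pow_eq_1 mod_eq_0_iff_dvd)
qed

text \<open>The p-th roots of unity are powers of \<open>\<omega>\<close>, so the exponents again
  form a homomorphism to Z_p that vanishes at z.\<close>

lemma character_order_p_trivial: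
  assumes mult: "\<And>x y. x \<in> carrier G \<Longrightarrow> y \<in> carrier G \<Longrightarrow> \<chi> (x \<otimes> y) = \<chi> x * \<chi> y"
    and pow: "\<And>x. x \<in> carrier G \<Longrightarrow> (\<chi> x :: 'k) ^ p = 1"
    and "\<chi> z = 1" and x: "x \<in> carrier G"
  shows "\<chi> x = 1"
proof -
  have "\<exists>k. \<chi> x = \<omega> ^ k" if "x \<in> carrier G" for x
    using root_of_unity_eq_omega_pow[OF pow[OF that]] by metis
  then obtain l :: "_ \<Rightarrow> nat" where l: "\<chi> x = \<omega> ^ l x" if "x \<in> carrier G" for x by metis
  have "l x mod p = 0"
  proof (rule no_index_p[OF _ _ x])
    show "l (x \<otimes> y) mod p = (l x + l y) mod p" if "x \<in> carrier G" "y \<in> carrier G" for x y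
      using mult[OF that] that by (simp add: l flip: power_add omega_pow_eq)
    show "l z mod p = 0" using \<open>\<chi> z = 1\<close> by (simp add: l omega_pow_eq_1 mod_eq_0_iff_dvd)
  qed
  then show ?thesis using x by (simp add: l omega_pow_eq_1 mod_eq_0_iff_dvd)
qed

text \<open>The character group of \<open>G / \<langle>z\<rangle>\<close> is finite without elements of order \<open>p\<close>, hence
  \<open>p\<close>-divisible.\<close>

lemma character_p_divisible:
  assumes mult: "\<And>x y. x \<in> carrier G \<Longrightarrow> y \<in> carrier G \<Longrightarrow> N (x \<otimes> y) = N x * N y"
    and ne: "\<And>x. x \<in> carrier G \<Longrightarrow> (N x :: 'k) \<noteq> 0" and z: "N z = 1"
  obtains q :: nat where "\<And>x. x \<in> carrier G \<Longrightarrow> (N x ^ q) ^ p = N x"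
proof -
  have N1: "N \<one> = 1" using mult[of \<one> \<one>] ne[of \<one>] by simp
  have N_pow: "N (x [^] (k::nat)) = N x ^ k" if "x \<in> carrier G" for x k
    using that by (induction k) (auto simp: N1 mult mult.commute)
  have order_pos: "Coset.order G \<noteq> 0" using order_gt_0_iff_finite finite_G by simp
  obtain e m where em: "Coset.order G = p ^ e * m" "\<not> p dvd m"
  proof -
    have "\<not> is_unit p" using p_gt_1 by simp
    then show ?thesis using that multiplicity_decompose'[of "Coset.order G" p] order_pos by metis
  qed
  have "(N x ^ m) ^ (p ^ e) = 1" if "x \<in> carrier G" for x
  proof -
    have "(N x ^ m) ^ (p ^ e) = N x ^ Coset.order G"
      unfolding em(1) by (simp only: power_mult[symmetric] mult.commute)
    also have "\<dots> = N (x [^] Coset.order G)" by (rule N_pow[OF that, symmetric])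
    finally show ?thesis by (simp only: pow_order_eq_1[OF that] N1)
  qed
  then have Nm: "N x ^ m = 1" if "x \<in> carrier G" for x
    using that
  proof (induction e)
    case (Suc e)
    \<comment> \<open>This power of \<open>N\<close> is a character with values in the p-th roots of
      unity, hence trivial; each such argument strips one factor p from the order.\<close>
    have "(N y ^ m) ^ (p ^ e) = 1" if "y \<in> carrier G" for y
    proof (rule character_order_p_trivial[of "\<lambda>y. (N y ^ m) ^ (p ^ e)"])
      show "((N x ^ m) ^ p ^ e) ^ p = 1" if "x \<in> carrier G" for x
        using Suc.prems(1)[OF that] by (simp only: power_mult[symmetric] power_Suc mult_ac)
    qed (use that in \<open>simp_all add: mult z power_mult_distrib\<close>)
    then show ?case using Suc by blast
  qed simp
  \<comment> \<open>\<open>q\<close> inverts p modulo the exponent m that is left, so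
    \<open>N x ^ q\<close> is a p-th root of \<open>N x\<close>.\<close>
  from em(2) obtain q n where qn: "p * q = m * n + 1"
  proof -
    have "coprime p m" using em(2) prime_p prime_imp_coprime by blast
    then show ?thesis using bezout_nat[of p m] that p_gt_1 by auto
  qed
  have "(N x ^ q) ^ p = N x" if "x \<in> carrier G" for x
  proof -
    have "(N x ^ q) ^ p = N x ^ (m * n + 1)"
      by (simp only: power_mult[symmetric] mult.commute[of q] qn)
    also have "\<dots> = (N x ^ m) ^ n * N x" by (simp add: power_add power_mult)
    finally show ?thesis using Nm[OF that] by simp
  qed
  then show ?thesis using that by blast
qed

section \<open>Homogeneous functions and their restrictions to cosets\<close>

definition homog :: "'a \<Rightarrow> nat \<Rightarrow> ('a \<Rightarrow> 'k) set" where
  "homog v d = {\<phi>. \<forall>x\<in>carrier G. \<phi> (x \<otimes> v) = \<omega> ^ d * \<phi> x}"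

definition point :: "'a \<Rightarrow> 'a \<Rightarrow> 'k" where
  "point y = (\<lambda>x. if x = y then 1 else 0)"

text \<open>The function of degree d that is supported on the coset y<z> and has value 1 at y. The
  chosen exponent does not matter, because \<open>\<omega> ^ (d * k)\<close> depends on k modulo p
  only. For d = 0 this is the indicator of the coset.\<close>

definition xi :: "nat \<Rightarrow> 'a \<Rightarrow> 'a \<Rightarrow> 'k" where
  "xi d y = (\<lambda>x. if \<exists>k::nat. x = y \<otimes> z [^] k
    then \<omega> ^ (d * (SOME k::nat. x = y \<otimes> z [^] k)) else 0)"

lemma xi_coset:
  assumes "y \<in> carrier G"
  shows "xi d y (y \<otimes> z [^] (k::nat)) = \<omega> ^ (d * k)"
proof -
  define l :: nat where "l = (SOME l. y \<otimes> z [^] k = y \<otimes> z [^] l)"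
  have "y \<otimes> z [^] k = y \<otimes> z [^] l" unfolding l_def by (rule someI) (rule refl)
  then have "k mod p = l mod p" using assms by (simp add: z_pow_eq)
  then have "\<omega> ^ k = \<omega> ^ l" by (simp add: omega_pow_eq)
  then have "\<omega> ^ (d * k) = \<omega> ^ (d * l)" by (metis power_mult mult.commute)
  then show ?thesis unfolding xi_def l_def by auto
qed

lemma xi_self [simp]: "y \<in> carrier G \<Longrightarrow> xi d y y = 1"
  using xi_coset[of y d 0] by simp

lemma xi_nonzero: "xi d y x \<noteq> 0 \<Longrightarrow> \<exists>k::nat. x = y \<otimes> z [^] k"
  by (auto simp: xi_def split: if_splits)

lemma xi_outside: "\<not> (\<exists>k::nat. x = y \<otimes> z [^] k) \<Longrightarrow> xi d y x = 0"
  by (auto simp: xi_def)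

lemma xi_in_homog:
  assumes y: "y \<in> carrier G"
  shows "xi d y \<in> homog z d"
  unfolding homog_def
proof (intro CollectI ballI)
  fix x assume x: "x \<in> carrier G"
  show "xi d y (x \<otimes> z) = \<omega> ^ d * xi d y x"
  proof (cases "\<exists>k::nat. x = y \<otimes> z [^] k")
    case True
    then obtain k :: nat where k: "x = y \<otimes> z [^] k" ..
    then have "x \<otimes> z = y \<otimes> z [^] Suc k" using y by (simp add: m_assoc)
    then show ?thesis by (simp only: k xi_coset[OF y]) (simp add: power_add)
  next
    case False
    have "\<not> (\<exists>k::nat. x \<otimes> z = y \<otimes> z [^] k)"
    proof
      assume "\<exists>k::nat. x \<otimes> z = y \<otimes> z [^] k"
      then obtain k :: nat where k: "x \<otimes> z = y \<otimes> z [^] k" ..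
      obtain l :: nat where l: "z [^] (1::nat) \<otimes> z [^] l = \<one>" by (rule z_pow_inverse)
      have "x = x \<otimes> (z [^] (1::nat) \<otimes> z [^] l)" using x l by simp
      also have "\<dots> = y \<otimes> z [^] (k + l)" using x y k by (simp add: m_assoc[symmetric] nat_pow_mult[symmetric])
      finally show False using False by blast
    qed
    then show ?thesis using False by (simp add: xi_outside)
  qed
qed

lemma homog_pow:
  assumes "\<phi> \<in> homog v d" "x \<in> carrier G" "v \<in> carrier G"
  shows "\<phi> (x \<otimes> v [^] (k::nat)) = \<omega> ^ (d * k) * \<phi> x"
proof (induction k)
  case (Suc k)
  have "\<phi> (x \<otimes> v [^] Suc k) = \<omega> ^ d * \<phi> (x \<otimes> v [^] k)"
    using assms by (simp add: homog_def m_assoc[symmetric])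
  then show ?case by (simp add: Suc power_add)
qed (use assms in simp)

text \<open>On a single coset of <z> the functions of degree d form a line, spanned by
  \<open>xi d y\<close>.\<close>

lemma homog_restrict_coset:
  assumes "\<phi> \<in> homog z d" "y \<in> carrier G"
  shows "xi 0 y x * \<phi> x = \<phi> y * xi d y x"
proof (cases "\<exists>k::nat. x = y \<otimes> z [^] k")
  case True
  then obtain k :: nat where "x = y \<otimes> z [^] k" ..
  then show ?thesis using assms by (simp add: xi_coset homog_pow)
qed (simp add: xi_outside)

lemma xi_0_idem: "y \<in> carrier G \<Longrightarrow> xi 0 y x * xi 0 y x = xi 0 y x"
  by (simp add: homog_restrict_coset[OF xi_in_homog])

lemma xi_0_eq_1_iff: "y \<in> carrier G \<Longrightarrow> xi 0 y x = 1 \<longleftrightarrow> (\<exists>k::nat. x = y \<otimes> z [^] k)"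
  using xi_nonzero[of 0 y x] xi_coset[of y 0] by auto

lemma homog_translate:
  assumes "\<phi> \<in> homog z d" "t \<in> carrier G"
  shows "(\<lambda>x. \<phi> (t \<otimes> x)) \<in> homog z d" and "(\<lambda>x. \<phi> (x \<otimes> t)) \<in> homog z d"
proof -
  have "x \<otimes> z \<otimes> t = x \<otimes> t \<otimes> z" if "x \<in> carrier G" for x
    using that assms(2) by (simp add: m_assoc z_comm)
  then show "(\<lambda>x. \<phi> (t \<otimes> x)) \<in> homog z d" "(\<lambda>x. \<phi> (x \<otimes> t)) \<in> homog z d"
    using assms by (simp_all add: homog_def m_assoc[symmetric])
qed

end

section \<open>Isomorphisms between twisted products\<close>

text \<open>
  \<open>F\<close> is the isomorphism, extended to functions that need not be extensional; \<open>a\<close> and \<open>b\<close> are the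
  inverses of \<open>\<alpha>\<^sub>1\<close> and \<open>\<beta>\<^sub>1\<close>, and \<open>z\<close>, \<open>w\<close> are the images under \<open>i\<close>, \<open>j\<close> of the character
  of \<open>\<int>\<^sub>p\<close> with value \<open>\<omega>\<close> at \<open>1\<close>. Compatibility with the comultiplication is expressed through the matrix
  entries \<open>F (point u) x\<close>.
\<close>

locale twist_iso = central_root G p \<omega> z
  for G :: "('a, 'm) monoid_scheme" (structure) and p :: nat
    and \<omega> :: "'k::field" and z :: 'a +
  fixes w :: 'a and a b :: "'a \<Rightarrow> 'a" and mA mB :: "('a \<Rightarrow> 'k) \<Rightarrow> ('a \<Rightarrow> 'k) \<Rightarrow> 'a \<Rightarrow> 'k"
    and F :: "('a \<Rightarrow> 'k) \<Rightarrow> 'a \<Rightarrow> 'k"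
  assumes w_closed [simp]: "w \<in> carrier G"
    and w_comm: "x \<in> carrier G \<Longrightarrow> w \<otimes> x = x \<otimes> w"
    and w_pow_p: "w [^] p = \<one>"
    and z_power_of_w: "\<exists>q::nat. z = w [^] q"
    and w_power_of_z: "\<exists>q::nat. w = z [^] q"
    and a_closed [simp]: "x \<in> carrier G \<Longrightarrow> a x \<in> carrier G"
    and a_mult: "x \<in> carrier G \<Longrightarrow> y \<in> carrier G \<Longrightarrow> a (x \<otimes> y) = a x \<otimes> a y"
    and a_z: "a z = z"
    and b_closed [simp]: "x \<in> carrier G \<Longrightarrow> b x \<in> carrier G"
    and b_mult: "x \<in> carrier G \<Longrightarrow> y \<in> carrier G \<Longrightarrow> b (x \<otimes> y) = b x \<otimes> b y"
    and b_w: "b w = w"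
    and mA_homogeneous: "\<phi> \<in> homog z d \<Longrightarrow> d < p \<Longrightarrow> x \<in> carrier G \<Longrightarrow> mA \<phi> \<psi> x = \<phi> x * \<psi> ((a ^^ d) x)"
    and mA_fixed: "x \<in> carrier G \<Longrightarrow> a x = x \<Longrightarrow> mA \<phi> \<psi> x = \<phi> x * \<psi> x"
    and mA_homog_0: "\<epsilon> \<in> homog z 0 \<Longrightarrow> x \<in> carrier G \<Longrightarrow> mA (\<lambda>v. \<epsilon> v * \<phi> v) \<psi> x = \<epsilon> x * mA \<phi> \<psi> x"
    and mB_homogeneous: "\<phi> \<in> homog w d \<Longrightarrow> d < p \<Longrightarrow> x \<in> carrier G \<Longrightarrow> mB \<phi> \<psi> x = \<phi> x * \<psi> ((b ^^ d) x)"
    and mB_fixed: "x \<in> carrier G \<Longrightarrow> b x = x \<Longrightarrow> mB \<phi> \<psi> x = \<phi> x * \<psi> x"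
    and F_cong: "(\<And>v. v \<in> carrier G \<Longrightarrow> \<phi> v = \<psi> v) \<Longrightarrow> x \<in> carrier G \<Longrightarrow> F \<phi> x = F \<psi> x"
    and F_add: "x \<in> carrier G \<Longrightarrow> F (\<lambda>v. \<phi> v + \<psi> v) x = F \<phi> x + F \<psi> x"
    and F_scale: "x \<in> carrier G \<Longrightarrow> F (\<lambda>v. c * \<phi> v) x = c * F \<phi> x"
    and F_inj: "(\<And>v. v \<in> carrier G \<Longrightarrow> F \<phi> v = F \<psi> v) \<Longrightarrow> x \<in> carrier G \<Longrightarrow> \<phi> x = \<psi> x"
    and F_surj: "\<exists>\<phi>. \<forall>x\<in>carrier G. F \<phi> x = \<psi> x"
    and F_comult_sum: "x \<in> carrier G \<Longrightarrow> y \<in> carrier G \<Longrightarrow>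
      F \<phi> (x \<otimes> y) = (\<Sum>u\<in>carrier G. \<Sum>v\<in>carrier G. \<phi> (u \<otimes> v) * F (point u) x * F (point v) y)"
    and F_counit: "F \<phi> \<one> = \<phi> \<one>"
    and F_one: "x \<in> carrier G \<Longrightarrow> F (\<lambda>v. 1) x = 1"
    and F_mult: "x \<in> carrier G \<Longrightarrow> F (mA \<phi> \<psi>) x = mB (F \<phi>) (F \<psi>) x"
begin

section \<open>The isomorphism as a family of functionals indexed by G\<close>

lemma F_sum:
  assumes "x \<in> carrier G"
  shows "finite S \<Longrightarrow> F (\<lambda>v. \<Sum>y\<in>S. g y v) x = (\<Sum>y\<in>S. F (g y) x)"
proof (induction S rule: finite_induct)
  case empty
  show ?case using F_scale[OF assms, of 0] by simp
qed (simp add: F_add[OF assms])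

lemma F_expand:
  assumes "x \<in> carrier G"
  shows "F \<phi> x = (\<Sum>y\<in>carrier G. \<phi> y * F (point y) x)"
proof -
  have "F \<phi> x = F (\<lambda>v. \<Sum>y\<in>carrier G. \<phi> y * point y v) x"
    by (rule F_cong[OF _ assms]) (simp add: point_def finite_G if_distrib cong: if_cong)
  then show ?thesis by (simp add: F_sum[OF assms finite_G] F_scale[OF assms])
qed

text \<open>Comultiplicativity without coordinates: the functional at x y is the convolution of the
  functionals at x and y.\<close>

lemma F_comult:
  assumes "x \<in> carrier G" "y \<in> carrier G"
  shows "F \<phi> (x \<otimes> y) = F (\<lambda>u. F (\<lambda>v. \<phi> (u \<otimes> v)) y) x"
  by (subst F_expand[OF assms(1)], subst F_expand[OF assms(2)])
    (simp add: F_comult_sum assms sum_distrib_left mult_ac)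

lemma F_swap:
  assumes "x \<in> carrier G" "y \<in> carrier G"
  shows "F (\<lambda>u. F (\<lambda>v. \<phi> u v) y) x = F (\<lambda>v. F (\<lambda>u. \<phi> u v) x) y"
proof -
  have "F (\<lambda>u. F (\<lambda>v. \<phi> u v) y) x =
      (\<Sum>u\<in>carrier G. \<Sum>v\<in>carrier G. \<phi> u v * F (point v) y * F (point u) x)"
    by (subst F_expand[OF assms(1)], subst F_expand[OF assms(2)]) (simp add: sum_distrib_right)
  also have "\<dots> = (\<Sum>v\<in>carrier G. \<Sum>u\<in>carrier G. \<phi> u v * F (point u) x * F (point v) y)"
    by (subst sum.swap) (simp add: mult_ac)
  also have "\<dots> = F (\<lambda>v. F (\<lambda>u. \<phi> u v) x) y"
    by (subst F_expand[OF assms(2)], subst F_expand[OF assms(1)]) (simp add: sum_distrib_right)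
  finally show ?thesis .
qed

text \<open>Each \<open>F (e y) x\<close> is an idempotent of the field, so 0 or 1. If all of them
  were 0, then every \<open>point y = e y * point y\<close> would be annihilated, and so would the
  constant 1, against \<open>F_one\<close>. The lemma is applied to points and to coset
  indicators.\<close>

lemma F_character_support:
  assumes x: "x \<in> carrier G"
    and mult: "\<And>y \<psi>. y \<in> carrier G \<Longrightarrow> F (\<lambda>v. e y v * \<psi> v) x = F (e y) x * F \<psi> x"
    and self: "\<And>y. y \<in> carrier G \<Longrightarrow> e y y = 1"
    and idem: "\<And>y v. y \<in> carrier G \<Longrightarrow> v \<in> carrier G \<Longrightarrow> e y v * e y v = e y v"
  obtains y where "y \<in> carrier G" "F (e y) x = 1" "\<And>\<psi>. F \<psi> x = F (\<lambda>v. e y v * \<psi> v) x"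
proof -
  have "\<exists>y\<in>carrier G. F (e y) x \<noteq> 0"
  proof (rule ccontr)
    assume neg: "\<not> ?thesis"
    have "F (point y) x = 0" if y: "y \<in> carrier G" for y
    proof -
      have "F (point y) x = F (\<lambda>v. e y v * point y v) x"
        by (rule F_cong[OF _ x]) (auto simp: point_def self[OF y])
      also have "\<dots> = 0" using neg y by (simp add: mult)
      finally show ?thesis .
    qed
    then have "F (\<lambda>v. 1) x = 0" by (subst F_expand[OF x]) simp
    then show False by (simp add: F_one[OF x])
  qed
  then obtain y where y: "y \<in> carrier G" "F (e y) x \<noteq> 0" ..
  have "F (e y) x * F (e y) x = F (\<lambda>v. e y v * e y v) x" by (simp add: mult y)
  also have "\<dots> = F (e y) x" by (rule F_cong[OF _ x]) (simp add: idem y)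
  finally have "F (e y) x = 1" using y by simp
  then show ?thesis using that[OF y(1)] mult[OF y(1)] by simp
qed

lemma F_character_point:
  assumes x: "x \<in> carrier G"
    and mult: "\<And>y \<psi>. y \<in> carrier G \<Longrightarrow> F (\<lambda>v. point y v * \<psi> v) x = F (point y) x * F \<psi> x"
  obtains y where "y \<in> carrier G" "\<And>\<psi>. F \<psi> x = \<psi> y"
proof (rule F_character_support[of x point])
  fix y assume y: "y \<in> carrier G" "F (point y) x = 1" "\<And>\<psi>. F \<psi> x = F (\<lambda>v. point y v * \<psi> v) x"
  have "F \<psi> x = \<psi> y" for \<psi>
  proof -
    have "F \<psi> x = F (\<lambda>v. \<psi> y * point y v) x"
      by (subst y(3), rule F_cong[OF _ x]) (simp add: point_def)
    then show ?thesis by (simp add: F_scale x y(2))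
  qed
  then show ?thesis using that y(1) by blast
qed (use assms in \<open>auto simp: point_def\<close>)

section \<open>Multiplicativity at w and convolution with the functional at w\<close>

lemma mA_0: "\<phi> \<in> homog z 0 \<Longrightarrow> x \<in> carrier G \<Longrightarrow> mA \<phi> \<psi> x = \<phi> x * \<psi> x"
  using mA_homogeneous[of \<phi> 0 x \<psi>] p_gt_1 by simp

lemma mB_0: "\<phi> \<in> homog w 0 \<Longrightarrow> x \<in> carrier G \<Longrightarrow> mB \<phi> \<psi> x = \<phi> x * \<psi> x"
  using mB_homogeneous[of \<phi> 0 x \<psi>] p_gt_1 by simp

text \<open>Since \<open>b\<close> fixes w, the product \<open>mB\<close> is pointwise there: the
  functional at w is a character of the twisted algebra.\<close>

lemma F_w_mult: "F (mA \<phi> \<psi>) w = F \<phi> w * F \<psi> w"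
  by (simp add: F_mult mB_fixed b_w)

text \<open>Coset indicators have degree 0, so the twisted product with them is pointwise and
  \<open>F_character_support\<close> applies. The functional is then concentrated on one coset,
  where each degree is one-dimensional.\<close>

lemma F_coset_support:
  assumes x: "x \<in> carrier G"
    and mult: "\<And>\<epsilon> \<psi>. \<epsilon> \<in> homog z 0 \<Longrightarrow> F (mA \<epsilon> \<psi>) x = F \<epsilon> x * F \<psi> x"
  obtains y where "y \<in> carrier G" "F (xi 0 y) x = 1" "\<And>\<psi>. F \<psi> x = F (\<lambda>v. xi 0 y v * \<psi> v) x"
    "\<And>d \<phi>. \<phi> \<in> homog z d \<Longrightarrow> F \<phi> x = \<phi> y * F (xi d y) x"
proof (rule F_character_support[OF x, of "xi 0"])
  show "F (\<lambda>v. xi 0 y v * \<psi> v) x = F (xi 0 y) x * F \<psi> x" if "y \<in> carrier G" for y \<psi>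
  proof -
    have "F (\<lambda>v. xi 0 y v * \<psi> v) x = F (mA (xi 0 y) \<psi>) x"
      by (rule F_cong[OF _ x]) (simp add: mA_0 xi_in_homog that)
    then show ?thesis by (simp add: mult xi_in_homog that)
  qed
next
  fix y assume y: "y \<in> carrier G" "F (xi 0 y) x = 1" "\<And>\<psi>. F \<psi> x = F (\<lambda>v. xi 0 y v * \<psi> v) x"
  have "F \<phi> x = \<phi> y * F (xi d y) x" if "\<phi> \<in> homog z d" for d \<phi>
    by (subst y(3)) (simp add: homog_restrict_coset[OF that y(1)] F_scale x)
  then show ?thesis using that y by blast
qed (auto simp: xi_0_idem)

text \<open>\<open>U \<phi> x\<close> is \<open>\<phi>\<close> convolved with the functional \<open>\<psi> \<mapsto> F \<psi> w\<close>; this functional is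
  grouplike for the dual comultiplication because \<open>b\<close> fixes \<open>w\<close>.\<close>

definition U :: "('a \<Rightarrow> 'k) \<Rightarrow> 'a \<Rightarrow> 'k" where
  "U \<phi> = (\<lambda>x. F (\<lambda>v. \<phi> (x \<otimes> v)) w)"

lemma F_U: "x \<in> carrier G \<Longrightarrow> F (U \<phi>) x = F \<phi> (x \<otimes> w)"
  by (simp add: U_def F_comult)

lemma F_U_pow: "x \<in> carrier G \<Longrightarrow> F ((U ^^ k) \<phi>) x = F \<phi> (x \<otimes> w [^] k)"
proof (induction k arbitrary: x)
  case (Suc k)
  then have "F ((U ^^ Suc k) \<phi>) x = F \<phi> (x \<otimes> w \<otimes> w [^] k)" by (simp add: F_U)
  also have "\<dots> = F \<phi> (x \<otimes> w [^] Suc k)" using Suc.prems by (simp add: m_assoc group_commutes_pow)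
  finally show ?case .
qed simp

lemma U_pow_p: "x \<in> carrier G \<Longrightarrow> (U ^^ p) \<phi> x = \<phi> x"
  by (rule F_inj) (simp_all add: F_U_pow w_pow_p)

text \<open>As w is central, left and right convolution with its functional agree. The comparison is
  made after applying \<open>F\<close>, which is injective.\<close>

lemma U_left:
  assumes x: "x \<in> carrier G"
  shows "U \<phi> x = F (\<lambda>v. \<phi> (v \<otimes> x)) w"
proof (rule F_inj[OF _ x])
  fix y assume y: "y \<in> carrier G"
  have "F (U \<phi>) y = F \<phi> (w \<otimes> y)" using y by (simp add: F_U w_comm)
  also have "\<dots> = F (\<lambda>x. F (\<lambda>v. \<phi> (v \<otimes> x)) w) y" using y by (simp only: F_comult F_swap[OF w_closed y] w_closed)
  finally show "F (U \<phi>) y = F (\<lambda>x. F (\<lambda>v. \<phi> (v \<otimes> x)) w) y" .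
qed

lemma U_invariant: "(\<And>v. v \<in> carrier G \<Longrightarrow> U \<phi> v = \<phi> v) \<Longrightarrow> F \<phi> \<in> homog w 0"
  unfolding homog_def using F_cong[of "U \<phi>" \<phi>] by (simp add: F_U)

lemma U_in_homog: "\<phi> \<in> homog z d \<Longrightarrow> U \<phi> \<in> homog z d"
proof -
  assume \<phi>: "\<phi> \<in> homog z d"
  have "U \<phi> (x \<otimes> z) = \<omega> ^ d * U \<phi> x" if x: "x \<in> carrier G" for x
  proof -
    have "U \<phi> (x \<otimes> z) = F (\<lambda>v. \<omega> ^ d * \<phi> (x \<otimes> v)) w"
      unfolding U_def
    proof (rule F_cong)
      fix v assume v: "v \<in> carrier G"
      have "x \<otimes> z \<otimes> v = x \<otimes> v \<otimes> z" using x v by (simp add: m_assoc z_comm)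
      then show "\<phi> (x \<otimes> z \<otimes> v) = \<omega> ^ d * \<phi> (x \<otimes> v)" using \<phi> x v by (simp add: homog_def)
    qed simp
    then show ?thesis by (simp add: U_def F_scale)
  qed
  then show ?thesis by (simp add: homog_def)
qed

section \<open>The coset that supports the functional at w\<close>

definition w_support :: "'a \<Rightarrow> bool" where
  "w_support y \<longleftrightarrow> y \<in> carrier G \<and> F (xi 0 y) w = 1 \<and>
    (\<forall>\<psi>. F \<psi> w = F (\<lambda>v. xi 0 y v * \<psi> v) w)"

lemma w_support_exists: obtains y where "w_support y"
  using F_coset_support[OF w_closed F_w_mult] unfolding w_support_def by metis

text \<open>A function of degree 0 is constant on the supporting coset, so the choice of the
  representative y is immaterial and the functional reduces to evaluation at y.\<close>

lemma w_support_homog_0: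
  assumes y: "w_support y" and \<phi>: "\<phi> \<in> homog z 0"
  shows "F \<phi> w = \<phi> y"
proof -
  have "F \<phi> w = F (\<lambda>v. xi 0 y v * \<phi> v) w" using y unfolding w_support_def by blast
  also have "(\<lambda>v. xi 0 y v * \<phi> v) = (\<lambda>v. \<phi> y * xi 0 y v)"
    using homog_restrict_coset[OF \<phi>] y unfolding w_support_def by blast
  finally show ?thesis using y by (simp add: F_scale w_support_def)
qed

lemma U_homog_0:
  assumes y: "w_support y" and \<phi>: "\<phi> \<in> homog z 0" and x: "x \<in> carrier G"
  shows "U \<phi> x = \<phi> (x \<otimes> y)" and "U \<phi> x = \<phi> (y \<otimes> x)"
  using w_support_homog_0[OF y homog_translate(1)[OF \<phi> x]]
    w_support_homog_0[OF y homog_translate(2)[OF \<phi> x]]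
  by (simp_all add: U_left[OF x]) (simp add: U_left[OF x, symmetric] U_def)

text \<open>The two formulas for \<open>U\<close> in degree 0, tested on a coset indicator, show
  that y commutes with x modulo <z>. The commutator with y is then a homomorphism into <z> that
  kills z, hence trivial.\<close>

lemma w_support_comm:
  assumes y: "w_support y" and x: "x \<in> carrier G"
  shows "y \<otimes> x = x \<otimes> y"
proof -
  have yc [simp]: "y \<in> carrier G" using y by (simp add: w_support_def)
  define h where "h x = inv (y \<otimes> x) \<otimes> (x \<otimes> y)" for x
  have h: "x \<otimes> y = y \<otimes> x \<otimes> h x" "h x \<in> carrier G" if "x \<in> carrier G" for x
    using that by (simp_all add: h_def m_assoc[symmetric])
  have hz: "\<exists>k::nat. h x = z [^] k" if x: "x \<in> carrier G" for x
  proof -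
    have "xi 0 (y \<otimes> x) (x \<otimes> y) = xi 0 (y \<otimes> x) (y \<otimes> x)"
      using U_homog_0[OF y _ x, of "xi 0 (y \<otimes> x)"] x by (simp add: xi_in_homog)
    then have "\<exists>k::nat. x \<otimes> y = y \<otimes> x \<otimes> z [^] k"
      using x xi_0_eq_1_iff[of "y \<otimes> x" "x \<otimes> y"] by simp
    then show ?thesis using x in_coset_iff[of "x \<otimes> y" "y \<otimes> x"] by (simp add: h_def)
  qed
  have h_comm: "h u \<otimes> v = v \<otimes> h u" if "u \<in> carrier G" "v \<in> carrier G" for u v
    using hz[OF that(1)] z_pow_comm[OF that(2)] by auto
  have "h x = \<one>"
  proof (rule hom_to_center_trivial[OF hz _ _ x])
    fix u v assume u: "u \<in> carrier G" and v: "v \<in> carrier G"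
    have "y \<otimes> (u \<otimes> v) \<otimes> h (u \<otimes> v) = u \<otimes> v \<otimes> y" using u v h(1)[of "u \<otimes> v"] by simp
    also have "\<dots> = u \<otimes> (y \<otimes> v \<otimes> h v)" using u v h(1)[OF v] by (simp add: m_assoc)
    also have "\<dots> = u \<otimes> y \<otimes> (v \<otimes> h v)" using u v h(2)[OF v] by (simp add: m_assoc)
    also have "\<dots> = y \<otimes> u \<otimes> (h u \<otimes> v) \<otimes> h v" using u v h[OF u] h(2)[OF v] by (simp add: m_assoc)
    also have "\<dots> = y \<otimes> (u \<otimes> v) \<otimes> (h u \<otimes> h v)"
      using u v h(2) by (simp only: h_comm[OF u v]) (simp add: m_assoc)
    finally show "h (u \<otimes> v) = h u \<otimes> h v" using u v h(2) by simp
  next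
    show "h z = \<one>" using z_comm[of y] by (simp add: h_def)
  qed
  then show ?thesis using h(1)[OF x] x by simp
qed

lemma U_pow_homog_0:
  assumes y: "w_support y"
  shows "\<phi> \<in> homog z 0 \<Longrightarrow> x \<in> carrier G \<Longrightarrow> (U ^^ k) \<phi> x = \<phi> (x \<otimes> y [^] k)"
proof (induction k arbitrary: \<phi>)
  case (Suc k)
  have yc: "y \<in> carrier G" using y by (simp add: w_support_def)
  have "(U ^^ Suc k) \<phi> x = (U ^^ k) (U \<phi>) x" by (simp only: funpow_Suc_right o_apply)
  also have "\<dots> = U \<phi> (x \<otimes> y [^] k)" using Suc by (simp add: U_in_homog)
  finally show ?case using Suc.prems yc by (simp add: U_homog_0(1)[OF y] m_assoc)
qed simp

text \<open>In degree 0 the operator \<open>U\<close> is translation by y, and its p-th power is the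
  identity; the indicator of <z> detects the consequence.\<close>

lemma w_support_pow_p:
  assumes y: "w_support y"
  shows "\<exists>k::nat. y [^] p = z [^] k"
proof -
  have yc: "y \<in> carrier G" using y by (simp add: w_support_def)
  have "xi 0 \<one> (\<one> \<otimes> y [^] p) = 1"
    using U_pow_homog_0[OF y xi_in_homog, of \<one> \<one> p] U_pow_p[of \<one> "xi 0 \<one>"] by simp
  then show ?thesis using yc xi_0_eq_1_iff[of \<one> "y [^] p"] by simp
qed

text \<open>Convolving with a functional supported on y<z> moves supports by the inverse of y, so
  the k-th iterate lives on the coset of y^(-k). This separates the terms of the average in
  \<open>U_invariant_homog_1\<close> at the identity.\<close>

lemma U_pow_xi_support:
  assumes y: "w_support y"
  shows "x \<in> carrier G \<Longrightarrow> (U ^^ k) (xi 1 \<one>) x \<noteq> 0 \<Longrightarrow> \<exists>l::nat. x \<otimes> y [^] k = z [^] l"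
proof (induction k arbitrary: x)
  case 0
  then show ?case using xi_nonzero[of 1 \<one> x] by auto
next
  case (Suc k)
  have yc [simp]: "y \<in> carrier G" using y by (simp add: w_support_def)
  let ?\<phi> = "(U ^^ k) (xi 1 \<one>)"
  have U: "U ?\<phi> x = F (\<lambda>v. xi 0 y v * ?\<phi> (x \<otimes> v)) w" using y unfolding U_def w_support_def by blast
  have "\<exists>v\<in>carrier G. xi 0 y v * ?\<phi> (x \<otimes> v) \<noteq> 0"
  proof (rule ccontr)
    assume "\<not> ?thesis"
    then have "F (\<lambda>v. xi 0 y v * ?\<phi> (x \<otimes> v)) w = F (\<lambda>v. 0 * 0) w" by (intro F_cong) auto
    also have "\<dots> = 0" by (subst F_scale) simp_all
    finally show False using U Suc.prems by simp
  qed
  then obtain v where v: "v \<in> carrier G" "xi 0 y v \<noteq> 0" "?\<phi> (x \<otimes> v) \<noteq> 0" by auto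
  then obtain m :: nat where m: "v = y \<otimes> z [^] m" using xi_nonzero by blast
  obtain l :: nat where l: "x \<otimes> v \<otimes> y [^] k = z [^] l" using Suc.IH[of "x \<otimes> v"] Suc.prems v by auto
  obtain n :: nat where n: "z [^] m \<otimes> z [^] n = \<one>" by (rule z_pow_inverse)
  have "y \<otimes> y [^] k = y [^] Suc k" using nat_pow_Suc2[of y k] by simp
  then have "x \<otimes> v \<otimes> y [^] k = x \<otimes> y [^] Suc k \<otimes> z [^] m"
    using Suc.prems z_pow_comm[of "y [^] k" m] by (simp add: m m_assoc)
      (simp add: m_assoc[symmetric])
  then have "x \<otimes> y [^] Suc k \<otimes> (z [^] m \<otimes> z [^] n) = z [^] l \<otimes> z [^] n"
    using l Suc.prems by (simp add: m_assoc[symmetric])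
  then have "x \<otimes> y [^] Suc k = z [^] (l + n)" using n Suc.prems by (simp add: nat_pow_mult)
  then show ?case by blast
qed

section \<open>The case that y lies outside <z>\<close>

lemma U_sum: "x \<in> carrier G \<Longrightarrow> finite S \<Longrightarrow> U (\<lambda>v. \<Sum>k\<in>S. g k v) x = (\<Sum>k\<in>S. U (g k) x)"
  by (simp add: U_def F_sum)

text \<open>The witness is obtained by averaging \<open>xi 1 \<one>\<close> over the powers of \<open>U\<close>.\<close>

lemma U_invariant_homog_1:
  assumes y: "w_support y" and outside: "\<nexists>k::nat. y = z [^] k"
  obtains \<psi> where "\<psi> \<in> homog z 1" "\<psi> \<one> = 1" "\<And>x. x \<in> carrier G \<Longrightarrow> U \<psi> x = \<psi> x"
proof
  have yc [simp]: "y \<in> carrier G" using y by (simp add: w_support_def)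
  let ?g = "\<lambda>k. (U ^^ k) (xi 1 \<one>)"
  let ?\<psi> = "\<lambda>x. \<Sum>k<p. ?g k x"
  have "?g k \<in> homog z 1" for k by (induction k) (auto intro: U_in_homog xi_in_homog)
  then show "?\<psi> \<in> homog z 1" by (simp add: homog_def sum_distrib_left)
  \<comment> \<open>A nonzero value would put y^k into <z>. As y^p lies there too and k is prime to
    p, so would y itself.\<close>
  have "?g k \<one> = 0" if k: "0 < k" "k < p" for k
  proof (rule ccontr)
    assume "?g k \<one> \<noteq> 0"
    then obtain l :: nat where l: "y [^] k = z [^] l" using U_pow_xi_support[OF y, of \<one> k] by auto
    obtain m :: nat where m: "y [^] p = z [^] m" using w_support_pow_p[OF y] ..
    have "\<not> p dvd k" using k by (meson nat_dvd_not_less)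
    then obtain q n where qn: "k * q = p * n + 1" using bezout_mod_prime[OF prime_p] by metis
    obtain r :: nat where r: "z [^] (m * n) \<otimes> z [^] r = \<one>" by (rule z_pow_inverse)
    have "z [^] (l * q) = y [^] (k * q)" by (simp add: nat_pow_pow[symmetric] l)
    also have "\<dots> = y [^] (1 + p * n)" by (simp only: qn add.commute)
    also have "\<dots> = y \<otimes> (y [^] p) [^] n" by (simp only: nat_pow_mult[symmetric] nat_pow_pow nat_pow_eone yc)
    also have "\<dots> = y \<otimes> z [^] (m * n)" by (simp add: m nat_pow_pow)
    finally have "z [^] (l * q) \<otimes> z [^] r = y \<otimes> (z [^] (m * n) \<otimes> z [^] r)" by (simp add: m_assoc)
    then have "y = z [^] (l * q + r)" by (simp add: r nat_pow_mult)
    then show False using outside by blast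
  qed
  then have "(\<Sum>k\<in>{..<p} - {0}. ?g k \<one>) = 0" by (intro sum.neutral) auto
  then show "?\<psi> \<one> = 1" using p_gt_1 by (simp add: sum.remove[of "{..<p}" 0])
  fix x assume x: "x \<in> carrier G"
  have "U ?\<psi> x = (\<Sum>k<p. ?g (Suc k) x)" using x by (simp add: U_sum)
  \<comment> \<open>\<open>U\<close> shifts the index by one, and the new last term equals the lost
    first one because U^p is the identity.\<close>
  also have "\<dots> = (\<Sum>k<Suc p. ?g k x) - ?g 0 x" by (simp only: sum.lessThan_Suc_shift) simp
  also have "\<dots> = ?\<psi> x" using U_pow_p[OF x] by simp
  finally show "U ?\<psi> x = ?\<psi> x" .
qed

text \<open>Both \<open>\<phi>\<close> and a translate of the invariant function of degree 1 are
  mapped to degree 0, where products commute. Hence they commute already under \<open>mA\<close>;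
  one order of the factors leaves \<open>\<phi>\<close> alone and the other composes it with
  \<open>a\<close>.\<close>

lemma homog_0_a_invariant:
  assumes y: "w_support y" and outside: "\<nexists>k::nat. y = z [^] k"
    and \<phi>: "\<phi> \<in> homog z 0" "\<And>x. x \<in> carrier G \<Longrightarrow> \<phi> (x \<otimes> y) = \<phi> x" and x: "x \<in> carrier G"
  shows "\<phi> (a x) = \<phi> x"
proof -
  obtain \<psi> where \<psi>: "\<psi> \<in> homog z 1" "\<psi> \<one> = 1" "\<And>x. x \<in> carrier G \<Longrightarrow> U \<psi> x = \<psi> x"
    using U_invariant_homog_1[OF y outside] by metis
  \<comment> \<open>Translated so that its value at x is 1 and can be cancelled at the end.\<close>
  let ?\<psi> = "\<lambda>v. \<psi> (inv x \<otimes> v)"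
  have "U ?\<psi> v = ?\<psi> v" if "v \<in> carrier G" for v
  proof -
    have "U ?\<psi> v = U \<psi> (inv x \<otimes> v)"
      unfolding U_def using that x by (intro F_cong) (auto simp: m_assoc)
    then show ?thesis using \<psi>(3)[of "inv x \<otimes> v"] that x by simp
  qed
  then have F\<psi>: "F ?\<psi> \<in> homog w 0" by (rule U_invariant)
  have F\<phi>: "F \<phi> \<in> homog w 0" by (rule U_invariant) (simp add: U_homog_0(1)[OF y \<phi>(1)] \<phi>(2))
  have "F (mA \<phi> ?\<psi>) v = F (mA ?\<psi> \<phi>) v" if "v \<in> carrier G" for v
    using that by (simp add: F_mult mB_0 F\<psi> F\<phi> mult.commute)
  then have "mA \<phi> ?\<psi> x = mA ?\<psi> \<phi> x" using x by (rule F_inj)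
  moreover have "?\<psi> \<in> homog z 1" using homog_translate(1)[OF \<psi>(1)] x by simp
  ultimately show ?thesis
    using x p_gt_1 \<psi>(2) mA_homogeneous[of ?\<psi> 1 x \<phi>] by (simp add: mA_0 \<phi>(1))
qed

lemma generate_central:
  assumes "S \<subseteq> carrier G" "\<And>s x. s \<in> S \<Longrightarrow> x \<in> carrier G \<Longrightarrow> s \<otimes> x = x \<otimes> s"
    and "s \<in> generate G S" "x \<in> carrier G"
  shows "s \<otimes> x = x \<otimes> s"
  using assms(3)
proof (induction s rule: generate.induct)
  case (inv h)
  have h: "h \<in> carrier G" using inv assms(1) by auto
  have "h \<otimes> (x \<otimes> inv h) = x \<otimes> h \<otimes> inv h"
    using h assms(4) by (simp add: m_assoc[symmetric] assms(2)[OF inv assms(4)])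
  then show ?case using h assms(4) by (simp add: inv_solve_left' m_assoc)
next
  case (eng g h)
  have gh: "g \<in> carrier G" "h \<in> carrier G" using eng generate_incl[OF assms(1)] by auto
  then have "g \<otimes> h \<otimes> x = g \<otimes> (h \<otimes> x)" using assms(4) by (simp add: m_assoc)
  also have "h \<otimes> x = x \<otimes> h" using eng assms(4) by blast
  also have "g \<otimes> (x \<otimes> h) = g \<otimes> x \<otimes> h" using gh assms(4) by (simp add: m_assoc)
  also have "g \<otimes> x = x \<otimes> g" using eng assms(4) by blast
  also have "x \<otimes> g \<otimes> h = x \<otimes> (g \<otimes> h)" using gh assms(4) by (simp add: m_assoc)
  finally show ?case .
qed (use assms in auto)

text \<open>Indicators of cosets of L = <z, y> are invariant under \<open>a\<close>, so
  \<open>a\<close> differs from the identity by a homomorphism \<open>h\<close> into the central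
  subgroup L. Its p-th power takes values in <z> and is trivial; then the values of \<open>h\<close>
  are central with p-th power 1, so they lie in <z> by \<open>central_p\<close>, and
  \<open>h\<close> is trivial as well.\<close>

lemma a_trivial:
  assumes y: "w_support y" and outside: "\<nexists>k::nat. y = z [^] k" and x: "x \<in> carrier G"
  shows "a x = x"
proof -
  have yc [simp]: "y \<in> carrier G" using y by (simp add: w_support_def)
  define L where "L = generate G {z, y}"
  interpret L: subgroup L G unfolding L_def by (rule generate_is_subgroup) auto
  have L_comm: "s \<otimes> v = v \<otimes> s" if "s \<in> L" "v \<in> carrier G" for s v
    by (rule generate_central[of "{z, y}"]) (use that w_support_comm[OF y] z_comm L_def in auto)
  have zyL: "z \<in> L" "y \<in> L" unfolding L_def by (auto intro: generate.incl)
  have gens: "\<exists>k::nat. s [^] p = z [^] k" if "s \<in> {z, y}" for s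
    using that w_support_pow_p[OF y] by auto
  have L_pow: "\<exists>k::nat. s [^] p = z [^] k" if "s \<in> L" for s
    using that unfolding L_def
  proof (induction s rule: generate.induct)
    case (incl h)
    then show ?case using gens by blast
  next
    case (inv h)
    then have h: "h \<in> carrier G" by auto
    obtain k :: nat where k: "h [^] p = z [^] k" using gens[OF inv] ..
    obtain l :: nat where l: "z [^] k \<otimes> z [^] l = \<one>" by (rule z_pow_inverse)
    have "z [^] l \<otimes> z [^] k = \<one>" using l by (simp add: nat_pow_mult add.commute)
    then have "inv (h [^] p) = z [^] l" using k by (simp add: inv_equality)
    then have "inv h [^] p = z [^] l" using h by (simp add: nat_pow_inv)
    then show ?case by blast
  next
    case (eng g h)
    then have gh: "g \<in> L" "h \<in> L" by (simp_all add: L_def)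
    obtain k l :: nat where "g [^] p = z [^] k" "h [^] p = z [^] l" using eng by auto
    moreover have "(g \<otimes> h) [^] p = g [^] p \<otimes> h [^] p"
      using gh L_comm by (intro pow_mult_distrib) auto
    ultimately have "(g \<otimes> h) [^] p = z [^] (k + l)" by (simp add: nat_pow_mult)
    then show ?case by blast
  next
    case one
    have "\<one> [^] p = z [^] (0::nat)" by simp
    then show ?case by blast
  qed
  define h where "h v = inv v \<otimes> a v" for v
  have h: "h v \<in> L" if v: "v \<in> carrier G" for v
  proof -
    \<comment> \<open>The indicator of the coset v L.\<close>
    define \<phi> :: "'a \<Rightarrow> 'k" where "\<phi> u = (if inv v \<otimes> u \<in> L then 1 else 0)" for u
    have inv: "\<phi> (u \<otimes> s) = \<phi> u" if "u \<in> carrier G" "s \<in> L" for u s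
    proof -
      have "inv v \<otimes> (u \<otimes> s) = inv v \<otimes> u \<otimes> s" using v that by (simp add: m_assoc)
      moreover have "inv v \<otimes> u = inv v \<otimes> u \<otimes> s \<otimes> inv s" using v that by (simp add: m_assoc)
      ultimately have "inv v \<otimes> (u \<otimes> s) \<in> L \<longleftrightarrow> inv v \<otimes> u \<in> L"
        using that by (metis L.m_closed L.m_inv_closed)
      then show ?thesis by (simp add: \<phi>_def)
    qed
    have "\<phi> (a v) = \<phi> v"
      by (rule homog_0_a_invariant[OF y outside _ _ v]) (simp_all add: homog_def inv zyL)
    then show ?thesis using v by (simp add: \<phi>_def h_def split: if_splits)
  qed
  have a_h: "a v = v \<otimes> h v" if "v \<in> carrier G" for v using that by (simp add: h_def m_assoc[symmetric])
  have h_mult: "h (u \<otimes> v) = h u \<otimes> h v" if u: "u \<in> carrier G" and v: "v \<in> carrier G" for u v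
  proof -
    have hc: "h u \<in> carrier G" "h v \<in> carrier G" using h u v by auto
    have "u \<otimes> v \<otimes> h (u \<otimes> v) = u \<otimes> (h u \<otimes> v) \<otimes> h v"
      using u v hc a_mult[OF u v] by (simp add: a_h m_assoc)
    also have "\<dots> = u \<otimes> v \<otimes> (h u \<otimes> h v)"
      using u v hc by (simp only: L_comm[OF h[OF u] v]) (simp add: m_assoc)
    finally show ?thesis using u v hc h[of "u \<otimes> v"] by simp
  qed
  have h_z: "h z = \<one>" by (simp add: h_def a_z)
  have h_pow: "h v [^] p = \<one>" if "v \<in> carrier G" for v
  proof (rule hom_to_center_trivial[OF _ _ _ that])
    show "h (u \<otimes> v) [^] p = h u [^] p \<otimes> h v [^] p" if "u \<in> carrier G" "v \<in> carrier G" for u v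
      using that h L_comm by (simp add: h_mult pow_mult_distrib)
  qed (use h L_pow h_z in auto)
  have "h x = \<one>"
    by (rule hom_to_center_trivial[OF _ h_mult h_z x], rule central_p) (use h L_comm h_pow in auto)
  then show ?thesis using a_h[OF x] x by simp
qed

text \<open>If y were outside <z>, then \<open>a\<close> would be trivial and \<open>mA\<close>
  pointwise, making the functional at w an evaluation at some c in y<z>. This c turns out to be
  central with c^p = 1, which forces c, and with it y, into <z>.\<close>

lemma w_support_power_of_z:
  assumes y: "w_support y"
  shows "\<exists>k::nat. y = z [^] k"
proof (rule ccontr)
  assume outside: "\<nexists>k::nat. y = z [^] k"
  have yc [simp]: "y \<in> carrier G" using y by (simp add: w_support_def)
  have "F (\<lambda>v. point u v * \<psi> v) w = F (point u) w * F \<psi> w" for u \<psi>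
  proof -
    have "F (\<lambda>v. point u v * \<psi> v) w = F (mA (point u) \<psi>) w"
      by (rule F_cong) (simp_all add: mA_fixed a_trivial[OF y outside])
    then show ?thesis by (simp add: F_w_mult)
  qed
  then obtain c where c [simp]: "c \<in> carrier G" and F_c: "\<And>\<psi>. F \<psi> w = \<psi> c"
    using F_character_point[OF w_closed] by metis
  have "xi 0 y c = 1" using y F_c unfolding w_support_def by metis
  then obtain k :: nat where k: "c = y \<otimes> z [^] k" using xi_0_eq_1_iff[of y c] by auto
  have U_pow: "(U ^^ n) \<phi> x = \<phi> (x \<otimes> c [^] n)" if "x \<in> carrier G" for n \<phi> x
    using that by (induction n arbitrary: \<phi>)
      (simp_all add: U_def F_c m_assoc funpow_Suc_right del: funpow.simps)
  \<comment> \<open>The identity U^p = id tested on the point function at the identity.\<close>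
  have "point \<one> (c [^] p) = (1 :: 'k)"
    using U_pow[of \<one> p "point \<one>"] U_pow_p[of \<one> "point \<one>"] by (simp add: point_def)
  then have "c [^] p = \<one>" by (simp add: point_def split: if_splits)
  moreover have "c \<otimes> x = x \<otimes> c" if x: "x \<in> carrier G" for x
  proof -
    have "c \<otimes> x = y \<otimes> x \<otimes> z [^] k" using x z_pow_comm[OF x, of k] by (simp add: k m_assoc)
    then show ?thesis using x w_support_comm[OF y x] by (simp add: k m_assoc)
  qed
  ultimately obtain l :: nat where l: "c = z [^] l" using central_p[OF c] by auto
  obtain r :: nat where r: "z [^] k \<otimes> z [^] r = \<one>" by (rule z_pow_inverse)
  have "y = c \<otimes> z [^] r" by (simp add: k m_assoc r)
  then have "y = z [^] (l + r)" by (simp add: l nat_pow_mult)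
  then show False using outside by blast
qed

text \<open>The functional at w is now supported on <z>, which \<open>a\<close> fixes pointwise. The
  twist is invisible there, so the functional is evaluation at a power of z, and
  \<open>F_comult\<close> turns this into a statement about translations.\<close>

lemma F_w_translation:
  obtains s where "0 < s" "s < p" "\<And>\<phi> x. x \<in> carrier G \<Longrightarrow> F \<phi> (x \<otimes> w) = F (\<lambda>v. \<phi> (v \<otimes> z [^] s)) x"
proof -
  obtain y where y: "w_support y" by (rule w_support_exists)
  obtain k :: nat where k: "y = z [^] k" using w_support_power_of_z[OF y] ..
  define E :: "'a \<Rightarrow> 'k" where "E = xi 0 y"
  have E_homog: "E \<in> homog z 0" unfolding E_def using k by (simp add: xi_in_homog)
  have E_iff: "E x = 1 \<longleftrightarrow> (\<exists>l::nat. x = z [^] l)" for x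
  proof -
    obtain r :: nat where r: "z [^] k \<otimes> z [^] r = \<one>" by (rule z_pow_inverse)
    have "z [^] l = y \<otimes> z [^] (r + l)" for l :: nat
      by (simp add: k nat_pow_mult[symmetric] m_assoc[symmetric] r)
    moreover have "y \<otimes> z [^] l = z [^] (k + l)" for l :: nat by (simp add: k nat_pow_mult)
    ultimately show ?thesis unfolding E_def using xi_0_eq_1_iff[of y x] k by (metis nat_pow_closed z_closed)
  qed
  have FE: "F E w = 1" "\<And>\<psi>. F \<psi> w = F (\<lambda>v. E v * \<psi> v) w"
    using y unfolding w_support_def E_def by auto
  have E_0: "E x = 0" if "\<nexists>l::nat. x = z [^] l" for x
    using that E_iff[of x] k xi_nonzero[of 0 y x] xi_coset[of y 0] unfolding E_def by fastforce
  have a_z_pow: "a (z [^] (l::nat)) = z [^] l" for l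
  proof (induction l)
    case 0
    have "a \<one> \<otimes> a \<one> = a \<one>" using a_mult[of \<one> \<one>] by simp
    then show ?case by simp
  qed (simp add: a_mult a_z)
  have "F (\<lambda>v. point u v * \<psi> v) w = F (point u) w * F \<psi> w" if u: "u \<in> carrier G" for u \<psi>
  proof -
    have "F (\<lambda>v. point u v * \<psi> v) w = F (\<lambda>v. E v * (point u v * \<psi> v)) w" by (rule FE(2))
    also have "\<dots> = F (mA (\<lambda>v. E v * point u v) \<psi>) w"
    proof (rule F_cong)
      fix v assume v: "v \<in> carrier G"
      \<comment> \<open>\<open>E\<close> is the indicator of <z>: off <z> both sides vanish, and on
        <z> the product is pointwise because \<open>a\<close> fixes v.\<close>
      show "E v * (point u v * \<psi> v) = mA (\<lambda>v. E v * point u v) \<psi> v"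
        by (cases "\<exists>l::nat. v = z [^] l") (auto simp: mA_homog_0[OF E_homog v] mA_fixed a_z_pow E_0)
    qed simp
    also have "\<dots> = F (point u) w * F \<psi> w" by (simp add: F_w_mult FE(2)[of "point u"])
    finally show ?thesis .
  qed
  then obtain c where c: "c \<in> carrier G" "\<And>\<psi>. F \<psi> w = \<psi> c" using F_character_point[OF w_closed] by metis
  then obtain l :: nat where l: "c = z [^] l" using FE(1) E_iff by metis
  define s where "s = l mod p"
  have F_w: "F \<phi> (x \<otimes> w) = F (\<lambda>v. \<phi> (v \<otimes> z [^] s)) x" if "x \<in> carrier G" for \<phi> x
    using that by (simp add: F_comult c(2) s_def z_pow_mod l)
  have "s \<noteq> 0"
  proof
    \<comment> \<open>Translation by w would then be trivial on all functions, so w would be the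
      identity, although z is a power of w.\<close>
    assume "s = 0"
    obtain \<phi> where \<phi>: "\<forall>x\<in>carrier G. F \<phi> x = point \<one> x" using F_surj by metis
    have "F \<phi> (\<one> \<otimes> w) = F \<phi> \<one>"
      using \<open>s = 0\<close> by (subst F_w) (auto intro!: F_cong)
    then have "w = \<one>" using \<phi> by (simp add: point_def split: if_splits)
    then show False using z_power_of_w z_ne_1 by auto
  qed
  then show ?thesis using that[of s] F_w p_gt_1 by (simp add: s_def)
qed

section \<open>Extraction of the group automorphism\<close>

context
  fixes s :: nat
  assumes s_pos: "0 < s" and s_less: "s < p"
    and F_w: "\<And>\<phi> x. x \<in> carrier G \<Longrightarrow> F \<phi> (x \<otimes> w) = F (\<lambda>v. \<phi> (v \<otimes> z [^] s)) x"
begin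

lemma F_homog:
  assumes "\<phi> \<in> homog z d"
  shows "F \<phi> \<in> homog w (d * s)"
  using assms by (auto simp: homog_def F_w F_scale[symmetric] homog_pow[OF assms] intro!: F_cong)

text \<open>By injectivity of \<open>F\<close>, the function is invariant under z^s; since s is
  invertible modulo p, it is invariant under z.\<close>

lemma homog_0_of_F:
  assumes "F \<phi> \<in> homog w 0"
  shows "\<phi> \<in> homog z 0"
proof -
  have s_inv: "\<phi> (x \<otimes> z [^] s) = \<phi> x" if x: "x \<in> carrier G" for x
  proof (rule F_inj[OF _ x])
    show "F (\<lambda>x. \<phi> (x \<otimes> z [^] s)) v = F \<phi> v" if "v \<in> carrier G" for v
      using assms that by (simp add: homog_def F_w[symmetric])
  qed
  have inv: "\<phi> (x \<otimes> z [^] (s * k)) = \<phi> x" if x: "x \<in> carrier G" for x k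
  proof (induction k)
    case (Suc k)
    have "x \<otimes> z [^] (s * Suc k) = x \<otimes> z [^] (s * k) \<otimes> z [^] s"
      using x by (simp add: m_assoc nat_pow_mult add.commute)
    then show ?case using x Suc by (simp add: s_inv)
  qed (use x in simp)
  have "\<not> p dvd s" using s_pos s_less by (meson nat_dvd_not_less)
  then obtain q n where qn: "s * q = p * n + 1" using bezout_mod_prime[OF prime_p] by metis
  then have "z [^] (s * q) = z [^] (1::nat)" by (simp only: z_pow_eq) (metis add.commute mod_mult_self2)
  then have "z [^] (s * q) = z" by simp
  then show ?thesis using inv[of _ q] by (simp add: homog_def)
qed

text \<open>The functional at x, seen in degrees 0 and 1 only, is evaluation at y weighted by the
  d-th power of m. The pair (y, m) is determined up to multiplying y by z^k and m by
  \<open>\<omega>\<close>^(-k).\<close>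

definition rel :: "'a \<Rightarrow> 'k \<Rightarrow> 'a \<Rightarrow> bool" where
  "rel x m y \<longleftrightarrow> y \<in> carrier G \<and> m \<noteq> 0 \<and> (\<forall>\<phi>\<in>homog z 0. F \<phi> x = \<phi> y) \<and>
    (\<forall>\<phi>\<in>homog z 1. F \<phi> x = m * \<phi> y)"

lemma homog_values_mult:
  assumes x: "x \<in> carrier G" "x' \<in> carrier G" and y: "y \<in> carrier G" "y' \<in> carrier G"
    and F: "\<And>\<phi>. \<phi> \<in> homog z d \<Longrightarrow> F \<phi> x = m * \<phi> y" "\<And>\<phi>. \<phi> \<in> homog z d \<Longrightarrow> F \<phi> x' = m' * \<phi> y'"
    and \<phi>: "\<phi> \<in> homog z d"
  shows "F \<phi> (x \<otimes> x') = m * m' * \<phi> (y \<otimes> y')"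
proof -
  have "F \<phi> (x \<otimes> x') = F (\<lambda>u. m' * \<phi> (u \<otimes> y')) x"
    unfolding F_comult[OF x] using F(2)[OF homog_translate(1)[OF \<phi>]] by (intro F_cong x)
  also have "\<dots> = m' * (m * \<phi> (y \<otimes> y'))"
    using F(1)[OF homog_translate(2)[OF \<phi> y(2)]] by (simp add: F_scale x)
  finally show ?thesis by simp
qed

text \<open>\<open>F\<close> preserves degree 0, so multiplication by degree 0 functions is now
  pointwise at every x, and \<open>F_coset_support\<close> is available beyond w.\<close>

lemma rel_exists:
  assumes x: "x \<in> carrier G"
  shows "\<exists>m y. rel x m y"
proof -
  have ex: "\<exists>y m. y \<in> carrier G \<and> (\<forall>\<phi>\<in>homog z 0. F \<phi> x = \<phi> y) \<and> (\<forall>\<phi>\<in>homog z 1. F \<phi> x = m * \<phi> y)"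
    if x: "x \<in> carrier G" for x
  proof -
    have mult: "F (mA \<epsilon> \<psi>) x = F \<epsilon> x * F \<psi> x" if "\<epsilon> \<in> homog z 0" for \<epsilon> \<psi>
      using F_homog[OF that] x by (simp add: F_mult mB_0)
    show ?thesis
    proof (rule F_coset_support[OF x mult])
      fix y assume y: "y \<in> carrier G" "F (xi 0 y) x = 1"
        "\<And>d \<phi>. \<phi> \<in> homog z d \<Longrightarrow> F \<phi> x = \<phi> y * F (xi d y) x"
      then show ?thesis by (intro exI[of _ y] exI[of _ "F (xi 1 y) x"]) (auto simp: mult.commute)
    qed
  qed
  obtain y m where y: "y \<in> carrier G" "\<forall>\<phi>\<in>homog z 0. F \<phi> x = \<phi> y"
    "\<forall>\<phi>\<in>homog z 1. F \<phi> x = m * \<phi> y" using ex[OF x] by metis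
  obtain y' m' where y': "y' \<in> carrier G" "\<forall>\<phi>\<in>homog z 1. F \<phi> (inv x) = m' * \<phi> y'"
    using ex[of "inv x"] x by auto
  \<comment> \<open>By the counit the left side is 1, so the scalar m attached to x cannot
    vanish.\<close>
  have "F (xi 1 \<one>) (x \<otimes> inv x) = m * m' * xi 1 \<one> (y \<otimes> y')"
    by (rule homog_values_mult[of _ _ _ _ 1]) (use x y y' xi_in_homog in auto)
  then have "m \<noteq> 0" using x by (auto simp: F_counit)
  then show ?thesis using y unfolding rel_def by blast
qed

lemma rel_mult:
  assumes x: "x \<in> carrier G" "x' \<in> carrier G" and rel: "rel x m y" "rel x' m' y'"
  shows "rel (x \<otimes> x') (m * m') (y \<otimes> y')"
  using rel homog_values_mult[OF x, of y y' 0 1 1] homog_values_mult[OF x, of y y' 1 m m']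
  unfolding rel_def by simp

lemma rel_unique:
  assumes "rel x m y" "rel x m' y'"
  obtains k where "y' = y \<otimes> z [^] k" "m = m' * \<omega> ^ k"
proof -
  have y: "y \<in> carrier G" using assms by (simp add: rel_def)
  have "xi 0 y y = xi 0 y y'" using assms y xi_in_homog[of y 0] unfolding rel_def by metis
  then obtain k :: nat where k: "y' = y \<otimes> z [^] k" using y xi_0_eq_1_iff[of y y'] by auto
  have "m * xi 1 y y = m' * xi 1 y y'" using assms y xi_in_homog[of y 1] unfolding rel_def by metis
  then show ?thesis using that k y by (simp add: xi_coset)
qed

lemma rel_shift:
  assumes "rel x (m * \<omega> ^ k) y"
  shows "rel x m (y \<otimes> z [^] k)"
  using assms unfolding rel_def by (auto simp: homog_pow)

lemma rel_one: "rel \<one> 1 \<one>"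
  by (simp add: rel_def F_counit)

lemma rel_w: "rel w 1 (z [^] s)"
  using F_w[of \<one>] by (auto simp: rel_def F_counit)

text \<open>The \<open>p\<close>-th powers of the scalars \<open>m\<close> in \<open>rel x m y\<close> form a character of \<open>G\<close>; a \<open>p\<close>-th
  root of that character singles out one \<open>y\<close> for each \<open>x\<close>.\<close>

lemma rel_section:
  obtains D where "\<And>x. x \<in> carrier G \<Longrightarrow> \<exists>!y. rel x (D x) y"
    and "\<And>x x'. x \<in> carrier G \<Longrightarrow> x' \<in> carrier G \<Longrightarrow> D (x \<otimes> x') = D x * D x'" and "D w = 1"
proof -
  obtain m y where my: "rel x (m x) (y x)" if "x \<in> carrier G" for x using rel_exists by metis
  define N where "N x = m x ^ p" for x
  have N: "N x = c ^ p" if x: "x \<in> carrier G" and rel: "rel x c v" for x c v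
  proof -
    obtain k where k: "m x = c * \<omega> ^ k" using rel_unique[OF my[OF x] rel] by metis
    have "(\<omega> ^ k) ^ p = (\<omega> ^ p) ^ k" by (simp only: power_mult[symmetric] mult.commute)
    then show ?thesis by (simp add: N_def k power_mult_distrib omega_pow_p)
  qed
  have N_mult: "N (x \<otimes> x') = N x * N x'" if "x \<in> carrier G" "x' \<in> carrier G" for x x'
    using N[OF _ rel_mult[OF that my[OF that(1)] my[OF that(2)]]] that
    by (simp add: N_def power_mult_distrib)
  have N_ne: "N x \<noteq> 0" if "x \<in> carrier G" for x using my[OF that] by (simp add: N_def rel_def)
  have N_w: "N w = 1" using N[OF _ rel_w] by simp
  \<comment> \<open>\<open>character_p_divisible\<close> asks for triviality at z, which is reached
    as a power of w.\<close>
  have N_pow: "N (w [^] (k::nat)) = 1" for k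
    using N[OF _ rel_one] by (induction k) (simp_all add: N_mult N_w)
  then have "N z = 1" using z_power_of_w by metis
  then obtain q :: nat where q: "(N x ^ q) ^ p = N x" if "x \<in> carrier G" for x
    using character_p_divisible[of N] N_mult N_ne by metis
  have "\<exists>!v. rel x (N x ^ q) v" if x: "x \<in> carrier G" for x
  proof -
    have ne: "N x ^ q \<noteq> 0" using N_ne[OF x] by simp
    have "(m x / N x ^ q) ^ p = 1" using q[OF x] N_ne[OF x] by (simp add: power_divide N_def)
    \<comment> \<open>The chosen scalar and the p-th root \<open>N x ^ q\<close> differ by a power
      of \<open>\<omega>\<close>, which is absorbed by moving the point within its coset.\<close>
    then obtain k where "m x / N x ^ q = \<omega> ^ k" by (rule root_of_unity_eq_omega_pow)
    then have "m x = N x ^ q * \<omega> ^ k" using ne by (simp add: field_simps)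
    then have ex: "rel x (N x ^ q) (y x \<otimes> z [^] k)" using my[OF x] by (intro rel_shift) simp
    have "v' = v" if v: "rel x (N x ^ q) v" "rel x (N x ^ q) v'" for v v'
    proof -
      obtain l where l: "v' = v \<otimes> z [^] l" "N x ^ q = N x ^ q * \<omega> ^ l" by (rule rel_unique[OF v])
      then have "z [^] l = \<one>" using N_ne[OF x] by (simp add: omega_pow_eq_1 z_pow_eq_1)
      then show ?thesis using l v by (simp add: rel_def)
    qed
    then show ?thesis using ex by blast
  qed
  then show ?thesis using that[of "\<lambda>x. N x ^ q"] N_mult N_w by (simp add: power_mult_distrib)
qed

lemma automorphism_exists_of_translation:
  "\<exists>s f. 0 < s \<and> s < p \<and> (\<forall>x\<in>carrier G. f x \<in> carrier G) \<and> (\<forall>x\<in>carrier G. \<forall>y\<in>carrier G. f (x \<otimes> y) = f x \<otimes> f y) \<and>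
    inj_on f (carrier G) \<and> f w = z [^] s \<and> (\<forall>x\<in>carrier G. a (f x) = f ((b ^^ s) x))"
proof -
  obtain D where D: "\<And>x. x \<in> carrier G \<Longrightarrow> \<exists>!y. rel x (D x) y"
    "\<And>x x'. x \<in> carrier G \<Longrightarrow> x' \<in> carrier G \<Longrightarrow> D (x \<otimes> x') = D x * D x'" "D w = 1"
    by (rule rel_section) (rule that)
  define f where "f x = (THE y. rel x (D x) y)" for x
  have f: "rel x (D x) (f x)" if "x \<in> carrier G" for x
    unfolding f_def by (rule theI') (rule D(1)[OF that])
  have f_eqI: "f x = y" if "x \<in> carrier G" "rel x (D x) y" for x y
    using D(1)[OF that(1)] f[OF that(1)] that(2) by blast
  have f_closed [simp]: "f x \<in> carrier G" if "x \<in> carrier G" for x using f[OF that] by (simp add: rel_def)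
  have f_mult: "f (x \<otimes> y) = f x \<otimes> f y" if "x \<in> carrier G" "y \<in> carrier G" for x y
    using rel_mult[OF that f[OF that(1)] f[OF that(2)]] that by (intro f_eqI) (simp_all add: D(2))
  have f_w: "f w = z [^] s" by (rule f_eqI) (simp_all add: D(3) rel_w)
  have f_one: "f \<one> = \<one>" using f_mult[of \<one> \<one>] by simp
  have f_w_pow: "f (w [^] (k::nat)) = z [^] (s * k)" for k
    by (induction k) (simp_all add: f_one f_mult f_w nat_pow_mult add.commute)
  have f_kernel: "x = \<one>" if x: "x \<in> carrier G" "f x = \<one>" for x
  proof -
    \<comment> \<open>The indicator of <w>. Its preimage under \<open>F\<close> has degree 0, so an
      element of the kernel of \<open>f\<close> is not separated from the identity by
      \<open>\<psi>\<close> and lies in <w>; there \<open>f\<close> is injective because p does not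
      divide s.\<close>
    define \<psi> :: "'a \<Rightarrow> 'k" where "\<psi> v = (if \<exists>k::nat. v = w [^] k then 1 else 0)" for v
    have "\<psi> (v \<otimes> w) = \<psi> v" if v: "v \<in> carrier G" for v
    proof -
      have "v \<otimes> w = w [^] Suc k" if "v = w [^] k" for k :: nat using that by simp
      moreover have "v = w [^] (k + (p - 1))" if k: "v \<otimes> w = w [^] k" for k :: nat
      proof -
        have "v = v \<otimes> w [^] Suc (p - 1)" using v p_gt_1 w_pow_p by simp
        also have "\<dots> = v \<otimes> w \<otimes> w [^] (p - 1)" using v by (simp add: m_assoc group_commutes_pow)
        finally show ?thesis by (simp add: k nat_pow_mult)
      qed
      ultimately have "(\<exists>k::nat. v \<otimes> w = w [^] k) \<longleftrightarrow> (\<exists>k::nat. v = w [^] k)" by metis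
      then show ?thesis by (simp add: \<psi>_def)
    qed
    then have \<psi>: "\<psi> \<in> homog w 0" by (simp add: homog_def)
    obtain \<phi> where \<phi>: "\<forall>x\<in>carrier G. F \<phi> x = \<psi> x" using F_surj by metis
    then have "F \<phi> \<in> homog w 0" using \<psi> by (simp add: homog_def)
    then have "\<phi> \<in> homog z 0" by (rule homog_0_of_F)
    then have "F \<phi> x = \<phi> \<one>" using f[OF x(1)] x(2) by (simp add: rel_def)
    then have "\<psi> x = \<psi> \<one>" using \<phi> x F_counit[of \<phi>] by simp
    moreover have "\<psi> \<one> = 1" unfolding \<psi>_def by (auto intro: exI[of _ 0])
    ultimately obtain k :: nat where k: "x = w [^] k" by (auto simp: \<psi>_def split: if_splits)
    then have "p dvd s * k" using x(2) by (simp add: f_w_pow z_pow_eq_1)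
    moreover have "\<not> p dvd s" using s_pos s_less by (meson nat_dvd_not_less)
    ultimately have "p dvd k" using prime_p prime_dvd_mult_iff by blast
    then obtain l where "k = p * l" ..
    then show ?thesis by (simp add: k nat_pow_pow[symmetric] w_pow_p)
  qed
  have f_inj: "inj_on f (carrier G)"
  proof (rule inj_onI)
    fix x y assume xy: "x \<in> carrier G" "y \<in> carrier G" "f x = f y"
    have "f (x \<otimes> inv y) = f (y \<otimes> inv y)" using xy by (simp only: f_mult inv_closed)
    then have "f (x \<otimes> inv y) = \<one>" using xy(2) by (simp add: f_one)
    then have "x \<otimes> inv y = \<one>" using xy by (simp add: f_kernel)
    then have "inv (inv y) = x" using xy by (intro inv_equality) simp_all
    then show "x = y" using xy by simp
  qed
  have b_pow_closed [simp]: "(b ^^ k) x \<in> carrier G" if "x \<in> carrier G" for x k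
    using that by (induction k) auto
  have b_pow_mult: "(b ^^ k) (x \<otimes> y) = (b ^^ k) x \<otimes> (b ^^ k) y"
    if "x \<in> carrier G" "y \<in> carrier G" for x y k
    using that by (induction k) (auto simp: b_mult)
  have b_pow_w: "(b ^^ k) w = w" for k by (induction k) (auto simp: b_w)
  define h where "h x = inv (f ((b ^^ s) x)) \<otimes> a (f x)" for x
  have h: "\<exists>k::nat. h x = z [^] k" if x: "x \<in> carrier G" for x
  proof -
    \<comment> \<open>This function has degree 1 and its image has degree s, so multiplicativity of
      \<open>F\<close> compares the twist by \<open>a\<close> with the twist by
      \<open>b ^^ s\<close>. The second factor, a coset indicator, then reads off the coset of
      \<open>a (f x)\<close>.\<close>
    define \<phi> where "\<phi> = xi 1 (f x)"
    have \<phi>: "\<phi> \<in> homog z 1" "\<phi> (f x) = 1" using x by (simp_all add: xi_in_homog \<phi>_def)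
    let ?\<psi> = "xi 0 (f ((b ^^ s) x))"
    have \<psi>: "?\<psi> \<in> homog z 0" using x by (simp add: xi_in_homog)
    have prod: "mA \<phi> ?\<psi> v = \<phi> v * ?\<psi> (a v)" if "v \<in> carrier G" for v
      using mA_homogeneous[OF \<phi>(1) p_gt_1 that] by simp
    have "mA \<phi> ?\<psi> \<in> homog z 1"
      using \<phi>(1) \<psi> by (simp add: homog_def prod a_mult a_z)
    then have "F (mA \<phi> ?\<psi>) x = D x * mA \<phi> ?\<psi> (f x)"
      using f[OF x] unfolding rel_def by blast
    also have "\<dots> = D x * ?\<psi> (a (f x))" using x by (simp add: prod \<phi>(2))
    finally have "D x * ?\<psi> (a (f x)) = mB (F \<phi>) (F ?\<psi>) x" using x by (simp add: F_mult)
    also have "\<dots> = F \<phi> x * F ?\<psi> ((b ^^ s) x)"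
      using F_homog[OF \<phi>(1)] x s_less by (intro mB_homogeneous) simp_all
    also have "\<dots> = D x * ?\<psi> (f ((b ^^ s) x))"
      using f[OF x] f[OF b_pow_closed[OF x, of s]] \<phi> \<psi> x unfolding rel_def by simp
    finally have "?\<psi> (a (f x)) = 1" using f[OF x] x by (simp add: rel_def)
    then have "\<exists>k::nat. a (f x) = f ((b ^^ s) x) \<otimes> z [^] k" using x by (simp add: xi_0_eq_1_iff)
    then show ?thesis using x in_coset_iff[of "a (f x)" "f ((b ^^ s) x)"] by (simp add: h_def)
  qed
  have hc [simp]: "h x \<in> carrier G" if "x \<in> carrier G" for x using that by (simp add: h_def)
  have a_f: "a (f x) = f ((b ^^ s) x) \<otimes> h x" if "x \<in> carrier G" for x
    using that by (simp add: h_def m_assoc[symmetric])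
  have h_mult: "h (x \<otimes> y) = h x \<otimes> h y" if x: "x \<in> carrier G" and y: "y \<in> carrier G" for x y
  proof -
    let ?B = "\<lambda>x. f ((b ^^ s) x)"
    have "?B (x \<otimes> y) \<otimes> h (x \<otimes> y) = ?B x \<otimes> h x \<otimes> (?B y \<otimes> h y)"
      using x y a_f[of "x \<otimes> y"] by (simp add: f_mult a_mult a_f)
    also have "\<dots> = ?B x \<otimes> (h x \<otimes> ?B y) \<otimes> h y" using x y by (simp add: m_assoc)
    also have "h x \<otimes> ?B y = ?B y \<otimes> h x" using h[OF x] z_pow_comm y by auto
    also have "?B x \<otimes> (?B y \<otimes> h x) \<otimes> h y = ?B (x \<otimes> y) \<otimes> (h x \<otimes> h y)"
      using x y by (simp add: b_pow_mult f_mult m_assoc)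
    finally show ?thesis using x y by simp
  qed
  \<comment> \<open>\<open>a\<close> fixes z and \<open>b\<close> fixes w, so there is no
    discrepancy at w; it passes to z, a power of w, as \<open>hom_to_center_trivial\<close>
    requires.\<close>
  have "h w = \<one>"
  proof -
    have "a (z [^] (k::nat)) = z [^] k" for k
    proof (induction k)
      case 0
      have "a \<one> \<otimes> a \<one> = a \<one>" using a_mult[of \<one> \<one>] by simp
      then show ?case by simp
    qed (simp add: a_mult a_z)
    then show ?thesis by (simp add: h_def b_pow_w f_w)
  qed
  moreover have "h \<one> = \<one>" using h_mult[of \<one> \<one>] by simp
  ultimately have "h (w [^] (k::nat)) = \<one>" for k by (induction k) (simp_all add: h_mult)
  then have "h z = \<one>" using z_power_of_w by metis
  then have "h x = \<one>" if "x \<in> carrier G" for x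
    by (intro hom_to_center_trivial[of h x] h h_mult that)
  then have "\<forall>x\<in>carrier G. a (f x) = f ((b ^^ s) x)" by (simp add: a_f)
  then show ?thesis
    using s_pos s_less f_closed f_mult f_inj f_w by (intro exI[of _ s] exI[of _ f] conjI) auto
qed

end

theorem automorphism_exists:
  "\<exists>s f. 0 < s \<and> s < p \<and> (\<forall>x\<in>carrier G. f x \<in> carrier G) \<and>
    (\<forall>x\<in>carrier G. \<forall>y\<in>carrier G. f (x \<otimes> y) = f x \<otimes> f y) \<and>
    inj_on f (carrier G) \<and> f w = z [^] s \<and> (\<forall>x\<in>carrier G. a (f x) = f ((b ^^ s) x))"
proof (rule F_w_translation)
  fix s assume "0 < s" "s < p"
    and "\<And>\<phi> x. x \<in> carrier G \<Longrightarrow> F \<phi> (x \<otimes> w) = F (\<lambda>v. \<phi> (v \<otimes> z [^] s)) x"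
  show ?thesis by (rule automorphism_exists_of_translation) fact+
qed

end

section \<open>Cocentral actions of cyclic groups of prime order\<close>

lemma group_center_subgroup:
  assumes "group G"
  shows "subgroup (group_center G) G"
proof -
  interpret group G by fact
  show ?thesis
  proof
    fix x y assume "x \<in> group_center G" "y \<in> group_center G"
    then have xy: "x \<in> carrier G" "y \<in> carrier G" "\<And>v. v \<in> carrier G \<Longrightarrow> x \<otimes>\<^bsub>G\<^esub> v = v \<otimes>\<^bsub>G\<^esub> x"
      "\<And>v. v \<in> carrier G \<Longrightarrow> y \<otimes>\<^bsub>G\<^esub> v = v \<otimes>\<^bsub>G\<^esub> y"
      by (auto simp: group_center_def)
    have "x \<otimes>\<^bsub>G\<^esub> y \<otimes>\<^bsub>G\<^esub> v = v \<otimes>\<^bsub>G\<^esub> (x \<otimes>\<^bsub>G\<^esub> y)" if v: "v \<in> carrier G" for v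
    proof -
      have "x \<otimes>\<^bsub>G\<^esub> y \<otimes>\<^bsub>G\<^esub> v = x \<otimes>\<^bsub>G\<^esub> (v \<otimes>\<^bsub>G\<^esub> y)" using xy(1,2) v by (simp add: m_assoc xy(4)[OF v])
      also have "\<dots> = (x \<otimes>\<^bsub>G\<^esub> v) \<otimes>\<^bsub>G\<^esub> y" using xy(1,2) v by (simp add: m_assoc)
      also have "\<dots> = v \<otimes>\<^bsub>G\<^esub> (x \<otimes>\<^bsub>G\<^esub> y)" using xy(1,2) v by (simp only: xy(3)[OF v]) (simp add: m_assoc)
      finally show ?thesis .
    qed
    then show "x \<otimes>\<^bsub>G\<^esub> y \<in> group_center G" using xy(1,2) by (simp add: group_center_def)
  next
    fix x assume "x \<in> group_center G"
    then have x: "x \<in> carrier G" "\<And>v. v \<in> carrier G \<Longrightarrow> x \<otimes>\<^bsub>G\<^esub> v = v \<otimes>\<^bsub>G\<^esub> x"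
      by (auto simp: group_center_def)
    have "inv\<^bsub>G\<^esub> x \<otimes>\<^bsub>G\<^esub> v = v \<otimes>\<^bsub>G\<^esub> inv\<^bsub>G\<^esub> x" if v: "v \<in> carrier G" for v
    proof -
      have "x \<otimes>\<^bsub>G\<^esub> (v \<otimes>\<^bsub>G\<^esub> inv\<^bsub>G\<^esub> x) = v \<otimes>\<^bsub>G\<^esub> x \<otimes>\<^bsub>G\<^esub> inv\<^bsub>G\<^esub> x"
        using x(1) v by (simp add: m_assoc[symmetric] x(2)[OF v])
      then show ?thesis using x(1) v by (simp add: inv_solve_left' m_assoc)
    qed
    then show "inv\<^bsub>G\<^esub> x \<in> group_center G" using x(1) by (simp add: group_center_def)
  qed (auto simp: group_center_def)
qed

lemma (in group) ord_eq_prime: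
  fixes p :: nat
  assumes "Factorial_Ring.prime p" "x \<in> carrier G" "x [^] p = \<one>" "x \<noteq> \<one>"
  shows "ord x = p"
proof -
  have "ord x dvd p" using assms by (simp add: pow_eq_id)
  moreover have "ord x \<noteq> 1" using assms ord_eq_1 by blast
  ultimately show ?thesis using assms(1) unfolding prime_nat_iff by blast
qed

text \<open>A nontrivial x and the element y both generate subgroups of order p, and a finite cyclic
  group has only one of each order.\<close>

lemma (in group) finite_cyclic_pow_prime:
  fixes p :: nat
  assumes cyc: "cyclic_group G" and fin: "finite (carrier G)" and p: "Factorial_Ring.prime p"
    and x: "x \<in> carrier G" "x [^] p = \<one>" and y: "y \<in> carrier G" "y [^] p = \<one>" "y \<noteq> \<one>"
  shows "\<exists>k::nat. x = y [^] k"
proof (cases "x = \<one>")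
  case True
  then have "x = y [^] (0::nat)" by simp
  then show ?thesis by blast
next
  case False
  have "card (generate G {x}) = card (generate G {y})"
    using x y False by (simp add: generate_pow_card[symmetric] ord_eq_prime[OF p])
  then have "generate G {x} = generate G {y}"
    using x y by (intro finite_cyclic_subgroups_eq[OF cyc fin] generate_is_subgroup) auto
  then have "x \<in> generate G {y}" by (auto intro: generate.incl)
  then show ?thesis using generate_pow_on_finite_carrier[OF fin y(1)] by auto
qed

section \<open>Pointwise calculus in the automorphism group\<close>

lemma (in group) auto_pow_apply:
  assumes "f \<in> auto G" "x \<in> carrier G"
  shows "(f [^]\<^bsub>AutoGroup G\<^esub> (n::nat)) x = (f ^^ n) x"
  using assms(2)
proof (induction n arbitrary: x)
  case 0
  then show ?case by (simp add: AutoGroup_def BijGroup_def nat_pow_def)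
next
  case (Suc n)
  interpret A: group "AutoGroup G" by (rule AutoGroup)
  have f: "f \<in> carrier (AutoGroup G)" using assms(1) by (simp add: AutoGroup_def)
  have "f [^]\<^bsub>AutoGroup G\<^esub> n \<in> carrier (AutoGroup G)" using f by (rule A.nat_pow_closed)
  moreover have "f x \<in> carrier G" using assms(1) Suc.prems by (auto simp: auto_def hom_def)
  ultimately show ?case
    using f Suc by (simp add: AutoGroup_def BijGroup_def auto_def compose_eq funpow_Suc_right del: funpow.simps)
qed

lemma (in group) auto_mult_apply:
  assumes "f \<in> auto G" "g \<in> auto G" "x \<in> carrier G"
  shows "(f \<otimes>\<^bsub>AutoGroup G\<^esub> g) x = f (g x)"
  using assms by (simp add: AutoGroup_def BijGroup_def auto_def compose_eq)

lemma (in group) auto_closed: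
  assumes "f \<in> auto G" "x \<in> carrier G"
  shows "f x \<in> carrier G"
  using assms by (auto simp: auto_def hom_def)

lemma (in group) auto_hom_mult:
  assumes "f \<in> auto G" "x \<in> carrier G" "y \<in> carrier G"
  shows "f (x \<otimes> y) = f x \<otimes> f y"
  using assms by (auto simp: auto_def hom_def)

lemma (in group) auto_eqI:
  assumes "f \<in> auto G" "g \<in> auto G" "\<And>x. x \<in> carrier G \<Longrightarrow> f x = g x"
  shows "f = g"
  using assms by (intro extensionalityI[of _ "carrier G"]) (auto simp: auto_def Bij_def)

lemma (in group) auto_inv:
  assumes "f \<in> auto G"
  shows "inv\<^bsub>AutoGroup G\<^esub> f \<in> auto G"
    and "x \<in> carrier G \<Longrightarrow> f ((inv\<^bsub>AutoGroup G\<^esub> f) x) = x"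
    and "x \<in> carrier G \<Longrightarrow> (inv\<^bsub>AutoGroup G\<^esub> f) (f x) = x"
proof -
  interpret A: group "AutoGroup G" by (rule AutoGroup)
  have f: "f \<in> carrier (AutoGroup G)" using assms by (simp add: AutoGroup_def)
  have inv: "inv\<^bsub>AutoGroup G\<^esub> f \<in> carrier (AutoGroup G)" using f by (rule A.inv_closed)
  then show inv': "inv\<^bsub>AutoGroup G\<^esub> f \<in> auto G" by (simp add: AutoGroup_def)
  have one: "\<one>\<^bsub>AutoGroup G\<^esub> = (\<lambda>x\<in>carrier G. x)" by (simp add: AutoGroup_def BijGroup_def)
  show "f ((inv\<^bsub>AutoGroup G\<^esub> f) x) = x" if x: "x \<in> carrier G"
    using auto_mult_apply[OF assms inv' x] A.r_inv[OF f] x by (simp add: one)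
  show "(inv\<^bsub>AutoGroup G\<^esub> f) (f x) = x" if x: "x \<in> carrier G"
    using auto_mult_apply[OF inv' assms x] A.l_inv[OF f] x by (simp add: one)
qed

section \<open>Coordinates for an action of Z_p\<close>

locale zp_action = prime_root p \<omega> + cocentral_action "integer_mod_group p" G i \<alpha>
  for p :: nat and \<omega> :: "'k::{alg_closed_field, field_char_0}"
    and G :: "('g, 'm) monoid_scheme" and i :: "(int \<Rightarrow> 'k) \<Rightarrow> 'g" and \<alpha> :: "int \<Rightarrow> 'g \<Rightarrow> 'g"
begin

abbreviation "Zp \<equiv> integer_mod_group p"

definition chi :: "nat \<Rightarrow> int \<Rightarrow> 'k" where
  "chi k = (\<lambda>g\<in>carrier Zp. \<omega> ^ (k * nat g))"

definition gen :: 'g where "gen = i (chi 1)"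

text \<open>The inverse is taken because automorphisms act on functions through their inverses: a
  left factor of degree d twists the right one by composition with \<open>act ^^ d\<close>.\<close>

definition act :: "'g \<Rightarrow> 'g" where "act = inv\<^bsub>AutoGroup G\<^esub> (\<alpha> 1)"

lemma carrier_Zp: "carrier Zp = {0..<int p}"
  using p_gt_1 by (simp add: carrier_integer_mod_group)

lemma omega_pow_nat_mod:
  assumes "0 \<le> g"
  shows "\<omega> ^ (k * nat (g mod int p)) = \<omega> ^ (k * nat g)"
proof -
  have "\<omega> ^ nat (g mod int p) = \<omega> ^ nat g" using assms omega_pow_mod[of "nat g"] by (simp add: nat_mod_distrib)
  then show ?thesis by (metis power_mult mult.commute)
qed

lemma chi_in_dual: "chi k \<in> carrier (dual_group Zp)"
  using omega_ne_0 by (auto simp: dual_group_def hom_group_def hom_def chi_def carrier_Zp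
    omega_pow_nat_mod nat_add_distrib distrib_left power_add)

lemma chi_mult: "chi k \<otimes>\<^bsub>dual_group Zp\<^esub> chi l = chi (k + l)"
  by (auto simp: dual_group_def hom_group_def chi_def distrib_right power_add)

text \<open>A character of a cyclic group is determined by its value at the generator 1, here a
  power of \<open>\<omega>\<close>.\<close>

lemma dual_eq_chi:
  assumes \<chi>: "\<chi> \<in> carrier (dual_group Zp)"
  obtains k where "\<chi> = chi k"
proof -
  have mult: "\<chi> ((g + h) mod int p) = \<chi> g * \<chi> h" if "g \<in> carrier Zp" "h \<in> carrier Zp" for g h
    using \<chi> that by (auto simp: dual_group_def hom_group_def hom_def)
  have "\<chi> 0 = \<chi> 0 * \<chi> 0" using mult[of 0 0] by simp
  moreover have "\<chi> 0 \<noteq> 0" using \<chi> p_gt_1 by (auto simp: dual_group_def hom_group_def hom_def carrier_Zp)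
  ultimately have \<chi>_0: "\<chi> 0 = 1" by simp
  have pow: "\<chi> (int n mod int p) = \<chi> 1 ^ n" for n
  proof (induction n)
    case (Suc n)
    have "int (Suc n) mod int p = (int n mod int p + 1) mod int p"
      by (metis of_nat_Suc add.commute mod_add_left_eq)
    then show ?case using mult[of "int n mod int p" 1] Suc p_gt_1 by (simp add: carrier_Zp)
  qed (simp add: \<chi>_0)
  then have "\<chi> 1 ^ p = 1" using pow[of p] \<chi>_0 by simp
  then obtain k where k: "\<chi> 1 = \<omega> ^ k" by (rule root_of_unity_eq_omega_pow)
  have "\<chi> = chi k"
  proof (rule extensionalityI[of _ "carrier Zp"])
    fix g assume g: "g \<in> carrier Zp"
    then have "\<chi> g = \<chi> (int (nat g) mod int p)" by (simp add: carrier_Zp)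
    also have "\<dots> = \<omega> ^ (k * nat g)" by (simp only: pow k power_mult)
    finally show "\<chi> g = chi k g" using g by (simp add: chi_def)
  qed (use \<chi> in \<open>auto simp: dual_group_def hom_group_def chi_def\<close>)
  then show ?thesis using that by blast
qed

lemma i_in_center: "\<chi> \<in> carrier (dual_group Zp) \<Longrightarrow> i \<chi> \<in> group_center G"
  using i_hom by (auto simp: hom_def)

lemma i_mult: "\<chi> \<in> carrier (dual_group Zp) \<Longrightarrow> \<chi>' \<in> carrier (dual_group Zp) \<Longrightarrow>
    i (\<chi> \<otimes>\<^bsub>dual_group Zp\<^esub> \<chi>') = i \<chi> \<otimes>\<^bsub>G\<^esub> i \<chi>'"
  using i_hom by (auto simp: hom_def)

lemma gen_closed: "gen \<in> carrier G"
  using i_in_center[OF chi_in_dual, of 1] by (simp add: gen_def group_center_def)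

lemma gen_comm: "x \<in> carrier G \<Longrightarrow> gen \<otimes>\<^bsub>G\<^esub> x = x \<otimes>\<^bsub>G\<^esub> gen"
  using i_in_center[OF chi_in_dual, of 1] by (simp add: gen_def group_center_def)

lemma i_chi: "i (chi k) = gen [^]\<^bsub>G\<^esub> k"
proof (induction k)
  case 0
  have "i (chi 0) \<in> carrier G" using i_in_center[OF chi_in_dual, of 0] by (simp add: group_center_def)
  then show ?case using i_mult[OF chi_in_dual chi_in_dual, of 0 0] by (simp add: chi_mult G.l_cancel_one')
next
  case (Suc k)
  then show ?case using i_mult[OF chi_in_dual chi_in_dual, of k 1] by (simp add: chi_mult gen_def)
qed

lemma image_i: "i ` carrier (dual_group Zp) = range (\<lambda>k::nat. gen [^]\<^bsub>G\<^esub> k)"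
proof
  show "i ` carrier (dual_group Zp) \<subseteq> range (\<lambda>k::nat. gen [^]\<^bsub>G\<^esub> k)"
    using dual_eq_chi i_chi by (metis image_subsetI rangeI)
  show "range (\<lambda>k::nat. gen [^]\<^bsub>G\<^esub> k) \<subseteq> i ` carrier (dual_group Zp)"
    using chi_in_dual i_chi by (metis image_eqI image_subsetI)
qed

lemma gen_pow_p: "gen [^]\<^bsub>G\<^esub> p = \<one>\<^bsub>G\<^esub>"
proof -
  have "\<omega> ^ (p * n) = 1" for n by (simp add: power_mult omega_pow_p)
  then have "chi p = chi 0" by (simp add: chi_def)
  then show ?thesis using i_chi[of p] i_chi[of 0] by simp
qed

lemma gen_ne_1: "gen \<noteq> \<one>\<^bsub>G\<^esub>"
proof
  assume "gen = \<one>\<^bsub>G\<^esub>"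
  then have "i (chi 1) = i (chi 0)" using i_chi[of 1] i_chi[of 0] by simp
  then have "chi 1 = chi 0" using i_inj chi_in_dual by (auto dest: inj_onD)
  then have "chi 1 1 = chi 0 1" by simp
  then show False using p_gt_1 omega_ne_1 by (simp add: chi_def carrier_Zp)
qed

lemma alpha_auto: "g \<in> carrier Zp \<Longrightarrow> \<alpha> g \<in> auto G"
  using \<alpha>_hom by (auto simp: hom_def AutoGroup_def)

lemma one_in_Zp: "1 \<in> carrier Zp"
  using p_gt_1 by (simp add: carrier_Zp)

lemma alpha_pow: "\<alpha> (int n mod int p) = \<alpha> 1 [^]\<^bsub>AutoGroup G\<^esub> n"
proof -
  have "\<alpha> (1 [^]\<^bsub>Zp\<^esub> n) = \<alpha> 1 [^]\<^bsub>AutoGroup G\<^esub> n"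
    by (rule hom_nat_pow[OF \<alpha>_hom one_in_Zp \<Gamma>.group_axioms G.AutoGroup])
  then show ?thesis by simp
qed

lemma act_auto: "act \<in> auto G"
  unfolding act_def by (rule G.auto_inv(1)[OF alpha_auto[OF one_in_Zp]])

lemma alpha_gen: "g \<in> carrier Zp \<Longrightarrow> \<alpha> g gen = gen"
  unfolding gen_def by (rule \<alpha>_fixes[OF _ chi_in_dual])

lemma act_gen: "act gen = gen"
  using G.auto_inv(3)[OF alpha_auto[OF one_in_Zp] gen_closed] alpha_gen[OF one_in_Zp] by (simp add: act_def)

lemma inv_alpha:
  assumes g: "g \<in> carrier Zp" and x: "x \<in> carrier G"
  shows "(inv\<^bsub>AutoGroup G\<^esub> (\<alpha> g)) x = (act ^^ nat g) x"
proof -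
  interpret A: group "AutoGroup G" by (rule G.AutoGroup)
  have \<alpha>1: "\<alpha> 1 \<in> carrier (AutoGroup G)" using alpha_auto[OF one_in_Zp] by (simp add: AutoGroup_def)
  have "\<alpha> g = \<alpha> 1 [^]\<^bsub>AutoGroup G\<^esub> nat g" using alpha_pow[of "nat g"] g by (simp add: carrier_Zp)
  then have "inv\<^bsub>AutoGroup G\<^esub> (\<alpha> g) = act [^]\<^bsub>AutoGroup G\<^esub> nat g"
    using \<alpha>1 by (simp add: A.nat_pow_inv act_def)
  then show ?thesis by (simp add: G.auto_pow_apply[OF act_auto x])
qed

text \<open>Every character is some \<open>chi k\<close> and \<open>i\<close> sends it to the k-th
  power of \<open>gen\<close>, so the single condition at \<open>gen\<close> covers the
  quantification over all characters in \<open>grade\<close>.\<close>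

lemma gradeI:
  assumes "\<phi> \<in> extensional (carrier G)" "\<And>x. x \<in> carrier G \<Longrightarrow> \<phi> (x \<otimes>\<^bsub>G\<^esub> gen) = \<omega> ^ d * \<phi> x" "d < p"
  shows "\<phi> \<in> grade Zp G i (int d)"
proof -
  have "\<phi> (x \<otimes>\<^bsub>G\<^esub> gen [^]\<^bsub>G\<^esub> (k::nat)) = \<omega> ^ (k * d) * \<phi> x" if x: "x \<in> carrier G" for x k
  proof (induction k)
    case (Suc k)
    have "\<phi> (x \<otimes>\<^bsub>G\<^esub> gen [^]\<^bsub>G\<^esub> Suc k) = \<omega> ^ d * \<phi> (x \<otimes>\<^bsub>G\<^esub> gen [^]\<^bsub>G\<^esub> k)"
      using x gen_closed by (simp add: G.m_assoc[symmetric] assms(2))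
    then show ?case by (simp add: Suc power_add)
  qed (use x in simp)
  then have "\<phi> (x \<otimes>\<^bsub>G\<^esub> i \<chi>) = \<chi> (int d) * \<phi> x"
    if "x \<in> carrier G" "\<chi> \<in> carrier (dual_group Zp)" for x \<chi>
    using that assms(3) by (elim dual_eq_chi) (simp add: i_chi, simp add: chi_def carrier_Zp)
  then show ?thesis using assms(1) by (simp add: grade_def)
qed

section \<open>The twisted product as an operation on all functions\<close>

lemma components:
  shows "components Zp G i \<phi> \<in> (\<Pi>\<^sub>E g\<in>carrier Zp. grade Zp G i g)"
    and "x \<in> carrier G \<Longrightarrow> (\<Sum>g\<in>carrier Zp. components Zp G i \<phi> g x) = \<phi> x"
  using theI'[OF ex1_components[OF cocentral_action_axioms dual_integer_mod_group_separates[OF prime_p], of \<phi>]]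
  unfolding components_def[symmetric] by auto

text \<open>Restricting the arguments first makes the product meaningful for functions that are not
  extensional, as \<open>twist_iso\<close> expects.\<close>

definition tmult :: "('g \<Rightarrow> 'k) \<Rightarrow> ('g \<Rightarrow> 'k) \<Rightarrow> 'g \<Rightarrow> 'k" where
  "tmult \<phi> \<psi> = restrict \<phi> (carrier G) \<otimes>\<^bsub>graded_twisting Zp G i \<alpha>\<^esub> restrict \<psi> (carrier G)"

lemma tmult_eq:
  assumes "x \<in> carrier G"
  shows "tmult \<phi> \<psi> x = (\<Sum>g\<in>carrier Zp. components Zp G i (restrict \<phi> (carrier G)) g x * \<psi> ((act ^^ nat g) x))"
proof -
  have "(act ^^ n) x \<in> carrier G" for n
    using G.auto_closed[OF act_auto] assms by (induction n) auto
  then show ?thesis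
    using assms inv_alpha by (simp add: tmult_def graded_twisting_def aut_action_def)
qed

lemma tmult_homogeneous:
  assumes \<phi>: "\<And>x. x \<in> carrier G \<Longrightarrow> \<phi> (x \<otimes>\<^bsub>G\<^esub> gen) = \<omega> ^ d * \<phi> x" and "d < p" and x: "x \<in> carrier G"
  shows "tmult \<phi> \<psi> x = \<phi> x * \<psi> ((act ^^ d) x)"
proof -
  have "restrict \<phi> (carrier G) \<in> grade Zp G i (int d)"
    using assms gen_closed by (intro gradeI) auto
  then have c: "components Zp G i (restrict \<phi> (carrier G)) =
      (\<lambda>h\<in>carrier Zp. if h = int d then restrict \<phi> (carrier G) else (\<lambda>x\<in>carrier G. 0))"
    using \<open>d < p\<close> by (intro components_homogeneous[OF cocentral_action_axioms prime_p]) (auto simp: carrier_Zp)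
  have "tmult \<phi> \<psi> x = (\<Sum>g\<in>carrier Zp. if g = int d then \<phi> x * \<psi> ((act ^^ d) x) else 0)"
    unfolding tmult_eq[OF x] c using x by (intro sum.cong) auto
  then show ?thesis using \<open>d < p\<close> by (simp add: carrier_Zp)
qed

text \<open>At a fixed point of \<open>act\<close> all summands carry the same factor, and the
  homogeneous components add up to \<open>\<phi>\<close> again.\<close>

lemma tmult_fixed:
  assumes x: "x \<in> carrier G" and "act x = x"
  shows "tmult \<phi> \<psi> x = \<phi> x * \<psi> x"
proof -
  have "(act ^^ n) x = x" for n using assms(2) by (induction n) auto
  then show ?thesis
    using components(2)[OF x, of "restrict \<phi> (carrier G)"] x by (simp add: tmult_eq sum_distrib_right[symmetric])
qed

text \<open>Multiplication by a function of degree 0 preserves each degree, so by uniqueness it acts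
  on the homogeneous components one by one.\<close>

lemma tmult_homog_0:
  assumes \<epsilon>: "\<And>x. x \<in> carrier G \<Longrightarrow> \<epsilon> (x \<otimes>\<^bsub>G\<^esub> gen) = \<epsilon> x" and x: "x \<in> carrier G"
  shows "tmult (\<lambda>v. \<epsilon> v * \<phi> v) \<psi> x = \<epsilon> x * tmult \<phi> \<psi> x"
proof -
  let ?c = "components Zp G i (restrict \<phi> (carrier G))"
  have "\<epsilon> (x \<otimes>\<^bsub>G\<^esub> gen [^]\<^bsub>G\<^esub> (k::nat)) = \<epsilon> x" if x: "x \<in> carrier G" for x k
    using x gen_closed by (induction k) (simp_all add: G.m_assoc[symmetric] \<epsilon>)
  then have \<epsilon>_i: "\<epsilon> (x \<otimes>\<^bsub>G\<^esub> i \<chi>) = \<epsilon> x" if "x \<in> carrier G" "\<chi> \<in> carrier (dual_group Zp)" for x \<chi>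
    using that by (elim dual_eq_chi) (simp add: i_chi)
  have i_closed: "i \<chi> \<in> carrier G" if "\<chi> \<in> carrier (dual_group Zp)" for \<chi>
    using i_in_center[OF that] by (simp add: group_center_def)
  have "components Zp G i (restrict (\<lambda>v. \<epsilon> v * \<phi> v) (carrier G)) =
      (\<lambda>g\<in>carrier Zp. \<lambda>v\<in>carrier G. \<epsilon> v * ?c g v)"
  proof (rule components_eqI[OF cocentral_action_axioms prime_p])
    show "(\<lambda>g\<in>carrier Zp. \<lambda>v\<in>carrier G. \<epsilon> v * ?c g v) \<in> (\<Pi>\<^sub>E g\<in>carrier Zp. grade Zp G i g)"
      using components(1)[of "restrict \<phi> (carrier G)"]
      by (auto simp: grade_def PiE_iff \<epsilon>_i i_closed)
    show "restrict (\<lambda>v. \<epsilon> v * \<phi> v) (carrier G) x =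
        (\<Sum>g\<in>carrier Zp. (\<lambda>g\<in>carrier Zp. \<lambda>v\<in>carrier G. \<epsilon> v * ?c g v) g x)" if "x \<in> carrier G" for x
      using that components(2)[OF that, of "restrict \<phi> (carrier G)"] by (simp add: sum_distrib_left[symmetric])
  qed
  then show ?thesis using x by (simp add: tmult_eq sum_distrib_left mult.assoc)
qed

text \<open>Reduced modulo p, \<open>l\<close> becomes a homomorphism to Z_p that kills the image of
  \<open>i\<close>; it factors through the quotient, where only the trivial homomorphism exists. The
  condition \<open>central_p\<close> is \<open>finite_cyclic_pow_prime\<close> in the
  centre.\<close>

lemma central_root_gen:
  assumes cyc: "cyclic_group (G\<lparr>carrier := group_center G\<rparr>)"
    and triv: "trivial_group (hom_group (G Mod (i ` carrier (dual_group Zp))) Zp)"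
  shows "central_root G p \<omega> gen"
proof
  fix l :: "'g \<Rightarrow> nat" and x
  assume l: "\<And>x y. x \<in> carrier G \<Longrightarrow> y \<in> carrier G \<Longrightarrow> l (x \<otimes>\<^bsub>G\<^esub> y) mod p = (l x + l y) mod p"
    and l_gen: "l gen mod p = 0" and x: "x \<in> carrier G"
  define N where "N = i ` carrier (dual_group Zp)"
  define h where "h x = int (l x mod p)" for x
  have h_hom: "h \<in> hom G Zp"
    using p_gt_1 by (auto simp: hom_def h_def carrier_Zp l zmod_int mod_add_eq)
  interpret h: group_hom G Zp h
    using h_hom by (simp add: group_hom_def group_hom_axioms_def \<Gamma>.group_axioms G.group_axioms)
  have h_gen: "h (gen [^]\<^bsub>G\<^esub> (k::nat)) = 0" for k
  proof -
    have "h gen = 0" by (simp add: h_def l_gen)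
    then show ?thesis by (simp add: h.hom_nat_pow[OF gen_closed])
  qed
  have sub: "subgroup N G"
  proof -
    interpret Z: group "G\<lparr>carrier := group_center G\<rparr>"
      by (rule G.subgroup_imp_group[OF group_center_subgroup[OF G.group_axioms]])
    interpret D: comm_group "dual_group Zp :: (int \<Rightarrow> 'k) monoid"
      by (rule comm_group_dual_group) simp
    interpret i: group_hom "dual_group Zp" "G\<lparr>carrier := group_center G\<rparr>" i
      using i_hom by unfold_locales
    have "subgroup N (G\<lparr>carrier := group_center G\<rparr>)" unfolding N_def by (rule i.img_is_subgroup)
    then show ?thesis
      using G.incl_subgroup[OF group_center_subgroup[OF G.group_axioms]] by blast
  qed
  have N_central: "x \<otimes>\<^bsub>G\<^esub> n = n \<otimes>\<^bsub>G\<^esub> x" if "x \<in> carrier G" "n \<in> N" for x n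
    using that i_in_center by (auto simp: N_def group_center_def)
  have normal: "N \<lhd> G"
    unfolding G.normal_inv_iff
  proof (intro conjI ballI sub)
    fix x n assume "x \<in> carrier G" "n \<in> N"
    then have "x \<otimes>\<^bsub>G\<^esub> n \<otimes>\<^bsub>G\<^esub> inv\<^bsub>G\<^esub> x = n"
      using subgroup.mem_carrier[OF sub] by (simp add: N_central G.m_assoc)
    then show "x \<otimes>\<^bsub>G\<^esub> n \<otimes>\<^bsub>G\<^esub> inv\<^bsub>G\<^esub> x \<in> N" using \<open>n \<in> N\<close> by simp
  qed
  have "h x = h y" if xy: "x \<in> carrier G" "y \<in> carrier G" "N #>\<^bsub>G\<^esub> x = N #>\<^bsub>G\<^esub> y" for x y
  proof -
    have "x \<in> N #>\<^bsub>G\<^esub> y" using G.rcos_self[OF xy(1) sub] xy(3) by simp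
    then obtain k :: nat where "x = gen [^]\<^bsub>G\<^esub> k \<otimes>\<^bsub>G\<^esub> y" by (auto simp: r_coset_def N_def image_i)
    then show ?thesis using xy(2) gen_closed h.hom_closed[OF xy(2)] by (simp add: h_gen carrier_Zp)
  qed
  then obtain h' where h': "h' \<in> hom (G Mod N) Zp" "\<And>x. x \<in> carrier G \<Longrightarrow> h' (N #>\<^bsub>G\<^esub> x) = h x"
    using FactGroup_universal[OF h_hom normal] by metis
  interpret Q: group "G Mod N" by (rule normal.factorgroup_is_group[OF normal])
  \<comment> \<open>Elements of \<open>hom_group\<close> are extensional, hence the
    restriction.\<close>
  have "restrict h' (carrier (G Mod N)) \<in> carrier (hom_group (G Mod N) Zp)"
    using h'(1) Q.m_closed by (auto simp: hom_group_def hom_def simp del: mult_FactGroup)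
  then have "restrict h' (carrier (G Mod N)) = \<one>\<^bsub>hom_group (G Mod N) Zp\<^esub>"
    using triv by (simp add: trivial_group_def N_def)
  moreover have Nx: "N #>\<^bsub>G\<^esub> x \<in> carrier (G Mod N)" using x by (auto simp: carrier_FactGroup)
  ultimately have "h' (N #>\<^bsub>G\<^esub> x) = 0"
    by (metis (no_types, lifting) hom_group_def monoid.simps(2) one_integer_mod_group restrict_apply')
  then have "h x = 0" using h'(2)[OF x] by simp
  then show "l x mod p = 0" by (simp add: h_def)
next
  fix c assume c: "c \<in> carrier G" "\<And>x. x \<in> carrier G \<Longrightarrow> c \<otimes>\<^bsub>G\<^esub> x = x \<otimes>\<^bsub>G\<^esub> c" "c [^]\<^bsub>G\<^esub> p = \<one>\<^bsub>G\<^esub>"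
  let ?Z = "G\<lparr>carrier := group_center G\<rparr>"
  have pow: "x [^]\<^bsub>?Z\<^esub> (k::nat) = x [^]\<^bsub>G\<^esub> k" for x k by (simp add: nat_pow_def)
  interpret Z: group ?Z by (rule G.subgroup_imp_group[OF group_center_subgroup[OF G.group_axioms]])
  have center: "c \<in> group_center G" "gen \<in> group_center G"
    using c gen_closed gen_comm by (auto simp: group_center_def)
  have "\<exists>k::nat. c = gen [^]\<^bsub>?Z\<^esub> k"
  proof (rule Z.finite_cyclic_pow_prime[OF cyc _ prime_p])
    show "finite (carrier ?Z)" using finite_G by (simp add: group_center_def)
  qed (use c(3) center gen_pow_p gen_ne_1 in \<open>auto simp: pow\<close>)
  then show "\<exists>k::nat. c = gen [^]\<^bsub>G\<^esub> k" by (simp add: pow)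
qed (use finite_G gen_closed gen_comm gen_pow_p gen_ne_1 in auto)

end

section \<open>Reduction of Hopf algebra isomorphisms to twisted products\<close>

lemma graded_twisting_simps:
  "carrier (graded_twisting \<Gamma> G i \<alpha>) = extensional (carrier G)"
  "\<phi> \<oplus>\<^bsub>graded_twisting \<Gamma> G i \<alpha>\<^esub> \<psi> = (\<lambda>x\<in>carrier G. \<phi> x + \<psi> x)"
  "\<one>\<^bsub>graded_twisting \<Gamma> G i \<alpha>\<^esub> = (\<lambda>x\<in>carrier G. 1)"
  "c \<odot>\<^bsub>graded_twisting \<Gamma> G i \<alpha>\<^esub> \<phi> = (\<lambda>x\<in>carrier G. c * \<phi> x)"
  "counit (graded_twisting \<Gamma> G i \<alpha>) \<phi> = \<phi> \<one>\<^bsub>G\<^esub>"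
  "comult (graded_twisting \<Gamma> G i \<alpha>) \<phi> = tensor_class (function_algebra G)
    (\<Sum>x\<in>carrier G. \<Sum>y\<in>carrier G.
      Poly_Mapping.single (delta_fun G x, delta_fun G y) (\<phi> (x \<otimes>\<^bsub>G\<^esub> y)))"
  "tensor_class (graded_twisting \<Gamma> G i \<alpha>) = tensor_class (function_algebra G)"
  by (simp_all add: graded_twisting_def function_hopf_def function_algebra_def module.defs hopf_algebra.defs
    tensor_class_cong)

text \<open>The value at (x, y) of the function on G x G that corresponds to a tensor, computed on a
  representative; by \<open>tensor_eval_tensor_rel\<close> it depends only on the class.\<close>

definition tensor_eval :: "'g \<Rightarrow> 'g \<Rightarrow> (('g \<Rightarrow> 'k) \<times> ('g \<Rightarrow> 'k) \<Rightarrow>\<^sub>0 'k) \<Rightarrow> 'k::field" where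
  "tensor_eval x y t = (\<Sum>q\<in>Poly_Mapping.keys t. Poly_Mapping.lookup t q * (fst q x * snd q y))"

lemma tensor_eval_superset:
  assumes "finite K" "Poly_Mapping.keys t \<subseteq> K"
  shows "tensor_eval x y t = (\<Sum>q\<in>K. Poly_Mapping.lookup t q * (fst q x * snd q y))"
  unfolding tensor_eval_def
  by (rule sum.mono_neutral_left) (use assms in \<open>auto simp: in_keys_iff\<close>)

lemma tensor_eval_add: "tensor_eval x y (s + t) = tensor_eval x y s + tensor_eval x y t"
proof -
  let ?K = "Poly_Mapping.keys s \<union> Poly_Mapping.keys t"
  have "Poly_Mapping.keys (s + t) \<subseteq> ?K" by (rule Poly_Mapping.keys_add)
  then show ?thesis
    by (subst (1 2 3) tensor_eval_superset[of ?K]) (auto simp: lookup_add distrib_right sum.distrib)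
qed

lemma tensor_eval_diff: "tensor_eval x y (s - t) = tensor_eval x y s - tensor_eval x y t"
  using tensor_eval_add[of x y "s - t" t] by simp

lemma tensor_eval_single: "tensor_eval x y (Poly_Mapping.single (u, v) c) = c * (u x * v y)"
  by (subst tensor_eval_superset[of "{(u, v)}"]) auto

lemma tensor_eval_0: "tensor_eval x y 0 = 0"
  by (simp add: tensor_eval_def)

lemma tensor_eval_sum: "tensor_eval x y (\<Sum>a\<in>S. t a) = (\<Sum>a\<in>S. tensor_eval x y (t a))"
  by (induction S rule: infinite_finite_induct) (simp_all add: tensor_eval_0 tensor_eval_add)

lemma tensor_eval_tensor_rel:
  assumes "t \<in> tensor_rel (function_algebra G)" "x \<in> carrier G" "y \<in> carrier G"
  shows "tensor_eval x y t = 0"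
  using assms(1)
  by induction (use assms(2,3) in \<open>simp_all add: tensor_eval_0 tensor_eval_add tensor_eval_diff
    tensor_eval_single function_algebra_def algebra_simps\<close>)

lemma tensor_class_eqD:
  assumes "tensor_class V s = tensor_class V t" "Poly_Mapping.keys s \<subseteq> carrier V \<times> carrier V"
  shows "s - t \<in> tensor_rel V"
proof -
  have "s \<in> tensor_class V s" using assms(2) by (simp add: tensor_class_def tensor_rel.zero)
  then have "s \<in> tensor_class V t" by (simp only: assms(1))
  then show ?thesis by (simp add: tensor_class_def)
qed

lemma keys_double_sum:
  assumes "\<And>x. x \<in> I \<Longrightarrow> e x \<in> A"
  shows "Poly_Mapping.keys (\<Sum>x\<in>I. \<Sum>y\<in>I. Poly_Mapping.single (e x, e y) (c x y)) \<subseteq> A \<times> A"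
proof -
  have add: "Poly_Mapping.keys (\<Sum>a\<in>S. t a) \<subseteq> B" if "\<And>a. a \<in> S \<Longrightarrow> Poly_Mapping.keys (t a) \<subseteq> B"
    for S :: "'x set" and t :: "'x \<Rightarrow> ('b \<times> 'b \<Rightarrow>\<^sub>0 'c)" and B
    using that
  proof (induction S rule: infinite_finite_induct)
    case (insert a S)
    then show ?case using Poly_Mapping.keys_add[of "t a" "\<Sum>a\<in>S. t a"] by auto
  qed auto
  show ?thesis by (intro add) (use assms in auto)
qed

lemma free_map_sum: "free_map f (\<Sum>a\<in>S. t a) = (\<Sum>a\<in>S. free_map f (t a))"
  by (induction S rule: infinite_finite_induct) (simp_all add: free_map_add, simp_all add: free_map_def)

lemma tensor_map_comult:
  fixes G :: "('g, 'm) monoid_scheme" and f :: "('g \<Rightarrow> 'k::field) \<Rightarrow> 'g \<Rightarrow> 'k"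
  assumes "f \<in> extensional (carrier G) \<rightarrow> extensional (carrier G)"
    and "\<And>\<phi> \<psi>. \<phi> \<in> extensional (carrier G) \<Longrightarrow> \<psi> \<in> extensional (carrier G) \<Longrightarrow>
      f (\<lambda>x\<in>carrier G. \<phi> x + \<psi> x) = (\<lambda>x\<in>carrier G. f \<phi> x + f \<psi> x)"
    and "\<And>c \<phi>. \<phi> \<in> extensional (carrier G) \<Longrightarrow>
      f (\<lambda>x\<in>carrier G. c * \<phi> x) = (\<lambda>x\<in>carrier G. c * f \<phi> x)"
  shows "tensor_map (graded_twisting \<Gamma> G j \<beta>) f (comult (graded_twisting \<Gamma> G i \<alpha>) \<phi>) =
    tensor_class (function_algebra G) (\<Sum>x\<in>carrier G. \<Sum>y\<in>carrier G.
      Poly_Mapping.single (f (delta_fun G x), f (delta_fun G y)) (\<phi> (x \<otimes>\<^bsub>G\<^esub> y)))"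
proof -
  let ?t = "\<Sum>x\<in>carrier G. \<Sum>y\<in>carrier G.
      Poly_Mapping.single (delta_fun G x, delta_fun G y) (\<phi> (x \<otimes>\<^bsub>G\<^esub> y))"
  have "delta_fun G x \<in> carrier (graded_twisting \<Gamma> G i \<alpha>)" for x
    by (simp add: graded_twisting_simps delta_fun_def)
  then have "Poly_Mapping.keys ?t \<subseteq> carrier (graded_twisting \<Gamma> G i \<alpha>) \<times> carrier (graded_twisting \<Gamma> G i \<alpha>)"
    by (intro keys_double_sum)
  then have "tensor_map (graded_twisting \<Gamma> G j \<beta>) f (tensor_class (graded_twisting \<Gamma> G i \<alpha>) ?t) =
      tensor_class (graded_twisting \<Gamma> G j \<beta>) (free_map f ?t)"
    using assms by (intro tensor_map_class) (simp_all add: graded_twisting_simps)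
  then show ?thesis by (simp add: graded_twisting_simps free_map_sum free_map_single)
qed

text \<open>Evaluation at (x, y) turns an equality of tensors into one of scalars; on the side of
  \<open>\<psi>\<close> the delta functions leave a single term.\<close>

lemma comult_preserved_coefficients:
  fixes G :: "('g, 'm) monoid_scheme" and f :: "('g \<Rightarrow> 'k::field) \<Rightarrow> 'g \<Rightarrow> 'k"
  assumes fin: "finite (carrier G)"
    and f: "f \<in> extensional (carrier G) \<rightarrow> extensional (carrier G)"
    and eq: "tensor_class (function_algebra G) (\<Sum>x\<in>carrier G. \<Sum>y\<in>carrier G.
        Poly_Mapping.single (delta_fun G x, delta_fun G y) (\<psi> (x \<otimes>\<^bsub>G\<^esub> y))) =
      tensor_class (function_algebra G) (\<Sum>x\<in>carrier G. \<Sum>y\<in>carrier G.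
        Poly_Mapping.single (f (delta_fun G x), f (delta_fun G y)) (\<phi> (x \<otimes>\<^bsub>G\<^esub> y)))"
    and xy: "x \<in> carrier G" "y \<in> carrier G"
  shows "\<psi> (x \<otimes>\<^bsub>G\<^esub> y) = (\<Sum>u\<in>carrier G. \<Sum>v\<in>carrier G.
      \<phi> (u \<otimes>\<^bsub>G\<^esub> v) * (f (delta_fun G u) x * f (delta_fun G v) y))"
proof -
  let ?s = "\<Sum>x\<in>carrier G. \<Sum>y\<in>carrier G.
        Poly_Mapping.single (delta_fun G x :: 'g \<Rightarrow> 'k, delta_fun G y :: 'g \<Rightarrow> 'k) (\<psi> (x \<otimes>\<^bsub>G\<^esub> y))"
  let ?t = "\<Sum>x\<in>carrier G. \<Sum>y\<in>carrier G.
        Poly_Mapping.single (f (delta_fun G x), f (delta_fun G y)) (\<phi> (x \<otimes>\<^bsub>G\<^esub> y))"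
  have "Poly_Mapping.keys ?s \<subseteq> carrier (function_algebra G) \<times> carrier (function_algebra G)"
    by (intro keys_double_sum) (simp add: function_algebra_def delta_fun_def)
  then have "tensor_eval x y (?s - ?t) = 0"
    by (intro tensor_eval_tensor_rel[OF _ xy] tensor_class_eqD[OF eq])
  then have "tensor_eval x y ?s = tensor_eval x y ?t" by (simp add: tensor_eval_diff)
  moreover have "tensor_eval x y ?s = \<psi> (x \<otimes>\<^bsub>G\<^esub> y)"
  proof -
    have "tensor_eval x y ?s = (\<Sum>u\<in>carrier G. \<Sum>v\<in>carrier G.
        if v = y then if u = x then \<psi> (u \<otimes>\<^bsub>G\<^esub> v) else 0 else 0)"
      unfolding tensor_eval_sum tensor_eval_single using xy by (intro sum.cong) (auto simp: delta_fun_def)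
    then show ?thesis using fin xy by simp
  qed
  ultimately show ?thesis by (simp add: tensor_eval_sum tensor_eval_single)
qed

section \<open>From a Hopf isomorphism to an equivalence of actions\<close>

lemma cocentral_equiv_if_hopf_isomorphic:
  fixes G :: "('g, 'm) monoid_scheme"
    and p :: nat
    and i j :: "(int \<Rightarrow> 'k::{alg_closed_field, field_char_0}) \<Rightarrow> 'g"
    and \<alpha> \<beta> :: "int \<Rightarrow> 'g \<Rightarrow> 'g"
  assumes A: "zp_action p \<omega> G i \<alpha>" and B: "zp_action p \<omega> G j \<beta>"
    and cyc: "cyclic_group (G\<lparr>carrier := group_center G\<rparr>)"
    and triv: "trivial_group (hom_group (G Mod (i ` carrier (dual_group (integer_mod_group p))))
      (integer_mod_group p))"
    and iso: "f \<in> hopf_iso (graded_twisting (integer_mod_group p) G i \<alpha>)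
      (graded_twisting (integer_mod_group p) G j \<beta>)"
  shows "cocentral_equiv (integer_mod_group p) G i \<alpha> j \<beta>"
proof -
  let ?Z = "integer_mod_group p"
  let ?A = "graded_twisting ?Z G i \<alpha>" and ?B = "graded_twisting ?Z G j \<beta>"
  let ?E = "extensional (carrier G) :: ('g \<Rightarrow> 'k) set"
  interpret A: zp_action p \<omega> G i \<alpha> by (fact A)
  interpret B: zp_action p \<omega> G j \<beta> by (fact B)
  interpret C: central_root G p \<omega> A.gen by (rule A.central_root_gen[OF cyc triv])
  have f_in: "f \<phi> \<in> ?E" if "\<phi> \<in> ?E" for \<phi>
    using iso that by (auto simp: hopf_iso_def ring_hom_def graded_twisting_simps)
  have f_mult: "f (\<phi> \<otimes>\<^bsub>?A\<^esub> \<psi>) = f \<phi> \<otimes>\<^bsub>?B\<^esub> f \<psi>" if "\<phi> \<in> ?E" "\<psi> \<in> ?E" for \<phi> \<psi>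
    using iso that by (simp add: hopf_iso_def ring_hom_def graded_twisting_simps)
  have f_add: "f (\<lambda>x\<in>carrier G. \<phi> x + \<psi> x) = (\<lambda>x\<in>carrier G. f \<phi> x + f \<psi> x)"
    if "\<phi> \<in> ?E" "\<psi> \<in> ?E" for \<phi> \<psi>
    using iso that by (simp add: hopf_iso_def ring_hom_def graded_twisting_simps)
  have f_one: "f (\<lambda>x\<in>carrier G. 1) = (\<lambda>x\<in>carrier G. 1)"
    using iso by (simp add: hopf_iso_def ring_hom_def graded_twisting_simps)
  have f_smult: "f (\<lambda>x\<in>carrier G. c * \<phi> x) = (\<lambda>x\<in>carrier G. c * f \<phi> x)" if "\<phi> \<in> ?E" for c \<phi>
    using iso that by (simp add: hopf_iso_def graded_twisting_simps)
  have f_bij: "bij_betw f ?E ?E" using iso by (simp add: hopf_iso_def graded_twisting_simps)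
  have f_counit: "f \<phi> \<one>\<^bsub>G\<^esub> = \<phi> \<one>\<^bsub>G\<^esub>" if "\<phi> \<in> ?E" for \<phi>
    using iso that by (simp add: hopf_iso_def graded_twisting_simps)
  have f_comult: "comult ?B (f \<phi>) = tensor_map ?B f (comult ?A \<phi>)" if "\<phi> \<in> ?E" for \<phi>
    using iso that by (simp add: hopf_iso_def graded_twisting_simps(1))
  define F where "F \<phi> = f (restrict \<phi> (carrier G))" for \<phi>
  have F_point: "F (C.point u) = f (delta_fun G u)" for u
    by (simp add: F_def C.point_def delta_fun_def restrict_def)
  have w_range: "range (\<lambda>k::nat. A.gen [^]\<^bsub>G\<^esub> k) = range (\<lambda>k::nat. B.gen [^]\<^bsub>G\<^esub> k)"
    using cocentral_images_eq[OF A.cocentral_action_axioms B.cocentral_action_axioms cyc]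
    by (simp only: A.image_i B.image_i)
  have "A.gen = A.gen [^]\<^bsub>G\<^esub> (1::nat)" "B.gen = B.gen [^]\<^bsub>G\<^esub> (1::nat)"
    using A.gen_closed B.gen_closed by simp_all
  then have gens: "\<exists>q::nat. A.gen = B.gen [^]\<^bsub>G\<^esub> q" "\<exists>q::nat. B.gen = A.gen [^]\<^bsub>G\<^esub> q"
    using w_range by blast+
  interpret T: twist_iso G p \<omega> A.gen B.gen A.act B.act A.tmult B.tmult F
  proof
    show "F \<phi> x = F \<psi> x" if "\<And>v. v \<in> carrier G \<Longrightarrow> \<phi> v = \<psi> v" "x \<in> carrier G" for \<phi> \<psi> x
    proof -
      have "restrict \<phi> (carrier G) = restrict \<psi> (carrier G)" using that(1) by (intro restrict_ext)
      then show ?thesis by (simp add: F_def)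
    qed
    show "F (\<lambda>v. \<phi> v + \<psi> v) x = F \<phi> x + F \<psi> x" if "x \<in> carrier G" for \<phi> \<psi> x
      using f_add[of "restrict \<phi> (carrier G)" "restrict \<psi> (carrier G)"] that
      by (simp add: F_def cong: restrict_cong)
    show "F (\<lambda>v. c * \<phi> v) x = c * F \<phi> x" if "x \<in> carrier G" for c \<phi> x
      using f_smult[of "restrict \<phi> (carrier G)" c] that by (simp add: F_def cong: restrict_cong)
    show "\<phi> x = \<psi> x" if "\<And>v. v \<in> carrier G \<Longrightarrow> F \<phi> v = F \<psi> v" "x \<in> carrier G" for \<phi> \<psi> x
    proof -
      have "f (restrict \<phi> (carrier G)) = f (restrict \<psi> (carrier G))"
        using that(1) f_in by (intro extensionalityI[of _ "carrier G"]) (auto simp: F_def)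
      then have "restrict \<phi> (carrier G) = restrict \<psi> (carrier G)"
        using f_bij by (auto simp: bij_betw_def dest: inj_onD)
      then show ?thesis using that(2) by (metis restrict_apply')
    qed
    show "\<exists>\<phi>. \<forall>x\<in>carrier G. F \<phi> x = \<psi> x" for \<psi>
    proof -
      have "restrict \<psi> (carrier G) \<in> f ` ?E" using f_bij by (simp add: bij_betw_def)
      then obtain \<phi> where \<phi>: "\<phi> \<in> ?E" "restrict \<psi> (carrier G) = f \<phi>" by blast
      then have "F \<phi> = restrict \<psi> (carrier G)" by (simp add: F_def extensional_restrict)
      then show ?thesis by (intro exI[of _ \<phi>]) simp
    qed
    show "F \<phi> (x \<otimes>\<^bsub>G\<^esub> y) = (\<Sum>u\<in>carrier G. \<Sum>v\<in>carrier G.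
        \<phi> (u \<otimes>\<^bsub>G\<^esub> v) * F (C.point u) x * F (C.point v) y)"
      if "x \<in> carrier G" "y \<in> carrier G" for \<phi> x y
    proof -
      have eq: "comult ?B (f (restrict \<phi> (carrier G))) = tensor_map ?B f (comult ?A (restrict \<phi> (carrier G)))"
        by (rule f_comult) simp
      have "F \<phi> (x \<otimes>\<^bsub>G\<^esub> y) = (\<Sum>u\<in>carrier G. \<Sum>v\<in>carrier G. restrict \<phi> (carrier G) (u \<otimes>\<^bsub>G\<^esub> v) *
          (f (delta_fun G u) x * f (delta_fun G v) y))"
        unfolding F_def
      proof (rule comult_preserved_coefficients[OF C.finite_G _ _ that])
        show "f \<in> ?E \<rightarrow> ?E" using f_in by blast
        show "tensor_class (function_algebra G) (\<Sum>x\<in>carrier G. \<Sum>y\<in>carrier G.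
            Poly_Mapping.single (delta_fun G x, delta_fun G y) (f (restrict \<phi> (carrier G)) (x \<otimes>\<^bsub>G\<^esub> y))) =
          tensor_class (function_algebra G) (\<Sum>x\<in>carrier G. \<Sum>y\<in>carrier G.
            Poly_Mapping.single (f (delta_fun G x), f (delta_fun G y)) (restrict \<phi> (carrier G) (x \<otimes>\<^bsub>G\<^esub> y)))"
          using eq tensor_map_comult[of f G ?Z j \<beta> i \<alpha>] f_in f_add f_smult
          by (simp only: graded_twisting_simps(6)) blast
      qed
      then show ?thesis by (simp add: F_point mult.assoc cong: sum.cong)
    qed
    show "F \<phi> \<one>\<^bsub>G\<^esub> = \<phi> \<one>\<^bsub>G\<^esub>" for \<phi>
      by (simp add: F_def f_counit)
    show "F (\<lambda>v. 1) x = 1" if "x \<in> carrier G" for x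
      using that by (simp add: F_def f_one)
    show "F (A.tmult \<phi> \<psi>) x = B.tmult (F \<phi>) (F \<psi>) x" if "x \<in> carrier G" for \<phi> \<psi> x
    proof -
      have "A.tmult \<phi> \<psi> \<in> ?E" by (simp add: A.tmult_def graded_twisting_def)
      then show ?thesis
        by (simp add: F_def A.tmult_def B.tmult_def f_mult extensional_restrict f_in)
    qed
    show "A.tmult \<phi> \<psi> x = \<phi> x * \<psi> ((A.act ^^ d) x)"
      if "\<phi> \<in> C.homog A.gen d" "d < p" "x \<in> carrier G" for \<phi> d x \<psi>
      using that by (intro A.tmult_homogeneous) (simp_all add: C.homog_def)
    show "B.tmult \<phi> \<psi> x = \<phi> x * \<psi> ((B.act ^^ d) x)"
      if "\<phi> \<in> C.homog B.gen d" "d < p" "x \<in> carrier G" for \<phi> d x \<psi>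
      using that by (intro B.tmult_homogeneous) (simp_all add: C.homog_def)
    show "A.tmult (\<lambda>v. \<epsilon> v * \<phi> v) \<psi> x = \<epsilon> x * A.tmult \<phi> \<psi> x"
      if "\<epsilon> \<in> C.homog A.gen 0" "x \<in> carrier G" for \<epsilon> \<phi> \<psi> x
      using that by (intro A.tmult_homog_0) (simp_all add: C.homog_def)
  qed (use B.gen_closed B.gen_comm B.gen_pow_p gens A.act_gen B.act_gen A.tmult_fixed B.tmult_fixed
      A.G.auto_closed[OF A.act_auto] A.G.auto_closed[OF B.act_auto]
      A.G.auto_hom_mult[OF A.act_auto] A.G.auto_hom_mult[OF B.act_auto] in auto)
  obtain s h where s: "0 < s" "s < p" and h_closed: "\<forall>x\<in>carrier G. h x \<in> carrier G"
    and h_mult: "\<forall>x\<in>carrier G. \<forall>y\<in>carrier G. h (x \<otimes>\<^bsub>G\<^esub> y) = h x \<otimes>\<^bsub>G\<^esub> h y"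
    and h_inj: "inj_on h (carrier G)" and h_gen: "h B.gen = A.gen [^]\<^bsub>G\<^esub> s"
    and h_act: "\<forall>x\<in>carrier G. A.act (h x) = h ((B.act ^^ s) x)"
    using T.automorphism_exists by auto
  define g where "g = restrict h (carrier G)"
  have "h ` carrier G = carrier G"
    using h_closed h_inj C.finite_G by (intro endo_inj_surj) auto
  then have g: "g \<in> auto G"
    using h_closed h_mult h_inj by (auto simp: g_def auto_def hom_def Bij_def bij_betw_def inj_on_def)
  \<comment> \<open>Multiplication by the exponent s with \<open>h B.gen = A.gen [^] s\<close>; it
    is bijective because s is prime to p.\<close>
  define u where "u = (\<lambda>x\<in>carrier ?Z. int s * x mod int p)"
  have "\<not> p dvd s" using s by (meson nat_dvd_not_less)
  then have "coprime (int s) (int p)"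
    using A.prime_p by (metis coprime_commute coprime_int_iff prime_imp_coprime)
  have u_inj: "inj_on u (carrier ?Z)"
  proof (intro inj_onI)
    fix x y assume xy: "x \<in> carrier ?Z" "y \<in> carrier ?Z" "u x = u y"
    then have "int p dvd int s * (x - y)"
      by (simp add: u_def mod_eq_dvd_iff right_diff_distrib)
    then have "int p dvd x - y"
      using \<open>coprime (int s) (int p)\<close> by (simp add: coprime_dvd_mult_right_iff coprime_commute)
    then have "x mod int p = y mod int p" by (simp add: mod_eq_dvd_iff)
    then show "x = y" using xy by (simp add: A.carrier_Zp)
  qed
  have u_closed: "u ` carrier ?Z \<subseteq> carrier ?Z" using A.p_gt_1 by (auto simp: u_def A.carrier_Zp)
  have "u ` carrier ?Z = carrier ?Z"
    using u_closed u_inj A.finite_\<Gamma> by (intro endo_inj_surj)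
  then have u: "u \<in> auto ?Z"
    using u_inj u_closed A.p_gt_1
    by (auto simp: auto_def hom_def Bij_def bij_betw_def u_def A.carrier_Zp mod_simps distrib_left)
  have g_gen_pow: "g (B.gen [^]\<^bsub>G\<^esub> (k::nat)) = A.gen [^]\<^bsub>G\<^esub> (k * s)" for k
  proof (induction k)
    case 0
    have "g \<one>\<^bsub>G\<^esub> \<otimes>\<^bsub>G\<^esub> g \<one>\<^bsub>G\<^esub> = g \<one>\<^bsub>G\<^esub>" using A.G.auto_hom_mult[OF g, of "\<one>\<^bsub>G\<^esub>" "\<one>\<^bsub>G\<^esub>"] by simp
    then show ?case using A.G.auto_closed[OF g, of "\<one>\<^bsub>G\<^esub>"] by simp
  next
    case (Suc k)
    have "g B.gen = A.gen [^]\<^bsub>G\<^esub> s" using h_gen B.gen_closed by (simp add: g_def)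
    then show ?case
      using Suc B.gen_closed A.gen_closed by (simp add: A.G.auto_hom_mult[OF g] A.G.nat_pow_mult add.commute)
  qed
  have "i (compose (carrier ?Z) \<chi> u) = g (j \<chi>)" if \<chi>: "\<chi> \<in> carrier (dual_group ?Z)" for \<chi>
  proof -
    obtain k where k: "\<chi> = B.chi k" by (rule B.dual_eq_chi[OF \<chi>])
    \<comment> \<open>Composition with \<open>u\<close> multiplies the exponent of the character by
      s, just as \<open>g\<close> does on powers of \<open>B.gen\<close>.\<close>
    have "compose (carrier ?Z) \<chi> u = A.chi (k * s)"
    proof (rule extensionalityI[of _ "carrier ?Z"])
      fix x assume x: "x \<in> carrier ?Z"
      then have "compose (carrier ?Z) \<chi> u x = \<omega> ^ (k * nat (int s * x mod int p))"
        using u_closed by (simp add: compose_eq k B.chi_def) (auto simp: u_def)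
      also have "\<dots> = \<omega> ^ (k * nat (int s * x))"
        using x by (intro A.omega_pow_nat_mod) (simp add: A.carrier_Zp)
      also have "\<dots> = A.chi (k * s) x" using x by (simp add: A.chi_def nat_mult_distrib mult.assoc)
      finally show "compose (carrier ?Z) \<chi> u x = A.chi (k * s) x" .
    qed (auto simp: A.chi_def)
    then show ?thesis using k by (simp add: A.i_chi B.i_chi g_gen_pow)
  qed
  moreover have "inv\<^bsub>AutoGroup G\<^esub> g \<otimes>\<^bsub>AutoGroup G\<^esub> \<alpha> x \<otimes>\<^bsub>AutoGroup G\<^esub> g = \<beta> (u x)"
    if x: "x \<in> carrier ?Z" for x
  proof -
    interpret Au: group "AutoGroup G" by (rule A.G.AutoGroup)
    have car: "carrier (AutoGroup G) = auto G" by (simp add: AutoGroup_def)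
    have \<alpha>1: "\<alpha> 1 \<in> carrier (AutoGroup G)" and \<beta>1: "\<beta> 1 \<in> carrier (AutoGroup G)"
      using A.alpha_auto[OF A.one_in_Zp] B.alpha_auto[OF A.one_in_Zp] by (simp_all add: car)
    have g': "g \<in> carrier (AutoGroup G)" using g by (simp add: car)
    let ?b = "\<beta> 1 [^]\<^bsub>AutoGroup G\<^esub> s"
    have b: "?b \<in> carrier (AutoGroup G)" using \<beta>1 by simp
    have act: "A.act \<in> carrier (AutoGroup G)" "B.act [^]\<^bsub>AutoGroup G\<^esub> s \<in> carrier (AutoGroup G)"
      using A.act_auto B.act_auto Au.nat_pow_closed by (simp_all add: car)
    \<comment> \<open>Both \<open>act\<close> automorphisms are inverses, so solving this relation
      gives \<open>\<alpha> 1\<close> followed through \<open>g\<close> as \<open>g\<close> times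
      the s-th power of \<open>\<beta> 1\<close>. Taking powers then covers all of Z_p.\<close>
    have "A.act \<otimes>\<^bsub>AutoGroup G\<^esub> g = g \<otimes>\<^bsub>AutoGroup G\<^esub> (B.act [^]\<^bsub>AutoGroup G\<^esub> s)"
    proof (rule A.G.auto_eqI)
      fix v assume v: "v \<in> carrier G"
      have "(B.act ^^ n) v \<in> carrier G" for n
        using A.G.auto_closed[OF B.act_auto] v by (induction n) auto
      then show "(A.act \<otimes>\<^bsub>AutoGroup G\<^esub> g) v = (g \<otimes>\<^bsub>AutoGroup G\<^esub> (B.act [^]\<^bsub>AutoGroup G\<^esub> s)) v"
        using v h_act act g g' unfolding car
        by (simp add: A.G.auto_mult_apply A.G.auto_pow_apply[OF B.act_auto] g_def)
    qed (use act g' Au.m_closed car in auto)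
    also have "B.act [^]\<^bsub>AutoGroup G\<^esub> s = inv\<^bsub>AutoGroup G\<^esub> ?b"
      using \<beta>1 by (simp add: B.act_def Au.nat_pow_inv)
    finally have "inv\<^bsub>AutoGroup G\<^esub> \<alpha> 1 \<otimes>\<^bsub>AutoGroup G\<^esub> g = g \<otimes>\<^bsub>AutoGroup G\<^esub> inv\<^bsub>AutoGroup G\<^esub> ?b"
      by (simp add: A.act_def)
    then have "g = \<alpha> 1 \<otimes>\<^bsub>AutoGroup G\<^esub> (g \<otimes>\<^bsub>AutoGroup G\<^esub> inv\<^bsub>AutoGroup G\<^esub> ?b)"
      using \<alpha>1 g' b by (simp add: Au.inv_solve_left')
    then have "g = \<alpha> 1 \<otimes>\<^bsub>AutoGroup G\<^esub> g \<otimes>\<^bsub>AutoGroup G\<^esub> inv\<^bsub>AutoGroup G\<^esub> ?b"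
      using \<alpha>1 g' b by (simp add: Au.m_assoc)
    then have step: "g \<otimes>\<^bsub>AutoGroup G\<^esub> ?b = \<alpha> 1 \<otimes>\<^bsub>AutoGroup G\<^esub> g"
      using \<alpha>1 g' b by (metis Au.inv_solve_right Au.m_closed)
    have comm: "\<alpha> 1 [^]\<^bsub>AutoGroup G\<^esub> n \<otimes>\<^bsub>AutoGroup G\<^esub> g = g \<otimes>\<^bsub>AutoGroup G\<^esub> ?b [^]\<^bsub>AutoGroup G\<^esub> n" for n :: nat
    proof (induction n)
      case (Suc n)
      have "\<alpha> 1 [^]\<^bsub>AutoGroup G\<^esub> Suc n \<otimes>\<^bsub>AutoGroup G\<^esub> g =
          \<alpha> 1 [^]\<^bsub>AutoGroup G\<^esub> n \<otimes>\<^bsub>AutoGroup G\<^esub> (g \<otimes>\<^bsub>AutoGroup G\<^esub> ?b)"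
        using \<alpha>1 g' by (simp add: step Au.m_assoc)
      also have "\<dots> = \<alpha> 1 [^]\<^bsub>AutoGroup G\<^esub> n \<otimes>\<^bsub>AutoGroup G\<^esub> g \<otimes>\<^bsub>AutoGroup G\<^esub> ?b"
        using \<alpha>1 g' b by (simp add: Au.m_assoc)
      also have "\<dots> = g \<otimes>\<^bsub>AutoGroup G\<^esub> ?b [^]\<^bsub>AutoGroup G\<^esub> Suc n"
        using g' b by (simp only: Suc Au.nat_pow_Suc) (simp add: Au.m_assoc)
      finally show ?case .
    qed (use g' in simp)
    have \<alpha>x: "\<alpha> x = \<alpha> 1 [^]\<^bsub>AutoGroup G\<^esub> nat x"
      using A.alpha_pow[of "nat x"] x by (simp add: A.carrier_Zp)
    have "u x = int (s * nat x) mod int p" using x by (simp add: u_def A.carrier_Zp)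
    then have \<beta>x: "\<beta> (u x) = ?b [^]\<^bsub>AutoGroup G\<^esub> nat x"
      using B.alpha_pow[of "s * nat x"] \<beta>1 by (simp add: Au.nat_pow_pow)
    have "inv\<^bsub>AutoGroup G\<^esub> g \<otimes>\<^bsub>AutoGroup G\<^esub> \<alpha> x \<otimes>\<^bsub>AutoGroup G\<^esub> g =
        inv\<^bsub>AutoGroup G\<^esub> g \<otimes>\<^bsub>AutoGroup G\<^esub> (g \<otimes>\<^bsub>AutoGroup G\<^esub> ?b [^]\<^bsub>AutoGroup G\<^esub> nat x)"
      using \<alpha>1 g' by (simp add: \<alpha>x Au.m_assoc comm)
    then show ?thesis using g' b by (simp add: \<beta>x Au.m_assoc[symmetric])
  qed
  ultimately show ?thesis unfolding cocentral_equiv_def using u g by blast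
qed

section \<open>Equivalent actions give isomorphic twistings\<close>

text \<open>Pullback along f is the isomorphism: the condition on characters carries degree g to
  degree u g, and the condition on automorphisms matches the twist by \<open>\<alpha> g\<close> with
  that by \<open>\<beta> (u g)\<close>.\<close>

lemma hopf_isomorphic_if_cocentral_equiv:
  fixes G :: "('g, 'm) monoid_scheme"
    and p :: nat
    and i j :: "(int \<Rightarrow> 'k::{alg_closed_field, field_char_0}) \<Rightarrow> 'g"
    and \<alpha> \<beta> :: "int \<Rightarrow> 'g \<Rightarrow> 'g"
  assumes A: "cocentral_action (integer_mod_group p) G i \<alpha>"
    and B: "cocentral_action (integer_mod_group p) G j \<beta>"
    and p: "Factorial_Ring.prime p"
    and equiv: "cocentral_equiv (integer_mod_group p) G i \<alpha> j \<beta>"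
  shows "hopf_isomorphic (graded_twisting (integer_mod_group p) G i \<alpha>)
    (graded_twisting (integer_mod_group p) G j \<beta>)"
proof -
  let ?Z = "integer_mod_group p"
  let ?A = "graded_twisting ?Z G i \<alpha>" and ?B = "graded_twisting ?Z G j \<beta>"
  let ?E = "extensional (carrier G) :: ('g \<Rightarrow> 'k) set"
  interpret A: cocentral_action ?Z G i \<alpha> by (fact A)
  interpret B: cocentral_action ?Z G j \<beta> by (fact B)
  interpret Au: group "AutoGroup G" by (rule A.G.AutoGroup)
  have car: "carrier (AutoGroup G) = auto G" by (simp add: AutoGroup_def)
  obtain u f where u: "u \<in> auto ?Z" and f: "f \<in> auto G"
    and f_j: "\<And>\<chi>. \<chi> \<in> carrier (dual_group ?Z) \<Longrightarrow> i (compose (carrier ?Z) \<chi> u) = f (j \<chi>)"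
    and f_\<alpha>: "\<And>g. g \<in> carrier ?Z \<Longrightarrow>
      inv\<^bsub>AutoGroup G\<^esub> f \<otimes>\<^bsub>AutoGroup G\<^esub> \<alpha> g \<otimes>\<^bsub>AutoGroup G\<^esub> f = \<beta> (u g)"
    using equiv unfolding cocentral_equiv_def by blast
  have u_bij: "bij_betw u (carrier ?Z) (carrier ?Z)" using u by (simp add: auto_def Bij_def)
  have u_closed: "u g \<in> carrier ?Z" if "g \<in> carrier ?Z" for g
    using u_bij that by (auto simp: bij_betw_def)
  have u_inv: "u (inv\<^bsub>?Z\<^esub> g) = inv\<^bsub>?Z\<^esub> (u g)" if "g \<in> carrier ?Z" for g
  proof -
    interpret u: group_hom ?Z ?Z u
      using u by (simp add: group_hom_def group_hom_axioms_def auto_def)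
    show ?thesis by (rule u.hom_inv[OF that])
  qed
  have f_bij: "bij_betw f (carrier G) (carrier G)" using f by (simp add: auto_def Bij_def)
  have f_closed [simp]: "f x \<in> carrier G" if "x \<in> carrier G" for x using A.G.auto_closed[OF f that] .
  have f_mult: "f (x \<otimes>\<^bsub>G\<^esub> y) = f x \<otimes>\<^bsub>G\<^esub> f y" if "x \<in> carrier G" "y \<in> carrier G" for x y
    using A.G.auto_hom_mult[OF f that] .
  interpret f: group_hom G G f
    using f by (simp add: group_hom_def group_hom_axioms_def auto_def A.G.group_axioms)
  have \<alpha>_auto: "\<alpha> g \<in> auto G" and \<beta>_auto: "\<beta> g \<in> auto G" if "g \<in> carrier ?Z" for g
    using A.\<alpha>_hom B.\<alpha>_hom that by (auto simp: hom_def car)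
  have inv_closed: "(inv\<^bsub>AutoGroup G\<^esub> a) x \<in> carrier G" if "a \<in> auto G" "x \<in> carrier G" for a x
    using A.G.auto_closed[OF A.G.auto_inv(1)[OF that(1)] that(2)] .
  have f_inv: "f ((inv\<^bsub>AutoGroup G\<^esub> (\<beta> (u g))) x) = (inv\<^bsub>AutoGroup G\<^esub> (\<alpha> g)) (f x)"
    if g: "g \<in> carrier ?Z" and x: "x \<in> carrier G" for g x
  proof -
    have in_Aut: "f \<in> carrier (AutoGroup G)" "\<alpha> g \<in> carrier (AutoGroup G)"
      using f \<alpha>_auto[OF g] by (simp_all add: car)
    have "f \<otimes>\<^bsub>AutoGroup G\<^esub> inv\<^bsub>AutoGroup G\<^esub> (\<beta> (u g)) = inv\<^bsub>AutoGroup G\<^esub> (\<alpha> g) \<otimes>\<^bsub>AutoGroup G\<^esub> f"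
      using in_Aut by (simp add: f_\<alpha>[OF g, symmetric] Au.inv_mult_group Au.m_assoc[symmetric])
    then show ?thesis
      using A.G.auto_mult_apply[OF f A.G.auto_inv(1)[OF \<beta>_auto[OF u_closed[OF g]]] x]
        A.G.auto_mult_apply[OF A.G.auto_inv(1)[OF \<alpha>_auto[OF g]] f x] by simp
  qed
  define \<Phi> :: "('g \<Rightarrow> 'k) \<Rightarrow> 'g \<Rightarrow> 'k" where "\<Phi> \<phi> = (\<lambda>x\<in>carrier G. \<phi> (f x))" for \<phi>
  have \<Phi>_E: "\<Phi> \<phi> \<in> ?E" for \<phi> by (simp add: \<Phi>_def)
  have \<Phi>_grade: "\<Phi> \<phi> \<in> grade ?Z G j (u g)" if \<phi>: "\<phi> \<in> grade ?Z G i g" and g: "g \<in> carrier ?Z" for \<phi> g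
    unfolding grade_def
  proof (intro CollectI conjI ballI \<Phi>_E)
    fix x and \<chi> :: "int \<Rightarrow> 'k" assume x: "x \<in> carrier G" and \<chi>: "\<chi> \<in> carrier (dual_group ?Z)"
    have j\<chi>: "j \<chi> \<in> carrier G" using B.i_hom \<chi> by (auto simp: hom_def group_center_def)
    have "compose (carrier ?Z) \<chi> u \<in> carrier (dual_group ?Z)"
      using u \<chi> u_closed A.\<Gamma>.m_closed
      by (simp add: dual_group_def hom_group_def auto_def hom_def Pi_iff compose_eq del: mult_integer_mod_group)
    then have "\<phi> (f x \<otimes>\<^bsub>G\<^esub> i (compose (carrier ?Z) \<chi> u)) = compose (carrier ?Z) \<chi> u g * \<phi> (f x)"
      using \<phi> x by (simp add: grade_def)
    then show "\<Phi> \<phi> (x \<otimes>\<^bsub>G\<^esub> j \<chi>) = \<chi> (u g) * \<Phi> \<phi> x"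
      using x g j\<chi> by (simp add: \<Phi>_def f_mult f_j[OF \<chi>] compose_eq)
  qed
  have comp: "components ?Z G i \<phi> \<in> (\<Pi>\<^sub>E g\<in>carrier ?Z. grade ?Z G i g)"
    "\<And>x. x \<in> carrier G \<Longrightarrow> \<phi> x = (\<Sum>g\<in>carrier ?Z. components ?Z G i \<phi> g x)" for \<phi>
    using theI'[OF ex1_components[OF A dual_integer_mod_group_separates[OF p], of \<phi>]]
    unfolding components_def[symmetric] by auto
  have \<Phi>_comp: "components ?Z G j (\<Phi> \<phi>) (u g) = \<Phi> (components ?Z G i \<phi> g)"
    if g: "g \<in> carrier ?Z" for \<phi> g
  proof -
    let ?v = "inv_into (carrier ?Z) u"
    have v: "?v h \<in> carrier ?Z" "u (?v h) = h" if "h \<in> carrier ?Z" for h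
      using u_bij that by (auto simp: bij_betw_def inv_into_into f_inv_into_f)
    \<comment> \<open>The pullbacks of the components, relabelled by \<open>u\<close>, form a
      homogeneous decomposition, which is unique.\<close>
    have "components ?Z G j (\<Phi> \<phi>) = (\<lambda>h\<in>carrier ?Z. \<Phi> (components ?Z G i \<phi> (?v h)))"
    proof (rule components_eqI[OF B p])
      show "(\<lambda>h\<in>carrier ?Z. \<Phi> (components ?Z G i \<phi> (?v h))) \<in> (\<Pi>\<^sub>E g\<in>carrier ?Z. grade ?Z G j g)"
        using \<Phi>_grade[OF _ v(1)] comp(1)[of \<phi>] v by (auto simp: PiE_iff)
      show "\<Phi> \<phi> x = (\<Sum>h\<in>carrier ?Z. (\<lambda>h\<in>carrier ?Z. \<Phi> (components ?Z G i \<phi> (?v h))) h x)"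
        if x: "x \<in> carrier G" for x
      proof -
        have "(\<Sum>h\<in>carrier ?Z. (\<lambda>h\<in>carrier ?Z. \<Phi> (components ?Z G i \<phi> (?v h))) h x) =
            (\<Sum>g\<in>carrier ?Z. \<Phi> (components ?Z G i \<phi> g) x)"
          using u_bij u_closed
          by (subst sum.reindex_bij_betw[OF u_bij, symmetric]) (simp add: bij_betw_inv_into_left)
        then show ?thesis using x comp(2)[of "f x" \<phi>] by (simp add: \<Phi>_def)
      qed
    qed
    then show ?thesis using g u_closed[OF g] bij_betw_inv_into_left[OF u_bij g] by simp
  qed
  have aut: "aut_action G (\<beta> (u g)) (\<Phi> \<psi>) x = aut_action G (\<alpha> g) \<psi> (f x)"
    if "g \<in> carrier ?Z" "x \<in> carrier G" for g x \<psi>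
    using that inv_closed[OF \<beta>_auto[OF u_closed]] by (simp add: aut_action_def \<Phi>_def f_inv)
  have \<Phi>_mult: "\<Phi> (\<phi> \<otimes>\<^bsub>?A\<^esub> \<psi>) = \<Phi> \<phi> \<otimes>\<^bsub>?B\<^esub> \<Phi> \<psi>" for \<phi> \<psi>
  proof (rule extensionalityI[of _ "carrier G"])
    fix x assume x: "x \<in> carrier G"
    have "(\<Phi> \<phi> \<otimes>\<^bsub>?B\<^esub> \<Phi> \<psi>) x =
        (\<Sum>g\<in>carrier ?Z. components ?Z G j (\<Phi> \<phi>) (u g) x * aut_action G (\<beta> (u g)) (\<Phi> \<psi>) x)"
      using x by (simp add: graded_twisting_def sum.reindex_bij_betw[OF u_bij, of
        "\<lambda>g. components ?Z G j (\<Phi> \<phi>) g x * aut_action G (\<beta> g) (\<Phi> \<psi>) x"])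
    also have "\<dots> = (\<Sum>g\<in>carrier ?Z. components ?Z G i \<phi> g (f x) * aut_action G (\<alpha> g) \<psi> (f x))"
      using x by (intro sum.cong) (simp_all only: \<Phi>_comp aut, simp add: \<Phi>_def)
    finally show "\<Phi> (\<phi> \<otimes>\<^bsub>?A\<^esub> \<psi>) x = (\<Phi> \<phi> \<otimes>\<^bsub>?B\<^esub> \<Phi> \<psi>) x"
      using x by (simp add: \<Phi>_def graded_twisting_def)
  qed (simp_all add: \<Phi>_def graded_twisting_def)
  have \<Phi>_antipode: "\<Phi> (antipode ?A \<phi>) = antipode ?B (\<Phi> \<phi>)" for \<phi>
  proof (rule extensionalityI[of _ "carrier G"])
    let ?S = "antipode (function_hopf G :: ('k, 'g \<Rightarrow> 'k) hopf_algebra)"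
    have S: "?S (\<Phi> \<psi>) = \<Phi> (?S \<psi>)" for \<psi>
      by (auto simp: \<Phi>_def function_hopf_def hopf_algebra.defs module.defs f.hom_inv)
    fix x assume x: "x \<in> carrier G"
    have "antipode ?B (\<Phi> \<phi>) x = (\<Sum>g\<in>carrier ?Z. aut_action G (\<beta> (inv\<^bsub>?Z\<^esub> (u g)))
        (?S (components ?Z G j (\<Phi> \<phi>) (u g))) x)"
      using x by (simp add: graded_twisting_def sum.reindex_bij_betw[OF u_bij, of
        "\<lambda>g. aut_action G (\<beta> (inv\<^bsub>?Z\<^esub> g)) (?S (components ?Z G j (\<Phi> \<phi>) g)) x"]
        del: inv_integer_mod_group)
    also have "\<dots> = (\<Sum>g\<in>carrier ?Z. aut_action G (\<alpha> (inv\<^bsub>?Z\<^esub> g)) (?S (components ?Z G i \<phi> g)) (f x))"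
      using x A.\<Gamma>.inv_closed by (intro sum.cong) (simp_all only: \<Phi>_comp u_inv[symmetric] S aut)
    finally show "\<Phi> (antipode ?A \<phi>) x = antipode ?B (\<Phi> \<phi>) x"
      using x by (simp add: \<Phi>_def graded_twisting_def del: inv_integer_mod_group)
  qed (simp_all add: \<Phi>_def graded_twisting_def)
  have \<Phi>_delta: "\<Phi> (delta_fun G (f x)) = delta_fun G x" if "x \<in> carrier G" for x
    using f_bij that by (auto simp: \<Phi>_def delta_fun_def bij_betw_def inj_on_eq_iff intro!: restrict_ext)
  have \<Phi>_comult: "comult ?B (\<Phi> \<phi>) = tensor_map ?B \<Phi> (comult ?A \<phi>)" for \<phi>
  proof -
    let ?t = "\<lambda>x y. Poly_Mapping.single (\<Phi> (delta_fun G x), \<Phi> (delta_fun G y)) (\<phi> (x \<otimes>\<^bsub>G\<^esub> y))"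
    have "tensor_map ?B \<Phi> (comult ?A \<phi>) =
        tensor_class (function_algebra G) (\<Sum>x\<in>carrier G. \<Sum>y\<in>carrier G. ?t x y)"
      by (rule tensor_map_comult) (auto simp: \<Phi>_def intro!: restrict_ext)
    \<comment> \<open>Substituting f x and f y for the summation variables turns the pulled back
      delta functions into delta functions.\<close>
    also have "(\<Sum>x\<in>carrier G. \<Sum>y\<in>carrier G. ?t x y) = (\<Sum>x\<in>carrier G. \<Sum>y\<in>carrier G. ?t (f x) y)"
      by (rule sum.reindex_bij_betw[OF f_bij, symmetric])
    also have "\<dots> = (\<Sum>x\<in>carrier G. \<Sum>y\<in>carrier G. ?t (f x) (f y))"
      by (intro sum.cong refl sum.reindex_bij_betw[OF f_bij, symmetric])
    also have "\<dots> = (\<Sum>x\<in>carrier G. \<Sum>y\<in>carrier G.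
        Poly_Mapping.single (delta_fun G x, delta_fun G y) (\<Phi> \<phi> (x \<otimes>\<^bsub>G\<^esub> y)))"
      by (intro sum.cong refl) (simp add: \<Phi>_delta, simp add: \<Phi>_def f_mult)
    finally show ?thesis by (simp add: graded_twisting_simps(6))
  qed
  have "bij_betw \<Phi> ?E ?E"
  proof (rule bij_betw_byWitness[of _ "\<lambda>\<phi>. \<lambda>x\<in>carrier G. \<phi> ((inv\<^bsub>AutoGroup G\<^esub> f) x)"])
    show "\<forall>\<phi>\<in>?E. (\<lambda>x\<in>carrier G. \<Phi> \<phi> ((inv\<^bsub>AutoGroup G\<^esub> f) x)) = \<phi>"
      using A.G.auto_inv(2)[OF f] inv_closed[OF f]
      by (auto simp: \<Phi>_def fun_eq_iff extensional_def)
    show "\<forall>\<phi>\<in>?E. \<Phi> (\<lambda>x\<in>carrier G. \<phi> ((inv\<^bsub>AutoGroup G\<^esub> f) x)) = \<phi>"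
      using A.G.auto_inv(3)[OF f] by (auto simp: \<Phi>_def fun_eq_iff extensional_def)
  qed (auto simp: \<Phi>_def)
  then have "\<Phi> \<in> hopf_iso ?A ?B"
    unfolding hopf_iso_def ring_hom_def
    using \<Phi>_E \<Phi>_mult \<Phi>_comult \<Phi>_antipode f.hom_one
    by (auto simp: graded_twisting_simps(1-5)) (auto simp: \<Phi>_def intro!: restrict_ext)
  then show ?thesis unfolding hopf_isomorphic_def by blast
qed

theorem theorem4p27:
  fixes G :: "('g, 'm) monoid_scheme"
    and p :: nat
    and i j :: "(int \<Rightarrow> 'k::{alg_closed_field, field_char_0}) \<Rightarrow> 'g"
    and \<alpha> \<beta> :: "int \<Rightarrow> 'g \<Rightarrow> 'g"
    and H :: "'g set monoid"
  assumes "group G" and "finite (carrier G)"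
    and "cyclic_group (G\<lparr>carrier := group_center G\<rparr>)"
    and "Factorial_Ring.prime p"
    and "cocentral_action (integer_mod_group p) G i \<alpha>"
    and "cocentral_action (integer_mod_group p) G j \<beta>"
    and "H = G Mod (i ` carrier (dual_group (integer_mod_group p)))"
    and "trivial_group (hom_group H (integer_mod_group p))"
    and "trivial_group (cohomology2 H (field_units :: 'k monoid)) \<or>
      cyclic_group (cohomology2 H (field_units :: 'k monoid)) \<and>
      Coset.order (cohomology2 H (field_units :: 'k monoid)) = p"
  shows "hopf_isomorphic (graded_twisting (integer_mod_group p) G i \<alpha>)
      (graded_twisting (integer_mod_group p) G j \<beta>)
    \<longleftrightarrow> cocentral_equiv (integer_mod_group p) G i \<alpha> j \<beta>"
proof
  assume "cocentral_equiv (integer_mod_group p) G i \<alpha> j \<beta>"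
  then show "hopf_isomorphic (graded_twisting (integer_mod_group p) G i \<alpha>)
      (graded_twisting (integer_mod_group p) G j \<beta>)"
    by (rule hopf_isomorphic_if_cocentral_equiv[OF assms(5,6,4)])
next
  assume "hopf_isomorphic (graded_twisting (integer_mod_group p) G i \<alpha>)
      (graded_twisting (integer_mod_group p) G j \<beta>)"
  then obtain f where f: "f \<in> hopf_iso (graded_twisting (integer_mod_group p) G i \<alpha>)
      (graded_twisting (integer_mod_group p) G j \<beta>)"
    by (auto simp: hopf_isomorphic_def)
  have "1 \<in> carrier (integer_mod_group p)" using assms(4) by auto
  \<comment> \<open>The value at 1 of a character that separates 1 from the identity of Z_p serves
    as the nontrivial p-th root of unity.\<close>
  then obtain \<chi> :: "int \<Rightarrow> 'k" where \<chi>: "\<chi> \<in> carrier (dual_group (integer_mod_group p))" "\<chi> 1 \<noteq> 1"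
    using dual_integer_mod_group_separates[OF assms(4), of 1] by auto
  interpret \<chi>: group_hom "integer_mod_group p" "field_units :: 'k monoid" \<chi>
    using \<chi>(1) comm_group_field_units[where 'k = 'k]
    by (simp add: dual_group_def hom_group_def group_hom_def group_hom_axioms_def comm_group_def)
  have pow: "c [^]\<^bsub>field_units\<^esub> n = c ^ n" for c :: 'k and n :: nat
    by (induction n) (simp_all add: mult.commute)
  have "\<chi> 1 ^ p = 1"
    using \<chi>.hom_nat_pow[OF \<open>1 \<in> carrier (integer_mod_group p)\<close>, of p] \<chi>.hom_one by (simp add: pow)
  then have "prime_root p (\<chi> 1)" using \<chi>(2) assms(4) by unfold_locales
  then show "cocentral_equiv (integer_mod_group p) G i \<alpha> j \<beta>"
    using cocentral_equiv_if_hopf_isomorphic[OF _ _ assms(3) _ f] assms(5-8)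
    by (simp add: zp_action_def)
qed

end
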